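(* Let $K\geq 1$ be an integer and let $s>0$. Then the supremum $$\sup\left\{\sum_{k=1}^{K}\int_{\Omega}|f_k(z)|^2e^{-\pi|z|^2}\,dA(z)\;:\;\Omega\subset\mathbb{C}\text{ measurable},\ |\Omega|=s,\ f_1,\ldots,f_K\text{ orthonormal in }\mathcal{F}\right\}$$ is attained.
   Context: The Fock space $\mathcal{F}$ is the Hilbert space of entire functions $f:\mathbb{C}\to\mathbb{C}$ with $\|f\|^2=\int_{\mathbb{C}}|f(z)|^2e^{-\pi|z|^2}\,dA(z)<\infty$, where $dA$ is Lebesgue measure on $\mathbb{C}$, with inner product $\langle f,g\rangle=\int_{\mathbb{C}}f(z)\overline{g(z)}e^{-\pi|z|^2}\,dA(z)$. $|\Omega|$ denotes the Lebesgue measure of $\Omega\subset\mathbb{C}$. *)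

theory Defs
  imports "HOL-Complex_Analysis.Complex_Analysis"
begin

definition fock_space :: "(complex \<Rightarrow> complex) set" where
  "fock_space = {f. f holomorphic_on UNIV \<and>
     integrable lebesgue (\<lambda>z. (cmod (f z))\<^sup>2 * exp (- pi * (cmod z)\<^sup>2))}"

definition fock_inner :: "(complex \<Rightarrow> complex) \<Rightarrow> (complex \<Rightarrow> complex) \<Rightarrow> complex" where
  "fock_inner f g =
     (LINT z|lebesgue. f z * cnj (g z) * complex_of_real (exp (- pi * (cmod z)\<^sup>2)))"

definition fock_orthonormal :: "nat \<Rightarrow> (nat \<Rightarrow> complex \<Rightarrow> complex) \<Rightarrow> bool" where
  "fock_orthonormal K f \<longleftrightarrow>
     (\<forall>k\<in>{1..K}. f k \<in> fock_space) \<and>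
     (\<forall>j\<in>{1..K}. \<forall>k\<in>{1..K}. fock_inner (f j) (f k) = (if j = k then 1 else 0))"

definition fock_concentration ::
  "nat \<Rightarrow> complex set \<Rightarrow> (nat \<Rightarrow> complex \<Rightarrow> complex) \<Rightarrow> real" where
  "fock_concentration K \<Omega> f =
     (\<Sum>k=1..K. LINT z:\<Omega>|lebesgue. (cmod (f k z))\<^sup>2 * exp (- pi * (cmod z)\<^sup>2))"

definition concentration_values :: "nat \<Rightarrow> real \<Rightarrow> real set" where
  "concentration_values K s =
     {fock_concentration K \<Omega> f | \<Omega> f.
        \<Omega> \<in> sets lebesgue \<and> emeasure lebesgue \<Omega> = ennreal s \<and> fock_orthonormal K f}"

end

theory Submission
  imports Defs
begin

text \<open>The supremum is attained by a disc together with the first K normalised monomials.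
  In the basis of normalised monomials, the localisation operator of the dilated set \<open>r S\<close> has matrix
  \<open>r\<^sup>2 C(r)\<close>, and \<open>(r/2) C' = (N C + C N)/2 - a C a\<^sup>*\<close> for the annihilation operator \<open>a\<close> and
  the number operator \<open>N = a\<^sup>* a\<close>.
  Because \<open>a a\<^sup>* - a\<^sup>* a = 1\<close>, the sum \<open>L\<^sub>n\<close> of the \<open>n\<close> largest eigenvalues of \<open>C\<close> satisfies
  \<open>(r/2) L\<^sub>n' \<ge> - n (L\<^sub>n\<^sub>+\<^sub>1 - L\<^sub>n)\<close>, while the sums of the first \<open>n\<close> diagonal entries of the disc
  satisfy this with equality. Hence the least difference over \<open>n\<close> between the disc and \<open>S\<close> can only
  grow as \<open>r\<close> decreases. As \<open>r\<close> tends to infinity it is asymptotically nonnegative, since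
  \<open>L\<^sub>n \<le> min (n/r\<^sup>2) |S|\<close> and a Chernoff bound shows that the disc almost reaches this value.
  This is the infinitesimal argument by which De Palma, Trevisan and Giovannetti proved that
  passive states optimise the quantum-limited attenuator. It is run on matrices truncated to
  degree below \<open>M\<close>, where boundedness of \<open>S\<close> makes the truncation error vanish as \<open>M\<close> grows.\<close>

section \<open>Spectral theorem for Hermitian matrices\<close>

text \<open>The inequality for \<open>n\<close> contains the eigenvalue sum for
  \<open>n + 1\<close>, so no single \<open>n\<close> can be followed alone along the dilation. At a
  minimising \<open>n\<close> the missing information is available: the step from \<open>n\<close>
  to \<open>n + 1\<close> is at least as large for the disc as for \<open>S\<close>. Eigenvalues may
  cross as \<open>r\<close> moves, so they are never differentiated. Ky Fan's principle bounds an
  eigenvalue sum from below by the form on fixed vectors, and only that form is differentiated. The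
  order of the two limits matters. At the large dilation \<open>r1\<close> the error must not depend
  on \<open>n\<close>, hence not on \<open>M\<close>, so that \<open>r1\<close> can be fixed first.
  Truncation then costs the last row and column of a matrix of size \<open>M + 1\<close>; on the
  fixed range of dilations its entries are of order \<open>fock_coeff M * (r1 * R) ^ M\<close>,
  which beats every power of \<open>M\<close>. Orthonormal functions lose orthonormality when their
  coefficients are cut off at \<open>M\<close>. The eigenvalue bound is therefore proved for
  families that satisfy only two Bessel-type inequalities.\<close>

definition cip :: "nat \<Rightarrow> (nat \<Rightarrow> complex) \<Rightarrow> (nat \<Rightarrow> complex) \<Rightarrow> complex" where
  "cip M v w = (\<Sum>i<M. v i * cnj (w i))"

text \<open>The dimension \<open>M\<close> is an argument and vectors are functions on all naturals,
  so one infinite matrix can be restricted to index sets of different sizes; \<open>M\<close> and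
  \<open>Suc M\<close> occur together below.\<close>

definition sesq :: "nat \<Rightarrow> (nat \<Rightarrow> nat \<Rightarrow> complex) \<Rightarrow> (nat \<Rightarrow> complex) \<Rightarrow> (nat \<Rightarrow> complex) \<Rightarrow> complex" where
  "sesq M H v w = (\<Sum>i<M. \<Sum>j<M. H i j * v i * cnj (w j))"

definition ons :: "nat \<Rightarrow> nat \<Rightarrow> (nat \<Rightarrow> nat \<Rightarrow> complex) \<Rightarrow> bool" where
  "ons M n e \<longleftrightarrow> (\<forall>j<n. \<forall>k<n. cip M (e j) (e k) = (if j = k then 1 else 0))"

lemma mult_cnj_self: "z * cnj z = complex_of_real ((cmod z)\<^sup>2)"
  by (simp only: of_real_power flip: complex_norm_square)

lemma cip_self: "cip M v v = complex_of_real (\<Sum>i<M. (cmod (v i))\<^sup>2)"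
  by (simp only: cip_def mult_cnj_self of_real_sum)

lemma Re_cip_self: "Re (cip M v v) = (\<Sum>i<M. (cmod (v i))\<^sup>2)"
  by (simp add: cip_self)

lemma cip_cnj: "cnj (cip M v w) = cip M w v"
  by (simp add: cip_def mult.commute)

lemma cip_add_left: "cip M (\<lambda>i. v i + w i) u = cip M v u + cip M w u"
  by (simp add: cip_def sum.distrib algebra_simps)

lemma cip_add_right: "cip M u (\<lambda>i. v i + w i) = cip M u v + cip M u w"
  by (simp add: cip_def sum.distrib algebra_simps)

lemma cip_diff_left: "cip M (\<lambda>i. v i - w i) u = cip M v u - cip M w u"
  by (simp add: cip_def sum_subtractf algebra_simps)

lemma cip_diff_right: "cip M u (\<lambda>i. v i - w i) = cip M u v - cip M u w"
  by (simp add: cip_def sum_subtractf algebra_simps)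

lemma cip_mult_left: "cip M (\<lambda>i. c * v i) u = c * cip M v u"
  by (simp add: cip_def sum_distrib_left algebra_simps)

lemma cip_mult_right: "cip M u (\<lambda>i. c * v i) = cnj c * cip M u v"
  by (simp add: cip_def sum_distrib_left algebra_simps)

lemma cip_sum_left: "cip M (\<lambda>i. \<Sum>j\<in>A. f j i) u = (\<Sum>j\<in>A. cip M (f j) u)"
  unfolding cip_def by (subst sum.swap) (simp add: sum_distrib_right)

lemma cip_sum_right: "cip M u (\<lambda>i. \<Sum>j\<in>A. f j i) = (\<Sum>j\<in>A. cip M u (f j))"
  unfolding cip_def by (subst sum.swap) (simp add: sum_distrib_left)

lemma sesq_add_left: "sesq M H (\<lambda>i. v i + w i) u = sesq M H v u + sesq M H w u"
  by (simp add: sesq_def sum.distrib algebra_simps)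

lemma sesq_add_right: "sesq M H u (\<lambda>i. v i + w i) = sesq M H u v + sesq M H u w"
  by (simp add: sesq_def sum.distrib algebra_simps)

lemma sesq_mult_left: "sesq M H (\<lambda>i. c * v i) u = c * sesq M H v u"
  by (simp add: sesq_def sum_distrib_left algebra_simps)

lemma sesq_mult_right: "sesq M H u (\<lambda>i. c * v i) = cnj c * sesq M H u v"
  by (simp add: sesq_def sum_distrib_left algebra_simps)

lemma sesq_sum_left: "sesq M H (\<lambda>i. \<Sum>j\<in>A. f j i) u = (\<Sum>j\<in>A. sesq M H (f j) u)"
  by (induction A rule: infinite_finite_induct) (simp_all add: sesq_add_left, simp_all add: sesq_def)

lemma sesq_sum_right: "sesq M H u (\<lambda>i. \<Sum>j\<in>A. f j i) = (\<Sum>j\<in>A. sesq M H u (f j))"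
  by (induction A rule: infinite_finite_induct) (simp_all add: sesq_add_right, simp_all add: sesq_def)

lemma sesq_cong: "(\<And>i. i < M \<Longrightarrow> v i = v' i) \<Longrightarrow> (\<And>i. i < M \<Longrightarrow> w i = w' i) \<Longrightarrow> sesq M H v w = sesq M H v' w'"
  by (simp add: sesq_def)

lemma sesq_cnj:
  assumes "\<And>i j. H j i = cnj (H i j)"
  shows "cnj (sesq M H v w) = sesq M H w v"
proof -
  have "cnj (sesq M H v w) = (\<Sum>i<M. \<Sum>j<M. H j i * w j * cnj (v i))"
    by (simp add: sesq_def assms[symmetric] mult_ac)
  also have "\<dots> = sesq M H w v"
    unfolding sesq_def by (rule sum.swap)
  finally show ?thesis .
qed

section \<open>Projection residuals and Bessel's inequality\<close>

lemma cip_residual: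
  assumes "ons M k e"
  shows "cip M (\<lambda>i. v i - (\<Sum>j<k. cip M v (e j) * e j i)) (\<lambda>i. v i - (\<Sum>j<k. cip M v (e j) * e j i))
           = complex_of_real (Re (cip M v v) - (\<Sum>j<k. (cmod (cip M v (e j)))\<^sup>2))" (is "cip M ?r ?r = _")
    and "l < k \<Longrightarrow> cip M (\<lambda>i. v i - (\<Sum>j<k. cip M v (e j) * e j i)) (e l) = 0"
proof -
  have orth: "cip M ?r (e l) = 0" if "l < k" for l
  proof -
    have "cip M ?r (e l) = cip M v (e l) - (\<Sum>j<k. cip M v (e j) * (if j = l then 1 else 0))"
      using assms that by (simp add: cip_diff_left cip_sum_left cip_mult_left ons_def)
    also have "\<dots> = 0"
      using that by (simp add: mult_delta_right)
    finally show ?thesis .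
  qed
  show "l < k \<Longrightarrow> cip M ?r (e l) = 0" by (rule orth)
  have "cip M ?r ?r = cip M ?r v - (\<Sum>j<k. cnj (cip M v (e j)) * cip M ?r (e j))"
    by (simp only: cip_diff_right cip_sum_right cip_mult_right)
  also have "\<dots> = cip M ?r v"
    by (simp add: orth)
  also have "\<dots> = cip M v v - (\<Sum>j<k. cip M v (e j) * cnj (cip M v (e j)))"
    by (simp add: cip_diff_left cip_sum_left cip_mult_left cip_cnj)
  also have "\<dots> = complex_of_real (Re (cip M v v) - (\<Sum>j<k. (cmod (cip M v (e j)))\<^sup>2))"
    by (simp only: cip_self mult_cnj_self of_real_diff Re_complex_of_real) (simp only: of_real_sum)
  finally show "cip M ?r ?r = complex_of_real (Re (cip M v v) - (\<Sum>j<k. (cmod (cip M v (e j)))\<^sup>2))" .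
qed

lemma cip_bessel:
  assumes "ons M k e"
  shows "(\<Sum>j<k. (cmod (cip M v (e j)))\<^sup>2) \<le> (\<Sum>i<M. (cmod (v i))\<^sup>2)"
proof -
  have "0 \<le> Re (cip M v v) - (\<Sum>j<k. (cmod (cip M v (e j)))\<^sup>2)"
    using arg_cong[OF cip_residual(1)[OF assms, of v], of Re] 
    by (metis (no_types, lifting) Re_cip_self Re_complex_of_real sum_nonneg zero_le_power2)
  then show ?thesis by (simp add: Re_cip_self)
qed

text \<open>The trace of the projection onto the complement of the family, computed in the standard basis.
  It yields both completeness for k = M and the existence of a further vector for k < M.\<close>

lemma sum_residual_basis:
  assumes "ons M k e"
  shows "(\<Sum>i<M. \<Sum>m<M. (cmod ((if m = i then 1 else 0) - (\<Sum>j<k. cnj (e j i) * e j m)))\<^sup>2)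
          = real M - real k"
proof -
  have del: "cip M (\<lambda>m. if m = i then 1 else 0) v = cnj (v i)" if "i < M" for i v
    using that by (simp add: cip_def if_distrib[of "\<lambda>x. x * _"] cong: if_cong)
  have "(\<Sum>m<M. (cmod ((if m = i then 1 else 0) - (\<Sum>j<k. cnj (e j i) * e j m)))\<^sup>2)
      = 1 - (\<Sum>j<k. (cmod (e j i))\<^sup>2)" if "i < M" for i
    using arg_cong[OF cip_residual(1)[OF assms, of "\<lambda>m. if m = i then 1 else 0"], of Re] that
    unfolding Re_cip_self by (simp add: del if_distrib[of cmod] if_distrib[of "\<lambda>x. x^2"] cong: if_cong)
  then have "(\<Sum>i<M. \<Sum>m<M. (cmod ((if m = i then 1 else 0) - (\<Sum>j<k. cnj (e j i) * e j m)))\<^sup>2)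
      = (\<Sum>i<M. 1 - (\<Sum>j<k. (cmod (e j i))\<^sup>2))"
    by simp
  also have "\<dots> = real M - (\<Sum>j<k. \<Sum>i<M. (cmod (e j i))\<^sup>2)"
    by (simp add: sum_subtractf sum.swap[of _ "{..<k}"])
  also have "(\<Sum>j<k. \<Sum>i<M. (cmod (e j i))\<^sup>2) = (\<Sum>j<k. 1)"
    using assms by (intro sum.cong refl) (simp add: ons_def flip: Re_cip_self)
  finally show ?thesis by simp
qed

text \<open>The residuals of the standard basis vectors have total squared norm
  \<open>M - k\<close>, which is positive, so one of them is nonzero and can be normalised. Entries
  from \<open>M\<close> on are set to zero so that \<open>v\<close> lies in the compact set used in
  \<open>rayleigh_maximizer\<close>.\<close>

lemma ons_extend:
  assumes "ons M k e" "k < M"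
  obtains v where "cip M v v = 1" "\<And>j. j < k \<Longrightarrow> cip M v (e j) = 0" "\<And>i. i \<ge> M \<Longrightarrow> v i = 0"
proof -
  define r where "r i m = (if m = i then 1 else 0) - (\<Sum>j<k. cnj (e j i) * e j m)" for i m
  have "\<exists>i<M. (\<Sum>m<M. (cmod (r i m))\<^sup>2) \<noteq> 0"
  proof (rule ccontr)
    assume "\<not> ?thesis"
    then have "(\<Sum>i<M. \<Sum>m<M. (cmod (r i m))\<^sup>2) = 0" by simp
    then show False
      using sum_residual_basis[OF assms(1)] \<open>k < M\<close> by (simp add: r_def)
  qed
  then obtain i where i: "i < M" and nz: "(\<Sum>m<M. (cmod (r i m))\<^sup>2) \<noteq> 0" by blast
  define S where "S = (\<Sum>m<M. (cmod (r i m))\<^sup>2)"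
  have S: "S > 0"
    using nz by (simp add: S_def order_less_le sum_nonneg)
  have del: "cip M (\<lambda>m. if m = i then 1 else 0) v = cnj (v i)" for v
    using i by (simp add: cip_def if_distrib[of "\<lambda>x. x * _"] cong: if_cong)
  have orth: "cip M (r i) (e j) = 0" if "j < k" for j
    using cip_residual(2)[OF assms(1) that, of "\<lambda>m. if m = i then 1 else 0"]
    by (simp add: r_def[abs_def] del)
  define v where "v m = (if m < M then complex_of_real (1 / sqrt S) * r i m else 0)" for m
  have v: "cip M v u = complex_of_real (1 / sqrt S) * cip M (r i) u" for u
    unfolding cip_mult_left[symmetric] by (simp add: cip_def v_def)
  show ?thesis
  proof
    have "cip M v v = complex_of_real (1 / sqrt S) * cnj (cip M v (r i))"
      by (subst v) (simp only: cip_cnj)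
    also have "\<dots> = complex_of_real (1 / sqrt S) * complex_of_real (1 / sqrt S) * complex_of_real S"
      unfolding v by (simp add: cip_self S_def)
    also have "\<dots> = complex_of_real (1 / sqrt S * (1 / sqrt S) * S)"
      by (simp only: of_real_mult)
    also have "1 / sqrt S * (1 / sqrt S) * S = 1"
      using S by (simp add: field_simps)
    finally show "cip M v v = 1" by simp
    show "j < k \<Longrightarrow> cip M v (e j) = 0" for j
      by (simp add: v orth)
    show "i \<ge> M \<Longrightarrow> v i = 0" for i
      by (simp add: v_def)
  qed
qed

section \<open>Successive Rayleigh maximisation\<close>

lemma compact_fun_cball:
  "compact {v :: nat \<Rightarrow> complex. (\<forall>i. v i \<in> (if i < M then cball 0 1 else {0}))}"
proof -
  \<comment> \<open>Vectors are functions on all naturals, so compactness is Tychonoff's theorem for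
    a product of discs; the coordinates from \<open>M\<close> on are confined to a point.\<close>
  have "compactin (product_topology (\<lambda>i. euclidean) UNIV) (PiE UNIV (\<lambda>i. if i < M then cball 0 1 else {0::complex}))"
    unfolding compactin_PiE by auto
  then show ?thesis
    by (simp add: euclidean_product_topology PiE_UNIV_domain Pi_def)
qed

lemma continuous_on_cip: "continuous_on A (\<lambda>v. cip M v w)"
  unfolding cip_def by (intro continuous_intros continuous_on_product_coordinates[THEN continuous_on_subset]) auto

lemma continuous_on_cip_self: "continuous_on A (\<lambda>v. cip M v v)"
  unfolding cip_def by (intro continuous_intros continuous_on_product_coordinates[THEN continuous_on_subset]) auto

lemma continuous_on_sesq_self: "continuous_on A (\<lambda>v. sesq M H v v)"
  unfolding sesq_def by (intro continuous_intros continuous_on_product_coordinates[THEN continuous_on_subset]) auto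

text \<open>A continuous form attains its maximum on the compact set of unit vectors orthogonal to
  the family, which is nonempty by \<open>ons_extend\<close>. The bound is homogeneous in
  \<open>u\<close> so that perturbed vectors can be inserted without normalising them.\<close>

lemma rayleigh_maximizer:
  assumes "ons M k e" "k < M"
  obtains v where "cip M v v = 1" "\<And>j. j < k \<Longrightarrow> cip M v (e j) = 0"
    "\<And>u. (\<And>j. j < k \<Longrightarrow> cip M u (e j) = 0) \<Longrightarrow> Re (sesq M H u u) \<le> Re (sesq M H v v) * Re (cip M u u)"
proof -
  define S where "S = {v. (\<forall>i. v i \<in> (if i < M then cball 0 1 else {0}))} \<inter>
    ({v. cip M v v = 1} \<inter> (\<Inter>j\<in>{..<k}. {v. cip M v (e j) = 0}))"
  have "compact S"
    unfolding S_def
    by (intro compact_Int_closed compact_fun_cball closed_Int closed_INT ballI)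
       (auto intro!: closed_Collect_eq continuous_on_cip continuous_on_cip_self)
  have inS: "v \<in> S" if "cip M v v = 1" "\<And>j. j < k \<Longrightarrow> cip M v (e j) = 0" "\<And>i. i \<ge> M \<Longrightarrow> v i = 0" for v
  proof -
    have "(cmod (v i))\<^sup>2 \<le> 1" if "i < M" for i
    proof -
      have "(cmod (v i))\<^sup>2 \<le> (\<Sum>i<M. (cmod (v i))\<^sup>2)"
        using that by (intro member_le_sum) auto
      also have "\<dots> = 1"
        using \<open>cip M v v = 1\<close> by (simp flip: Re_cip_self)
      finally show ?thesis .
    qed
    then have "cmod (v i) \<le> 1" if "i < M" for i
      using that by (simp add: power2_le_iff_abs_le abs_square_le_1)
    then show ?thesis
      using that by (auto simp: S_def)
  qed
  have "S \<noteq> {}"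
    using ons_extend[OF assms] inS by (metis empty_iff)
  then obtain v where v: "v \<in> S" and max: "\<And>u. u \<in> S \<Longrightarrow> Re (sesq M H u u) \<le> Re (sesq M H v v)"
    using continuous_attains_sup[OF \<open>compact S\<close>, of "\<lambda>v. Re (sesq M H v v)"]
    by (metis continuous_on_Re continuous_on_sesq_self)
  show ?thesis
  proof
    show "cip M v v = 1" "\<And>j. j < k \<Longrightarrow> cip M v (e j) = 0"
      using v by (auto simp: S_def)
    fix u assume u: "\<And>j. j < k \<Longrightarrow> cip M u (e j) = 0"
    define s where "s = Re (cip M u u)"
    show "Re (sesq M H u u) \<le> Re (sesq M H v v) * Re (cip M u u)"
    proof (cases "s = 0")
      case True
      then have "u i = 0" if "i < M" for i
        using that by (simp add: s_def Re_cip_self sum_nonneg_eq_0_iff)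
      then show ?thesis
        using True by (simp add: sesq_def s_def)
    next
      case False
      then have s: "s > 0"
        by (simp add: s_def Re_cip_self order_less_le sum_nonneg)
      define c where "c = complex_of_real (1 / sqrt s)"
      have cc: "c * c * complex_of_real s = 1" "cnj c = c" "c * c = complex_of_real (1 / s)"
        using s by (simp_all add: c_def field_simps flip: of_real_mult)
      \<comment> \<open>\<open>u\<close> is unrestricted beyond \<open>M\<close>, so it is cut off
        there as well as normalised before it can belong to \<open>S\<close>.\<close>
      define w where "w i = (if i < M then c * u i else 0)" for i
      have w: "cip M w x = c * cip M u x" for x
        unfolding cip_mult_left[symmetric] by (simp add: cip_def w_def)
      have s': "cip M u u = complex_of_real s"
        unfolding s_def Re_cip_self unfolding cip_self ..
      have "cip M w w = c * cnj (c * cip M u u)"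
        by (metis w cip_cnj)
      also have "\<dots> = c * c * complex_of_real s"
        by (simp add: s' cc(2))
      also have "\<dots> = 1"
        by (rule cc)
      finally have "w \<in> S"
        by (intro inS) (auto simp: w u, simp add: w_def)
      then have "Re (sesq M H w w) \<le> Re (sesq M H v v)"
        by (rule max)
      also have "sesq M H w w = sesq M H (\<lambda>i. c * u i) (\<lambda>i. c * u i)"
        by (rule sesq_cong) (auto simp: w_def)
      also have "\<dots> = c * c * sesq M H u u"
        by (simp add: sesq_mult_left sesq_mult_right cc(2))
      also have "Re \<dots> = Re (sesq M H u u) / s"
        unfolding cc by simp
      finally show ?thesis
        using s by (simp add: field_simps s_def)
    qed
  qed
qed

text \<open>Write q for \<open>sesq M H u v\<close>. Along \<open>v + t u\<close> the form minus its
  Rayleigh bound vanishes at \<open>t = 0\<close> and has linear part 2 Re (t q). At a maximum no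
  linear part can survive, so q is zero.\<close>

lemma rayleigh_first_order:
  assumes H: "\<And>i j. H j i = cnj (H i j)"
    and v: "cip M v v = 1" and u: "cip M u v = 0"
    and max: "\<And>t. Re (sesq M H (\<lambda>i. v i + t * u i) (\<lambda>i. v i + t * u i))
                 \<le> Re (sesq M H v v) * Re (cip M (\<lambda>i. v i + t * u i) (\<lambda>i. v i + t * u i))"
  shows "sesq M H u v = 0"
proof (rule ccontr)
  assume nz: "sesq M H u v \<noteq> 0"
  define q where "q = sesq M H u v"
  \<comment> \<open>\<open>X\<close> bounds the coefficient of the quadratic part, and the summand 1
    keeps it positive. With \<open>t = s * cnj q\<close> the linear part is 2 s |q|^2, while
    \<open>s = 1 / X\<close> keeps the quadratic part at most half of that.\<close>
  define X where "X = \<bar>Re (sesq M H v v) * Re (cip M u u)\<bar> + \<bar>Re (sesq M H u u)\<bar> + 1"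
  define s where "s = 1 / X"
  have X: "X > 0" "s > 0" by (simp_all add: X_def s_def add_nonneg_pos)
  define t where "t = complex_of_real s * cnj q"
  have vu: "cip M v u = 0" using u cip_cnj by (metis complex_cnj_zero)
  have svu: "sesq M H v u = cnj q" unfolding q_def using sesq_cnj[of H, OF H] by metis
  have qq: "q * cnj q = complex_of_real ((cmod q)\<^sup>2)" by (rule mult_cnj_self)
  have tt: "t * cnj t = complex_of_real (s\<^sup>2 * (cmod q)\<^sup>2)" "t * q = complex_of_real (s * (cmod q)\<^sup>2)"
  proof -
    have "t * cnj t = complex_of_real (s\<^sup>2) * (q * cnj q)" "t * q = complex_of_real s * (q * cnj q)"
      by (simp_all add: t_def power2_eq_square)
    then show "t * cnj t = complex_of_real (s\<^sup>2 * (cmod q)\<^sup>2)" "t * q = complex_of_real (s * (cmod q)\<^sup>2)"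
      unfolding qq by (simp_all only: of_real_mult)
  qed
  have "sesq M H (\<lambda>i. v i + t * u i) (\<lambda>i. v i + t * u i)
     = sesq M H v v + t * q + cnj (t * q) + t * cnj t * sesq M H u u"
    by (simp add: sesq_add_left sesq_add_right sesq_mult_left sesq_mult_right svu q_def[symmetric] algebra_simps)
  then have 1: "Re (sesq M H (\<lambda>i. v i + t * u i) (\<lambda>i. v i + t * u i))
     = Re (sesq M H v v) + 2 * s * (cmod q)\<^sup>2 + s\<^sup>2 * (cmod q)\<^sup>2 * Re (sesq M H u u)"
    unfolding tt by simp
  have "cip M (\<lambda>i. v i + t * u i) (\<lambda>i. v i + t * u i) = 1 + t * cnj t * cip M u u"
    by (simp add: cip_add_left cip_add_right cip_mult_left cip_mult_right u v vu algebra_simps)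
  then have 2: "Re (cip M (\<lambda>i. v i + t * u i) (\<lambda>i. v i + t * u i)) = 1 + s\<^sup>2 * (cmod q)\<^sup>2 * Re (cip M u u)"
    unfolding tt by simp
  have "s * (cmod q)\<^sup>2 * 2 \<le> s * (cmod q)\<^sup>2 * (s * (Re (sesq M H v v) * Re (cip M u u) - Re (sesq M H u u)))"
    using max[of t] unfolding 1 2 by (simp add: algebra_simps power2_eq_square)
  then have "2 \<le> s * (Re (sesq M H v v) * Re (cip M u u) - Re (sesq M H u u))"
    using X nz by (simp add: q_def)
  also have "\<dots> \<le> s * X"
    using X unfolding X_def by (intro mult_left_mono) auto
  also have "\<dots> = 1"
    using X by (simp add: s_def)
  finally show False by simp
qed

text \<open>Choosing each vector as a maximiser on the complement of its predecessors provides both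
  properties of a diagonalisation: comparing \<open>e j\<close> with a later \<open>e k\<close>
  orders the eigenvalues, and perturbing \<open>e j\<close> by a later \<open>e k\<close> makes the
  off-diagonal form vanish.\<close>

lemma hermitian_greedy:
  assumes "n \<le> M"
  shows "\<exists>e. ons M n e \<and> (\<forall>j<n. \<forall>u. (\<forall>i<j. cip M u (e i) = 0) \<longrightarrow>
     Re (sesq M H u u) \<le> Re (sesq M H (e j) (e j)) * Re (cip M u u))"
  using assms
proof (induction n)
  case 0
  then show ?case by (simp add: ons_def)
next
  case (Suc n)
  then obtain e where e: "ons M n e" "\<forall>j<n. \<forall>u. (\<forall>i<j. cip M u (e i) = 0) \<longrightarrow>
     Re (sesq M H u u) \<le> Re (sesq M H (e j) (e j)) * Re (cip M u u)" by auto
  obtain v where v: "cip M v v = 1" "\<And>j. j < n \<Longrightarrow> cip M v (e j) = 0"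
    "\<And>u. (\<And>j. j < n \<Longrightarrow> cip M u (e j) = 0) \<Longrightarrow> Re (sesq M H u u) \<le> Re (sesq M H v v) * Re (cip M u u)"
    using rayleigh_maximizer[OF e(1), of H] Suc.prems by (metis Suc_le_eq)
  have v': "cip M (e j) v = 0" if "j < n" for j
    using v(2)[OF that] cip_cnj by (metis complex_cnj_zero)
  show ?case
  proof (intro exI[of _ "e(n := v)"] conjI allI impI)
    show "ons M (Suc n) (e(n := v))"
      using e(1) v(1,2) v' by (auto simp: ons_def less_Suc_eq)
    fix j u assume j: "j < Suc n" and u: "\<forall>i<j. cip M u ((e(n := v)) i) = 0"
    show "Re (sesq M H u u) \<le> Re (sesq M H ((e(n := v)) j) ((e(n := v)) j)) * Re (cip M u u)"
    proof (cases "j = n")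
      case True
      then show ?thesis using u v(3)[of u] by auto
    next
      case False
      then show ?thesis using e(2) j u by auto
    qed
  qed
qed

lemma ons_complete:
  assumes "ons M M e"
  shows "i < M \<Longrightarrow> m < M \<Longrightarrow> (\<Sum>j<M. cnj (e j i) * e j m) = (if m = i then 1 else 0)"
    and "m < M \<Longrightarrow> (\<Sum>j<M. cip M v (e j) * e j m) = v m"
    and "cip M v w = (\<Sum>j<M. cip M v (e j) * cnj (cip M w (e j)))"
proof -
  have *: "(\<Sum>j<M. cnj (e j i) * e j m) = (if m = i then 1 else 0)" if "i < M" "m < M" for i m
  proof -
    have "(\<Sum>i<M. \<Sum>m<M. (cmod ((if m = i then 1 else 0) - (\<Sum>j<M. cnj (e j i) * e j m)))\<^sup>2) = 0"
      using sum_residual_basis[OF assms] by simp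
    then have "(cmod ((if m = i then 1 else 0) - (\<Sum>j<M. cnj (e j i) * e j m)))\<^sup>2 = 0"
      using that by (simp add: sum_nonneg_eq_0_iff sum_nonneg)
    then show ?thesis by simp
  qed
  show "i < M \<Longrightarrow> m < M \<Longrightarrow> (\<Sum>j<M. cnj (e j i) * e j m) = (if m = i then 1 else 0)"
    by (rule *)
  have **: "(\<Sum>j<M. cip M v (e j) * e j m) = v m" if "m < M" for v m
  proof -
    have "(\<Sum>j<M. cip M v (e j) * e j m) = (\<Sum>i<M. v i * (\<Sum>j<M. cnj (e j i) * e j m))"
      unfolding cip_def sum_distrib_right sum_distrib_left by (subst sum.swap) (simp add: mult_ac)
    also have "\<dots> = (\<Sum>i<M. v i * (if m = i then 1 else 0))"
      using that * by simp
    finally show ?thesis using that by (simp add: mult_delta_right)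
  qed
  show "m < M \<Longrightarrow> (\<Sum>j<M. cip M v (e j) * e j m) = v m" by (rule **)
  have "cip M v w = cip M (\<lambda>m. \<Sum>j<M. cip M v (e j) * e j m) w"
    using ** by (simp add: cip_def)
  also have "\<dots> = (\<Sum>j<M. cip M v (e j) * cnj (cip M w (e j)))"
    by (simp add: cip_sum_left cip_mult_left cip_cnj)
  finally show "cip M v w = (\<Sum>j<M. cip M v (e j) * cnj (cip M w (e j)))" .
qed

theorem hermitian_spectral:
  assumes H: "\<And>i j. H j i = cnj (H i j)"
  obtains e lam where "ons M M e" "\<And>j k. j \<le> k \<Longrightarrow> k < M \<Longrightarrow> lam k \<le> lam j"
    "\<And>v w. sesq M H v w = (\<Sum>j<M. complex_of_real (lam j) * cip M v (e j) * cnj (cip M w (e j)))"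
proof -
  obtain e where e: "ons M M e" and max: "\<And>j u. j < M \<Longrightarrow> (\<And>i. i<j \<Longrightarrow> cip M u (e i) = 0) \<Longrightarrow>
     Re (sesq M H u u) \<le> Re (sesq M H (e j) (e j)) * Re (cip M u u)"
    using hermitian_greedy[of M M H] by blast
  define lam where "lam j = Re (sesq M H (e j) (e j))" for j
  have one: "cip M (e j) (e k) = (if j = k then 1 else 0)" if "j < M" "k < M" for j k
    using e that by (simp add: ons_def)
  have off: "sesq M H (e k) (e j) = 0" if "j < k" "k < M" for j k
  proof (rule rayleigh_first_order[of H, OF H])
    show "cip M (e j) (e j) = 1" "cip M (e k) (e j) = 0"
      using that by (auto simp: one)
    show "Re (sesq M H (\<lambda>i. e j i + t * e k i) (\<lambda>i. e j i + t * e k i))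
       \<le> Re (sesq M H (e j) (e j)) * Re (cip M (\<lambda>i. e j i + t * e k i) (\<lambda>i. e j i + t * e k i))" for t
      using that by (intro max) (auto simp: cip_add_left cip_mult_left one)
  qed
  have diag: "sesq M H (e j) (e k) = (if j = k then complex_of_real (lam j) else 0)" if "j < M" "k < M" for j k
  proof (cases j k rule: linorder_cases)
    case less
    then show ?thesis using off[of j k] that sesq_cnj[of H, OF H] by (metis complex_cnj_zero nat_neq_iff)
  next
    case equal
    have "cnj (sesq M H (e j) (e j)) = sesq M H (e j) (e j)"
      using sesq_cnj[of H, OF H] .
    then show ?thesis using equal by (simp add: lam_def complex_eq_iff)
  next
    case greater
    then show ?thesis using off[of k j] that by simp
  qed
  show ?thesis
  proof
    show "ons M M e" by (rule e)
    show "lam k \<le> lam j" if "j \<le> k" "k < M" for j k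
      using max[of j "e k"] that by (simp add: lam_def one)
    fix v w
    have "sesq M H v w = sesq M H (\<lambda>i. \<Sum>j<M. cip M v (e j) * e j i) (\<lambda>i. \<Sum>j<M. cip M w (e j) * e j i)"
      using ons_complete(2)[OF e] by (intro sesq_cong) simp_all
    also have "\<dots> = (\<Sum>j<M. cip M v (e j) * (\<Sum>k<M. cnj (cip M w (e k)) * sesq M H (e j) (e k)))"
      by (simp add: sesq_sum_left sesq_mult_left sesq_sum_right sesq_mult_right)
    also have "\<dots> = (\<Sum>j<M. cip M v (e j) * (\<Sum>k<M. cnj (cip M w (e k)) * (if j = k then complex_of_real (lam j) else 0)))"
      by (intro sum.cong refl) (simp_all add: diag)
    also have "\<dots> = (\<Sum>j<M. complex_of_real (lam j) * cip M v (e j) * cnj (cip M w (e j)))"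
      by (simp add: mult_delta_right mult_ac)
    finally show "sesq M H v w = \<dots>" .
  qed
qed

section \<open>Eigenvalue sums along the dilation flow\<close>

text \<open>In coordinates with respect to the normalised monomials this is multiplication by
  sqrt(pi) z, and \<open>annihilation\<close> is d/dz divided by sqrt(pi).\<close>

definition creation :: "(nat \<Rightarrow> complex) \<Rightarrow> nat \<Rightarrow> complex" where
  "creation v i = (case i of 0 \<Rightarrow> 0 | Suc j \<Rightarrow> complex_of_real (sqrt (real (Suc j))) * v j)"

definition annihilation :: "(nat \<Rightarrow> complex) \<Rightarrow> nat \<Rightarrow> complex" where
  "annihilation v i = complex_of_real (sqrt (real (Suc i))) * v (Suc i)"

lemma creation_simps [simp]: "creation v 0 = 0" "creation v (Suc j) = complex_of_real (sqrt (real (Suc j))) * v j"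
  by (simp_all add: creation_def)

text \<open>Only an inequality, since the top entry is raised out of the truncation. The weight
  \<open>Suc i\<close> here against \<open>i\<close> in \<open>annihilation_sq\<close> is where the
  commutator enters the proof.\<close>

lemma norm_creation_sq: "(\<Sum>i<M. (cmod (creation v i))\<^sup>2) \<le> (\<Sum>i<M. real (Suc i) * (cmod (v i))\<^sup>2)"
proof (cases M)
  case (Suc N)
  then have "(\<Sum>i<M. (cmod (creation v i))\<^sup>2) = (\<Sum>i<N. real (Suc i) * (cmod (v i))\<^sup>2)"
    by (simp add: sum.lessThan_Suc_shift norm_mult power_mult_distrib del: sum.lessThan_Suc)
  also have "\<dots> \<le> (\<Sum>i<M. real (Suc i) * (cmod (v i))\<^sup>2)"
    using Suc by (intro sum_mono2) auto
  finally show ?thesis .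
qed simp

lemma cip_creation_annihilation:
  "cip M (creation v) w = cip (M - 1) v (annihilation w)"
proof (cases M)
  case (Suc N)
  then show ?thesis
    by (simp add: cip_def sum.lessThan_Suc_shift annihilation_def mult_ac del: sum.lessThan_Suc)
qed (simp add: cip_def)

lemma cip_bessel_right:
  assumes "ons M n e"
  shows "(\<Sum>k<n. (cmod (cip M (e k) v))\<^sup>2) \<le> (\<Sum>i<M. (cmod (v i))\<^sup>2)"
proof -
  have "cmod (cip M (e k) v) = cmod (cip M v (e k))" for k
    by (metis cip_cnj complex_mod_cnj)
  then show ?thesis using cip_bessel[OF assms, of v] by simp
qed

lemma annihilation_sq:
  "(\<Sum>i<M-1. (cmod (annihilation v i))\<^sup>2) = (\<Sum>i<M. real i * (cmod (v i))\<^sup>2)"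
proof (cases M)
  case (Suc N)
  then show ?thesis
    by (simp only: sum.lessThan_Suc_shift) (simp add: annihilation_def norm_mult power_mult_distrib)
qed simp

text \<open>The raised vectors are not orthonormal. Moving the ladder operator over to
  \<open>v\<close> leaves the orthonormal family itself, and Bessel bounds the sum by the squared
  norm of the lowered \<open>v\<close>.\<close>

lemma bessel_ladder:
  assumes "ons M n e" "n \<le> M"
  shows "(\<Sum>k<n. (cmod (cip M (creation (e k)) v))\<^sup>2) \<le> (\<Sum>i<M. real i * (cmod (v i))\<^sup>2)"
proof -
  \<comment> \<open>\<open>annihilation v (M - 1)\<close> would read the entry \<open>v M\<close>
    outside the truncation, so the lowered vector stops one index earlier.\<close>
  define d where "d i = (if i < M - 1 then annihilation v i else 0)" for i
  have "cip M (creation (e k)) v = cip M (e k) d" for k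
  proof -
    have "cip M (e k) d = (\<Sum>i<M-1. e k i * cnj (d i))"
      unfolding cip_def by (rule sum.mono_neutral_right) (auto simp: d_def)
    then show ?thesis by (simp add: cip_creation_annihilation) (simp add: cip_def d_def)
  qed
  then have "(\<Sum>k<n. (cmod (cip M (creation (e k)) v))\<^sup>2) \<le> (\<Sum>i<M. (cmod (d i))\<^sup>2)"
    using cip_bessel_right[OF assms(1), of d] by simp
  also have "\<dots> = (\<Sum>i<M-1. (cmod (d i))\<^sup>2)"
    by (rule sum.mono_neutral_right) (auto simp: d_def)
  also have "\<dots> = (\<Sum>i<M. real i * (cmod (v i))\<^sup>2)"
    by (simp add: d_def flip: annihilation_sq)
  finally show ?thesis .
qed

section \<open>Variational bounds for sums of eigenvalues\<close>

locale spectral_data =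
  fixes M :: nat and H :: "nat \<Rightarrow> nat \<Rightarrow> complex" and e :: "nat \<Rightarrow> nat \<Rightarrow> complex" and lam :: "nat \<Rightarrow> real"
  assumes ons: "ons M M e"
    and anti: "j \<le> k \<Longrightarrow> k < M \<Longrightarrow> lam k \<le> lam j"
    and sesq_eq: "sesq M H v w = (\<Sum>j<M. complex_of_real (lam j) * cip M v (e j) * cnj (cip M w (e j)))"
begin

lemma cip_e: "j < M \<Longrightarrow> k < M \<Longrightarrow> cip M (e j) (e k) = (if j = k then 1 else 0)"
  using ons by (simp add: ons_def)

lemma ons_sub: "n \<le> M \<Longrightarrow> ons M n e"
  using ons by (simp add: ons_def)

lemma sesq_self: "sesq M H v v = complex_of_real (\<Sum>j<M. lam j * (cmod (cip M v (e j)))\<^sup>2)"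
  by (simp only: sesq_eq mult.assoc mult_cnj_self of_real_sum of_real_mult)

lemma sesq_eigen: "k < M \<Longrightarrow> sesq M H v (e k) = complex_of_real (lam k) * cip M v (e k)"
  unfolding sesq_eq by (simp add: cip_e if_distrib[of cnj] mult_delta_right cong: if_cong)

lemma sesq_eigen_self: "k < M \<Longrightarrow> sesq M H (e k) (e k) = complex_of_real (lam k)"
  by (simp add: sesq_eigen cip_e)

lemma lam_nonneg:
  assumes "\<And>v. Re (sesq M H v v) \<ge> 0" "k < M"
  shows "lam k \<ge> 0"
  using assms(1)[of "e k"] assms(2) by (simp add: sesq_eigen_self)

lemma norm_e: "k < M \<Longrightarrow> (\<Sum>i<M. (cmod (e k i))\<^sup>2) = 1"
  by (simp add: cip_e flip: Re_cip_self)

lemma parseval: "(\<Sum>j<M. (cmod (cip M v (e j)))\<^sup>2) = (\<Sum>i<M. (cmod (v i))\<^sup>2)"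
proof -
  have "complex_of_real (\<Sum>j<M. (cmod (cip M v (e j)))\<^sup>2) = cip M v v"
    unfolding ons_complete(3)[OF ons, of v v] by (simp only: mult_cnj_self of_real_sum)
  then show ?thesis by (simp only: cip_self of_real_eq_iff)
qed

text \<open>Moving weight onto the largest eigenvalues only helps. After subtracting the threshold
  \<open>x\<close>, the first \<open>K\<close> terms grow when their weight is raised to 1 and the
  others are nonpositive; the bound on the total weight pays for restoring \<open>x\<close>.\<close>

lemma weighted_sum_le:
  assumes "K \<le> M" "\<And>v. Re (sesq M H v v) \<ge> 0"
    and "\<And>j. j < M \<Longrightarrow> 0 \<le> w j" "\<And>j. j < M \<Longrightarrow> w j \<le> 1" "(\<Sum>j<M. w j) \<le> real K"
  shows "(\<Sum>j<M. lam j * w j) \<le> (\<Sum>j<K. lam j)"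
proof -
  \<comment> \<open>For \<open>K = M\<close> no eigenvalue is left over, and 0 serves as threshold
    because the form is nonnegative.\<close>
  define x where "x = (if K < M then lam K else 0)"
  have x: "x \<ge> 0" "\<And>j. j < K \<Longrightarrow> x \<le> lam j" "\<And>j. K \<le> j \<Longrightarrow> j < M \<Longrightarrow> lam j \<le> x"
    using lam_nonneg[OF assms(2)] anti assms(1) by (auto simp: x_def)
  have split: "(\<Sum>j<M. f j) = (\<Sum>j<K. f j) + (\<Sum>j=K..<M. f j)" for f :: "nat \<Rightarrow> real"
    using assms(1) by (metis lessThan_atLeast0 sum.atLeastLessThan_concat zero_le)
  have "(\<Sum>j<M. (lam j - x) * w j) \<le> (\<Sum>j<K. lam j - x)"
    unfolding split
  proof -
    have "(\<Sum>j<K. (lam j - x) * w j) \<le> (\<Sum>j<K. (lam j - x) * 1)"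
      using assms x by (intro sum_mono mult_left_mono) auto
    moreover have "(\<Sum>j=K..<M. (lam j - x) * w j) \<le> 0"
      using assms x by (intro sum_nonpos mult_nonpos_nonneg) auto
    ultimately show "(\<Sum>j<K. (lam j - x) * w j) + (\<Sum>j=K..<M. (lam j - x) * w j) \<le> (\<Sum>j<K. lam j - x)"
      by simp
  qed
  moreover have "x * (\<Sum>j<M. w j) \<le> x * real K"
    using x assms by (intro mult_left_mono) auto
  ultimately show ?thesis
    by (simp add: left_diff_distrib sum_subtractf sum_distrib_left algebra_simps)
qed

text \<open>Ky Fan's maximum principle for families that need not be orthonormal. \<open>row\<close>
  bounds the total weight on the eigenvectors by \<open>K\<close> and \<open>col\<close> bounds each
  single weight by 1; both survive when the coefficients of orthonormal functions are cut
  off.\<close>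

lemma ky_fan:
  assumes "K \<le> M" "\<And>v. Re (sesq M H v v) \<ge> 0"
    and col: "\<And>j. j < M \<Longrightarrow> (\<Sum>k\<in>A. (cmod (cip M (v k) (e j)))\<^sup>2) \<le> 1"
    and row: "\<And>k. k \<in> A \<Longrightarrow> (\<Sum>i<M. (cmod (v k i))\<^sup>2) \<le> 1"
    and "card A = K"
  shows "(\<Sum>k\<in>A. Re (sesq M H (v k) (v k))) \<le> (\<Sum>j<K. lam j)"
proof -
  have "(\<Sum>k\<in>A. Re (sesq M H (v k) (v k))) = (\<Sum>k\<in>A. \<Sum>j<M. lam j * (cmod (cip M (v k) (e j)))\<^sup>2)"
    by (simp add: sesq_self)
  also have "\<dots> = (\<Sum>j<M. lam j * (\<Sum>k\<in>A. (cmod (cip M (v k) (e j)))\<^sup>2))"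
    by (subst sum.swap) (simp add: sum_distrib_left)
  also have "\<dots> \<le> (\<Sum>j<K. lam j)"
  proof (rule weighted_sum_le)
    show "K \<le> M" "\<And>v. 0 \<le> Re (sesq M H v v)" by fact+
    show "(\<Sum>k\<in>A. (cmod (cip M (v k) (e j)))\<^sup>2) \<le> 1" if "j < M" for j
      using col that .
    have "(\<Sum>j<M. \<Sum>k\<in>A. (cmod (cip M (v k) (e j)))\<^sup>2) = (\<Sum>k\<in>A. \<Sum>i<M. (cmod (v k i))\<^sup>2)"
      by (subst sum.swap) (simp add: parseval)
    also have "\<dots> \<le> (\<Sum>k\<in>A. 1)"
      by (intro sum_mono row)
    finally show "(\<Sum>j<M. \<Sum>k\<in>A. (cmod (cip M (v k) (e j)))\<^sup>2) \<le> real K"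
      using assms by simp
  qed (auto intro: sum_nonneg)
  finally show ?thesis .
qed

text \<open>With \<open>x\<close> the next eigenvalue, \<open>H - x\<close> is nonnegative on the span of the first \<open>n\<close> eigenvectors
  and nonpositive on its complement. This leaves \<open>x\<close> times the trace of the commutator
  \<open>a a\<^sup>* - a\<^sup>* a\<close> over the span, which is \<open>n\<close>.\<close>

lemma ladder_bound:
  assumes "n \<le> M" and pos: "\<And>v. Re (sesq M H v v) \<ge> 0"
  defines "x \<equiv> if n < M then lam n else 0"
  shows "(\<Sum>k<n. Re (sesq M H (creation (e k)) (creation (e k)))) \<le> (\<Sum>k<n. lam k * (\<Sum>i<M. real i * (cmod (e k i))\<^sup>2)) + real n * x"
proof -
  have x: "x \<ge> 0" "\<And>j. j < n \<Longrightarrow> x \<le> lam j" "\<And>j. n \<le> j \<Longrightarrow> j < M \<Longrightarrow> lam j \<le> x"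
    using lam_nonneg[OF assms(2)] anti assms(1) by (auto simp: x_def)
  define p where "p k j = (cmod (cip M (creation (e k)) (e j)))\<^sup>2" for k j
  define N where "N k = (\<Sum>i<M. real i * (cmod (e k i))\<^sup>2)" for k
  have split: "(\<Sum>j<M. f j) = (\<Sum>j<n. f j) + (\<Sum>j=n..<M. f j)" for f :: "nat \<Rightarrow> real"
    using assms(1) by (metis lessThan_atLeast0 sum.atLeastLessThan_concat zero_le)
  have "(\<Sum>j<M. (lam j - x) * p k j) \<le> (\<Sum>j<n. (lam j - x) * p k j)" for k
  proof -
    have "(\<Sum>j=n..<M. (lam j - x) * p k j) \<le> 0"
      using x by (intro sum_nonpos mult_nonpos_nonneg) (auto simp: p_def)
    then show ?thesis unfolding split by simp
  qed
  then have "(\<Sum>k<n. \<Sum>j<M. (lam j - x) * p k j) \<le> (\<Sum>k<n. \<Sum>j<n. (lam j - x) * p k j)"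
    by (intro sum_mono)
  also have "\<dots> = (\<Sum>j<n. (lam j - x) * (\<Sum>k<n. p k j))"
    by (subst sum.swap) (simp add: sum_distrib_left)
  also have "\<dots> \<le> (\<Sum>j<n. (lam j - x) * N j)"
    unfolding p_def N_def using x assms(1)
    by (intro sum_mono mult_left_mono bessel_ladder ons_sub) auto
  finally have 1: "(\<Sum>k<n. \<Sum>j<M. (lam j - x) * p k j) \<le> (\<Sum>j<n. (lam j - x) * N j)" .
  \<comment> \<open>The full row sum is bounded by \<open>N k + 1\<close>, whereas the column sums
    above were bounded by \<open>N j\<close>. The \<open>n\<close> extra units are what carries the
    factor \<open>x\<close>.\<close>
  have "(\<Sum>j<M. p k j) \<le> N k + 1" if "k < n" for k
  proof -
    have "(\<Sum>j<M. p k j) \<le> (\<Sum>i<M. real (Suc i) * (cmod (e k i))\<^sup>2)"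
      unfolding p_def parseval by (rule norm_creation_sq)
    also have "\<dots> = N k + (\<Sum>i<M. (cmod (e k i))\<^sup>2)"
      by (simp add: N_def algebra_simps sum.distrib)
    also have "(\<Sum>i<M. (cmod (e k i))\<^sup>2) = 1"
      using that assms(1) by (intro norm_e) auto
    finally show ?thesis .
  qed
  then have "(\<Sum>k<n. \<Sum>j<M. p k j) \<le> (\<Sum>k<n. N k + 1)"
    by (intro sum_mono) auto
  then have "x * (\<Sum>k<n. \<Sum>j<M. p k j) \<le> x * (\<Sum>k<n. N k + 1)"
    by (rule mult_left_mono) (rule x)
  with 1 have "(\<Sum>k<n. \<Sum>j<M. lam j * p k j) \<le> (\<Sum>k<n. lam k * N k) + real n * x"
    by (simp add: left_diff_distrib sum_subtractf sum_distrib_left sum.distrib distrib_left algebra_simps)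
  then show ?thesis
    unfolding sesq_self Re_complex_of_real p_def N_def .
qed

end

section \<open>The term lost by truncation\<close>

lemma sesq_Suc:
  "sesq (Suc M) H v v = sesq M H v v + (\<Sum>j<M. H M j * v M * cnj (v j)) + (\<Sum>i<M. H i M * v i * cnj (v M))
      + H M M * v M * cnj (v M)"
  by (simp add: sesq_def sum.distrib algebra_simps)

text \<open>The two forms differ by the last row and column, which have \<open>2 * M + 1\<close>
  entries. Raising multiplies entries of modulus at most 1 by at most sqrt(M), so each of these
  terms is at most \<open>b * M\<close>.\<close>

lemma sesq_truncation:
  assumes b: "\<And>i. i \<le> M \<Longrightarrow> cmod (H i M) \<le> b" "\<And>i. i \<le> M \<Longrightarrow> cmod (H M i) \<le> b"
    and v: "\<And>i. i < M \<Longrightarrow> cmod (v i) \<le> 1"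
  shows "cmod (sesq (Suc M) H (creation v) (creation v) - sesq M H (creation v) (creation v)) \<le> (2 * real M + 1) * (b * real M)"
proof -
  have b0: "b \<ge> 0" using b(1)[of M] norm_ge_zero order_trans by blast
  have u: "cmod (creation v i) \<le> sqrt (real M)" if "i \<le> M" for i
  proof (cases i)
    case (Suc j)
    then have "sqrt (real (Suc j)) * cmod (v j) \<le> sqrt (real M) * 1"
      using that v[of j] by (intro mult_mono) auto
    then show ?thesis using Suc by (simp add: norm_mult)
  qed simp
  have uu: "cmod (h * creation v i * cnj (creation v j)) \<le> b * real M" if "i \<le> M" "j \<le> M" "cmod h \<le> b" for h i j
  proof -
    have "cmod (h * creation v i * cnj (creation v j)) \<le> b * sqrt (real M) * sqrt (real M)"
      unfolding norm_mult complex_mod_cnj using that u b0 by (intro mult_mono) auto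
    then show ?thesis by (simp add: mult.assoc)
  qed
  have "cmod (\<Sum>j<M. H M j * creation v M * cnj (creation v j)) \<le> of_nat (card {..<M}) * (b * real M)"
    by (rule sum_norm_bound) (use uu b in auto)
  moreover have "cmod (\<Sum>i<M. H i M * creation v i * cnj (creation v M)) \<le> of_nat (card {..<M}) * (b * real M)"
    by (rule sum_norm_bound) (use uu b in auto)
  moreover have "cmod (H M M * creation v M * cnj (creation v M)) \<le> b * real M"
    using uu b by simp
  ultimately have "cmod ((\<Sum>j<M. H M j * creation v M * cnj (creation v j)) + (\<Sum>i<M. H i M * creation v i * cnj (creation v M))
      + H M M * creation v M * cnj (creation v M)) \<le> real M * (b * real M) + real M * (b * real M) + b * real M"
    by (intro norm_triangle_le add_mono) auto
  then show ?thesis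
    by (simp add: sesq_Suc algebra_simps)
qed

section \<open>The comparison principle for eigenvalue sums\<close>

locale ladder_flow =
  fixes C :: "real \<Rightarrow> nat \<Rightarrow> nat \<Rightarrow> complex"
  assumes herm: "C r j i = cnj (C r i j)"
    and pos: "Re (sesq M (C r) v v) \<ge> 0"
    and flow: "r \<ge> 1 \<Longrightarrow> ((\<lambda>r. C r i j) has_vector_derivative
       (1 / r) *\<^sub>R (of_nat (i + j) * C r i j - 2 * complex_of_real (sqrt (real (Suc i)) * sqrt (real (Suc j))) * C r (Suc i) (Suc j))) (at r)"
begin

text \<open>The vector is held fixed while \<open>r\<close> moves. The flow couples the entry
  \<open>(i, j)\<close> to \<open>(i + 1, j + 1)\<close>, so differentiating the form on
  \<open>M\<close> coordinates produces the form of the raised vector on \<open>Suc M\<close>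
  coordinates.\<close>

lemma sesq_deriv:
  assumes "r \<ge> 1"
  shows "((\<lambda>r. Re (sesq M (C r) v v)) has_real_derivative
     (2 / r) * (Re (sesq M (C r) (\<lambda>i. of_nat i * v i) v) - Re (sesq (Suc M) (C r) (creation v) (creation v)))) (at r)"
proof -
  let ?D = "\<lambda>i j. (1 / r) *\<^sub>R (of_nat (i + j) * C r i j - 2 * complex_of_real (sqrt (real (Suc i)) * sqrt (real (Suc j))) * C r (Suc i) (Suc j))"
  have "((\<lambda>r. sesq M (C r) v v) has_vector_derivative (\<Sum>i<M. \<Sum>j<M. ?D i j * v i * cnj (v j))) (at r)"
    unfolding sesq_def by (intro has_vector_derivative_sum has_vector_derivative_mult_left flow assms)
  also have "(\<Sum>i<M. \<Sum>j<M. ?D i j * v i * cnj (v j)) = (1 / r) *\<^sub>R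
     (sesq M (C r) (\<lambda>i. of_nat i * v i) v + sesq M (C r) v (\<lambda>i. of_nat i * v i) - 2 * sesq (Suc M) (C r) (creation v) (creation v))"
  proof -
    have creation: "sesq (Suc M) (C r) (creation v) (creation v) = (\<Sum>i<M. \<Sum>j<M. complex_of_real (sqrt (real (Suc i)) * sqrt (real (Suc j))) * C r (Suc i) (Suc j) * v i * cnj (v j))"
      unfolding sesq_def by (subst sum.lessThan_Suc_shift, subst sum.lessThan_Suc_shift) (simp add: mult_ac sum.lessThan_Suc_shift del: sum.lessThan_Suc)
    show ?thesis
      unfolding creation unfolding sesq_def scaleR_right_diff_distrib scaleR_right_distrib scaleR_sum_right sum_distrib_left
        sum.distrib[symmetric] sum_subtractf[symmetric]
      by (intro sum.cong refl) (simp add: algebra_simps)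
  qed
  also have "sesq M (C r) v (\<lambda>i. of_nat i * v i) = cnj (sesq M (C r) (\<lambda>i. of_nat i * v i) v)"
    using sesq_cnj[of "C r", OF herm] by metis
  finally have "((\<lambda>r. Re (sesq M (C r) v v)) has_vector_derivative
     Re ((1 / r) *\<^sub>R (sesq M (C r) (\<lambda>i. of_nat i * v i) v + cnj (sesq M (C r) (\<lambda>i. of_nat i * v i) v) - 2 * sesq (Suc M) (C r) (creation v) (creation v)))) (at r)"
    by (rule bounded_linear.has_vector_derivative[OF bounded_linear_Re])
  then show ?thesis
    unfolding has_real_derivative_iff_has_vector_derivative by (simp add: algebra_simps)
qed

text \<open>The diagonalisation is chosen separately for every \<open>r\<close>, and its
  eigenvectors need not depend regularly on \<open>r\<close>. The dependence of
  \<open>topsum\<close> on \<open>r\<close> is controlled through its variational description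
  instead.\<close>

definition spec :: "nat \<Rightarrow> real \<Rightarrow> (nat \<Rightarrow> nat \<Rightarrow> complex) \<times> (nat \<Rightarrow> real)" where
  "spec M r = (SOME p. spectral_data M (C r) (fst p) (snd p))"

definition topsum :: "nat \<Rightarrow> nat \<Rightarrow> real \<Rightarrow> real" where
  "topsum M n r = (\<Sum>j<n. snd (spec M r) j)"

lemma spec: "spectral_data M (C r) (fst (spec M r)) (snd (spec M r))"
proof -
  obtain e lam where "ons M M e" "\<And>j k. j \<le> k \<Longrightarrow> k < M \<Longrightarrow> lam k \<le> lam j"
    "\<And>v w. sesq M (C r) v w = (\<Sum>j<M. complex_of_real (lam j) * cip M v (e j) * cnj (cip M w (e j)))"
    using hermitian_spectral[of "C r" M, OF herm] by metis
  then have "spectral_data M (C r) (fst (e, lam)) (snd (e, lam))"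
    unfolding spectral_data_def by auto
  then show ?thesis unfolding spec_def by (rule someI)
qed

lemma topsum_ge_subframe:
  assumes "n \<le> M" "card A = n"
    and row: "\<And>k. k \<in> A \<Longrightarrow> (\<Sum>i<M. (cmod (v k i))\<^sup>2) \<le> 1"
    and col: "\<And>u. (\<Sum>k\<in>A. (cmod (cip M (v k) u))\<^sup>2) \<le> (\<Sum>i<M. (cmod (u i))\<^sup>2)"
  shows "(\<Sum>k\<in>A. Re (sesq M (C r) (v k) (v k))) \<le> topsum M n r"
proof -
  interpret spectral_data M "C r" "fst (spec M r)" "snd (spec M r)" by (rule spec)
  show ?thesis
    unfolding topsum_def
  proof (rule ky_fan)
    show "(\<Sum>k\<in>A. (cmod (cip M (v k) (fst (spec M r) j)))\<^sup>2) \<le> 1" if "j < M" for j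
      using col norm_e[OF that] by metis
  qed (use assms pos in auto)
qed

lemma topsum_ge:
  assumes "n \<le> M" "ons M n v"
  shows "(\<Sum>k<n. Re (sesq M (C r) (v k) (v k))) \<le> topsum M n r"
proof (rule topsum_ge_subframe[OF assms(1)])
  show "(\<Sum>k<n. (cmod (cip M (v k) u))\<^sup>2) \<le> (\<Sum>i<M. (cmod (u i))\<^sup>2)" for u
    by (rule cip_bessel_right[OF assms(2)])
  show "(\<Sum>i<M. (cmod (v k i))\<^sup>2) \<le> 1" if "k \<in> {..<n}" for k
    using assms(2) that by (simp add: ons_def flip: Re_cip_self)
qed simp

lemma topsum_eq:
  assumes "n \<le> M"
  shows "topsum M n r = (\<Sum>k<n. Re (sesq M (C r) (fst (spec M r) k) (fst (spec M r) k)))"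
proof -
  interpret spectral_data M "C r" "fst (spec M r)" "snd (spec M r)" by (rule spec)
  show ?thesis
    unfolding topsum_def using assms by (intro sum.cong refl) (simp add: sesq_eigen_self)
qed

lemma ons_le_1:
  assumes "ons M n v" "k < n" "i < M"
  shows "cmod (v k i) \<le> 1"
proof -
  have "(cmod (v k i))\<^sup>2 \<le> (\<Sum>i<M. (cmod (v k i))\<^sup>2)"
    using assms by (intro member_le_sum) auto
  also have "\<dots> = 1"
    using assms by (simp add: ons_def flip: Re_cip_self)
  finally show ?thesis
    by (simp add: abs_square_le_1)
qed

text \<open>Eigenvectors for \<open>r\<close> serve as test vectors for \<open>r'\<close>. Their
  entries have modulus at most 1, so each form changes by at most the sum of the entrywise
  differences. Exchanging the roles of \<open>r\<close> and \<open>r'\<close> then gives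
  continuity.\<close>

lemma topsum_lipschitz:
  assumes "n \<le> M"
  shows "topsum M n r \<le> topsum M n r' + real n * (\<Sum>i<M. \<Sum>j<M. cmod (C r i j - C r' i j))"
proof -
  define e where "e = fst (spec M r)"
  interpret spectral_data M "C r" e "snd (spec M r)" unfolding e_def by (rule spec)
  have d: "Re (sesq M (C r) (e k) (e k)) \<le> Re (sesq M (C r') (e k) (e k)) + (\<Sum>i<M. \<Sum>j<M. cmod (C r i j - C r' i j))"
    if "k < n" for k
  proof -
    have le1: "cmod (e k i) \<le> 1" if "i < M" for i
      using ons_le_1[OF ons] that \<open>k < n\<close> assms by simp
    have "sesq M (C r) (e k) (e k) - sesq M (C r') (e k) (e k) = (\<Sum>i<M. \<Sum>j<M. (C r i j - C r' i j) * e k i * cnj (e k j))"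
      by (simp add: sesq_def sum_subtractf algebra_simps)
    also have "cmod \<dots> \<le> (\<Sum>i<M. \<Sum>j<M. cmod (C r i j - C r' i j))"
    proof (intro sum_norm_le)
      fix i j assume "i \<in> {..<M}" "j \<in> {..<M}"
      then have "cmod (C r i j - C r' i j) * cmod (e k i) * cmod (e k j) \<le> cmod (C r i j - C r' i j) * 1 * 1"
        using le1 by (intro mult_mono) auto
      then show "cmod ((C r i j - C r' i j) * e k i * cnj (e k j)) \<le> cmod (C r i j - C r' i j)"
        by (simp add: norm_mult)
    qed
    finally show ?thesis
      using complex_Re_le_cmod[of "sesq M (C r) (e k) (e k) - sesq M (C r') (e k) (e k)"] by simp
  qed
  have "topsum M n r \<le> (\<Sum>k<n. Re (sesq M (C r') (e k) (e k)) + (\<Sum>i<M. \<Sum>j<M. cmod (C r i j - C r' i j)))"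
    unfolding topsum_eq[OF assms] e_def[symmetric] by (intro sum_mono d) auto
  also have "\<dots> \<le> topsum M n r' + real n * (\<Sum>i<M. \<Sum>j<M. cmod (C r i j - C r' i j))"
    using topsum_ge[OF assms ons_sub[OF assms], of r'] by (simp add: sum.distrib)
  finally show ?thesis .
qed

lemma continuous_topsum:
  assumes "n \<le> M"
  shows "continuous_on {1..r1} (topsum M n)"
  unfolding continuous_on_def
proof
  fix r assume r: "r \<in> {1..r1}"
  let ?S = "\<lambda>x. \<Sum>i<M. \<Sum>j<M. cmod (C x i j - C r i j)"
  have cont: "((\<lambda>x. C x i j) \<longlongrightarrow> C r i j) (at r within {1..r1})" for i j
    using r by (intro tendsto_within_subset[OF isContD[OF has_vector_derivative_continuous[OF flow]]]) auto
  have "((\<lambda>x. real n * ?S x) \<longlongrightarrow> real n * (\<Sum>i<M. \<Sum>j<M. cmod (C r i j - C r i j))) (at r within {1..r1})"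
    by (intro tendsto_intros cont)
  then have S: "((\<lambda>x. real n * ?S x) \<longlongrightarrow> 0) (at r within {1..r1})" by simp
  have "\<bar>topsum M n x - topsum M n r\<bar> \<le> real n * ?S x" for x
    using topsum_lipschitz[OF assms, of x r] topsum_lipschitz[OF assms, of r x]
    by (simp add: norm_minus_commute abs_le_iff)
  then have "((\<lambda>x. topsum M n x - topsum M n r) \<longlongrightarrow> 0) (at r within {1..r1})"
    by (intro Lim_null_comparison[OF _ S]) (simp add: always_eventually)
  then show "(topsum M n \<longlongrightarrow> topsum M n r) (at r within {1..r1})"
    by (simp add: LIM_zero_iff)
qed

text \<open>Minimise \<open>g n r - topsum M n r + \<epsilon> (r1 - r)\<close> over \<open>n\<close> and \<open>r\<close>. At a minimum with \<open>r < r1\<close> the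
  eigenvectors stay admissible for nearby \<open>r\<close>, so the one-sided derivative along them is
  nonnegative, which \<open>ladder_bound\<close> and minimality in \<open>n\<close> rule out.\<close>

theorem topsum_comparison:
  fixes g :: "nat \<Rightarrow> real \<Rightarrow> real" and r1 :: real
  assumes r1: "r1 \<ge> 1" and M: "1 \<le> K" "K \<le> M"
    and g: "\<And>n r. r \<ge> 1 \<Longrightarrow> ((g n) has_real_derivative - (2 * real n / r) * (g (Suc n) r - g n r)) (at r)"
    and g_mono: "\<And>n r. g n r \<le> g (Suc n) r"
    and b: "\<And>r i. r \<in> {1..r1} \<Longrightarrow> i \<le> M \<Longrightarrow> cmod (C r i M) \<le> b"
    and bd: "\<And>n. n \<le> M \<Longrightarrow> topsum M n r1 \<le> g n r1 + \<delta>"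
    and eps: "\<epsilon> > 2 * real M * ((2 * real M + 1) * (b * real M))"
  shows "topsum M K 1 \<le> g K 1 + \<delta> + \<epsilon> * (r1 - 1)"
proof -
  define F where "F n r = g n r - topsum M n r + \<epsilon> * (r1 - r)" for n r
  have g_cont: "continuous_on {1..r1} (g n)" for n
    by (intro continuous_at_imp_continuous_on ballI DERIV_isCont[OF g]) auto
  have F_cont: "continuous_on {1..r1} (F n)" if "n \<le> M" for n
    unfolding F_def by (intro continuous_intros g_cont continuous_topsum that)
  have "\<exists>x\<in>{1..r1}. \<forall>y\<in>{1..r1}. F n x \<le> F n y" if "n \<le> M" for n
    using r1 by (intro continuous_attains_inf F_cont that) auto
  then obtain X where X: "\<And>n. n \<le> M \<Longrightarrow> X n \<in> {1..r1}" "\<And>n y. n \<le> M \<Longrightarrow> y \<in> {1..r1} \<Longrightarrow> F n (X n) \<le> F n y"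
    by metis
  define n where "n = (ARG_MIN (\<lambda>n. F n (X n)) n. n \<in> {1..M})"
  have ne: "finite {1..M}" "{1..M} \<noteq> {}" using M by auto
  have n: "n \<in> {1..M}" "\<And>m. m \<in> {1..M} \<Longrightarrow> F n (X n) \<le> F m (X m)"
    using arg_min_if_finite[OF ne, of "\<lambda>n. F n (X n)"] unfolding n_def arg_min_on_def by (auto simp: not_less)
  have nM: "n \<le> M" "n \<ge> 1" using n by auto
  define \<rho> where "\<rho> = X n"
  have \<rho>: "\<rho> \<in> {1..r1}" and min: "\<And>m y. 1 \<le> m \<Longrightarrow> m \<le> M \<Longrightarrow> y \<in> {1..r1} \<Longrightarrow> F n \<rho> \<le> F m y"
    using X n unfolding \<rho>_def by force+
  have "\<rho> = r1"
  proof (rule ccontr)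
    assume "\<rho> \<noteq> r1"
    with \<rho> have lt: "\<rho> < r1" "\<rho> \<ge> 1" by auto
    define e where "e = fst (spec M \<rho>)"
    define lam where "lam = snd (spec M \<rho>)"
    interpret spectral_data M "C \<rho>" e lam unfolding e_def lam_def by (rule spec)
    define x where "x = (if n < M then lam n else 0)"
    define err where "err = (2 * real M + 1) * (b * real M)"
    \<comment> \<open>\<open>\<psi>\<close> keeps the eigenvectors belonging to \<rho> for every
      \<open>r\<close>. It agrees with \<open>F n\<close> at \<rho> and is nowhere below it, so it
      inherits the minimum at \<rho>, and unlike \<open>F n\<close> it can be
      differentiated.\<close>
    define \<psi> where "\<psi> r = g n r - (\<Sum>k<n. Re (sesq M (C r) (e k) (e k))) + \<epsilon> * (r1 - r)" for r
    define N where "N k = (\<Sum>i<M. real i * (cmod (e k i))\<^sup>2)" for k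
    define U where "U k = Re (sesq (Suc M) (C \<rho>) (creation (e k)) (creation (e k)))" for k
    have U: "U k \<le> Re (sesq M (C \<rho>) (creation (e k)) (creation (e k))) + err" if "k < n" for k
    proof -
      have bb: "cmod (C \<rho> i M) \<le> b" "cmod (C \<rho> M i) \<le> b" if "i \<le> M" for i
        using b[OF \<rho> that] herm[of \<rho> M i] by simp_all
      have "cmod (sesq (Suc M) (C \<rho>) (creation (e k)) (creation (e k)) - sesq M (C \<rho>) (creation (e k)) (creation (e k))) \<le> err"
        unfolding err_def using bb ons_le_1[OF ons] that nM by (intro sesq_truncation) auto
      then show ?thesis
        using complex_Re_le_cmod[of "sesq (Suc M) (C \<rho>) (creation (e k)) (creation (e k)) - sesq M (C \<rho>) (creation (e k)) (creation (e k))"]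
        unfolding U_def by simp
    qed
    have "(\<Sum>k<n. U k) \<le> (\<Sum>k<n. Re (sesq M (C \<rho>) (creation (e k)) (creation (e k))) + err)"
      by (intro sum_mono U) auto
    also have "\<dots> \<le> (\<Sum>k<n. lam k * N k) + real n * x + real n * err"
      using ladder_bound[OF nM(1) pos] by (simp add: sum.distrib x_def N_def)
    finally have sumU: "(\<Sum>k<n. U k) \<le> (\<Sum>k<n. lam k * N k) + real n * x + real n * err" .
    have eig: "Re (sesq M (C \<rho>) (\<lambda>i. of_nat i * e k i) (e k)) = lam k * N k" if "k < n" for k
    proof -
      have "cip M (\<lambda>i. of_nat i * e k i) (e k) = complex_of_real (N k)"
        unfolding cip_def N_def mult.assoc mult_cnj_self by simp
      then show ?thesis
        using that nM by (simp add: sesq_eigen)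
    qed
    have "(\<psi> has_real_derivative (- (2 * real n / \<rho>) * (g (Suc n) \<rho> - g n \<rho>)
        - (\<Sum>k<n. (2 / \<rho>) * (Re (sesq M (C \<rho>) (\<lambda>i. of_nat i * e k i) (e k)) - U k)) + \<epsilon> * (0 - 1))) (at \<rho>)"
      unfolding \<psi>_def U_def
      by (intro derivative_intros g sesq_deriv lt) (auto intro!: derivative_eq_intros)
    also have "(\<Sum>k<n. (2 / \<rho>) * (Re (sesq M (C \<rho>) (\<lambda>i. of_nat i * e k i) (e k)) - U k))
       = (2 / \<rho>) * ((\<Sum>k<n. lam k * N k) - (\<Sum>k<n. U k))"
      by (simp add: eig sum_distrib_left sum_subtractf right_diff_distrib)
    finally have der: "(\<psi> has_real_derivative (- (2 * real n / \<rho>) * (g (Suc n) \<rho> - g n \<rho>)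
        - (2 / \<rho>) * ((\<Sum>k<n. lam k * N k) - (\<Sum>k<n. U k)) + \<epsilon> * (0 - 1))) (at \<rho>)" (is "(_ has_real_derivative ?D) _") .
    \<comment> \<open>Minimality against \<open>n + 1\<close> says that the next increment of
      \<open>g\<close> is at least the next eigenvalue. At \<open>n = M\<close> there is no
      competitor, but \<open>x\<close> is 0 there and \<open>g_mono\<close> suffices.\<close>
    have gx: "g (Suc n) \<rho> - g n \<rho> \<ge> x"
    proof (cases "n < M")
      case True
      then have "F n \<rho> \<le> F (Suc n) \<rho>" using \<rho> nM by (intro min) auto
      moreover have "topsum M (Suc n) \<rho> = topsum M n \<rho> + x"
        using True by (simp add: topsum_def x_def lam_def)
      ultimately show ?thesis by (simp add: F_def)
    next
      case False
      then show ?thesis using g_mono[of n \<rho>] by (simp add: x_def)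
    qed
    have b0: "b \<ge> 0" using b[OF \<rho>, of 0] norm_ge_zero order_trans by blast
    have "?D = (2 / \<rho>) * ((\<Sum>k<n. U k) - (\<Sum>k<n. lam k * N k) - real n * (g (Suc n) \<rho> - g n \<rho>)) - \<epsilon>"
      using lt by (simp add: field_simps)
    also have "\<dots> \<le> (2 / \<rho>) * (real n * err) - \<epsilon>"
    proof -
      have "real n * x \<le> real n * (g (Suc n) \<rho> - g n \<rho>)"
        using gx by (intro mult_left_mono) auto
      then show ?thesis
        using sumU lt by (intro diff_mono mult_left_mono) auto
    qed
    \<comment> \<open>This uses \<rho> \<ge> 1 and n \<le> M; the slope \<epsilon> was required to
      exceed exactly this truncation loss.\<close>
    also have "\<dots> \<le> 2 * (real M * err) - \<epsilon>"
      using lt nM b0 by (intro diff_mono mult_mono) (auto simp: err_def field_simps)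
    also have "\<dots> < 0"
      using eps by (simp add: err_def mult_ac)
    finally have "?D < 0" .
    from DERIV_neg_dec_right[OF der this] obtain d where d: "d > 0" "\<And>h. 0 < h \<Longrightarrow> h < d \<Longrightarrow> \<psi> (\<rho> + h) < \<psi> \<rho>"
      by blast
    define h where "h = Min {d / 2, r1 - \<rho>}"
    have h: "0 < h" "h < d" "\<rho> + h \<in> {1..r1}"
      using d lt by (auto simp: h_def min_def)
    have "F n \<rho> \<le> F n (\<rho> + h)" using min nM h by simp
    also have "\<dots> \<le> \<psi> (\<rho> + h)"
      using topsum_ge[OF nM(1) ons_sub[OF nM(1)], of "\<rho> + h"] by (simp add: F_def \<psi>_def)
    also have "\<dots> < \<psi> \<rho>" using d h by simp
    also have "\<psi> \<rho> = F n \<rho>"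
      by (simp add: F_def \<psi>_def topsum_eq[OF nM(1)] e_def)
    finally show False by simp
  qed
  then have "F n r1 \<le> F K 1"
    using min[OF M, of 1] r1 by simp
  moreover have "- \<delta> \<le> F n r1"
    using bd[OF nM(1)] by (simp add: F_def)
  ultimately show ?thesis
    by (simp add: F_def)
qed

end

section \<open>Radial integrals on the plane\<close>

text \<open>Discs are mapped to discs, and by Vitali's theorem they exhaust every open set up to a null set.\<close>

lemma distr_lborel_rotation:
  fixes u :: complex
  assumes "cmod u = 1"
  shows "distr lborel borel (\<lambda>z. u * z) = lborel"
proof (rule sym, rule lborel_eqI)
  have u: "u \<noteq> 0" "cmod (inverse u) = 1" using assms by (auto simp: norm_inverse)
  have pre: "(\<lambda>z. u * z) -` A = (\<lambda>z. inverse u * z) ` A" for A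
  proof (intro set_eqI iffI)
    fix z assume "z \<in> (\<lambda>z. u * z) -` A"
    then show "z \<in> (\<lambda>z. inverse u * z) ` A"
      using u(1) by (intro image_eqI[of _ _ "u * z"]) (simp_all flip: mult.assoc)
  next
    fix z assume "z \<in> (\<lambda>z. inverse u * z) ` A"
    then show "z \<in> (\<lambda>z. u * z) -` A"
      using u(1) by (auto simp flip: mult.assoc)
  qed
  have ball: "(\<lambda>z. u * z) -` ball c r = ball (inverse u * c) r" for c r
  proof (intro set_eqI)
    fix z
    have "inverse u * c - z = inverse u * (c - u * z)" using u by (simp add: field_simps)
    then have "dist (inverse u * c) z = dist c (u * z)"
      using u(2) by (simp add: dist_norm norm_mult)
    then show "z \<in> (\<lambda>z. u * z) -` ball c r \<longleftrightarrow> z \<in> ball (inverse u * c) r" by simp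
  qed
  let ?D = "distr lborel borel (\<lambda>z. u * z) :: complex measure"
  have D: "emeasure ?D A = emeasure lborel ((\<lambda>z. u * z) -` A)" if "A \<in> sets borel" for A
    using that by (subst emeasure_distr) auto
  have Dball: "emeasure ?D (ball c r) = emeasure lborel (ball c r)" for c r
  proof (cases "r \<ge> 0")
    case True
    then show ?thesis by (simp add: D ball emeasure_ball)
  qed (simp add: D ball_empty)
  have Dopen: "emeasure ?D S = emeasure lborel S" if "open S" for S
  proof -
    define K where "K = {p. ball (fst p) (snd p) \<subseteq> S}"
    have "\<exists>i. i \<in> K \<and> x \<in> ball (fst i) (snd i) \<and> snd i < d" if "x \<in> S" "0 < d" for x d
    proof -
      obtain e where e: "e > 0" "ball x e \<subseteq> S" using \<open>open S\<close> \<open>x \<in> S\<close> open_contains_ball by blast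
      show ?thesis
        using e that by (intro exI[of _ "(x, min e (d/2))"]) (auto simp: K_def)
    qed
    then obtain C where C: "countable C" "C \<subseteq> K"
      "pairwise (\<lambda>i j. disjnt (ball (fst i) (snd i)) (ball (fst j) (snd j))) C"
      "negligible (S - (\<Union>i\<in>C. ball (fst i) (snd i)))"
      by (rule Vitali_covering_theorem_balls[of S K fst snd])
    define U where "U = (\<Union>i\<in>C. ball (fst i) (snd i))"
    have US: "U \<subseteq> S" "open U" using C(2) by (auto simp: U_def K_def)
    have bor: "S \<in> sets borel" "U \<in> sets borel" "S - U \<in> sets borel"
      using US \<open>open S\<close> by auto
    have "disjoint_family_on (\<lambda>i. ball (fst i) (snd i)) C"
      using C(3) by (auto simp: disjoint_family_on_def pairwise_def disjnt_def)
    then have UU: "emeasure ?D U = emeasure lborel U"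
      unfolding U_def using C(1)
      by (simp add: emeasure_UN_countable Dball)
    have neg: "negligible (S - U)" using C(4) by (simp add: U_def)
    then have "emeasure lborel (S - U) = 0"
      using bor by (simp add: negligible_iff_emeasure0)
    \<comment> \<open>The preimage of the uncovered part is its image under the inverse rotation,
      and a differentiable map of the plane to itself keeps null sets null.\<close>
    have "negligible ((\<lambda>z. inverse u * z) ` (S - U))"
      by (rule negligible_differentiable_image_negligible[OF order_refl neg]) (auto intro!: derivative_intros)
    moreover have "(\<lambda>z. u * z) -` (S - U) \<in> sets borel"
      using bor(3) by (intro measurable_sets_borel[of _ borel]) auto
    ultimately have "emeasure ?D (S - U) = 0"
      using bor by (subst D) (auto simp: negligible_iff_emeasure0 simp flip: pre)
    with \<open>emeasure lborel (S - U) = 0\<close> have "emeasure ?D (U \<union> (S - U)) = emeasure lborel (U \<union> (S - U))"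
      using bor UU by (subst (1 2) plus_emeasure[symmetric]) auto
    moreover have "U \<union> (S - U) = S" using US by auto
    ultimately show ?thesis by simp
  qed
  show "emeasure ?D (box l v) = (\<Prod>b\<in>Basis. (v - l) \<bullet> b)" if "\<And>b. b \<in> Basis \<Longrightarrow> l \<bullet> b \<le> v \<bullet> b" for l v
    by (simp only: Dopen[OF open_box]) (rule emeasure_lborel_box[OF that])
qed auto

lemma integral_rotation:
  fixes f :: "complex \<Rightarrow> 'a :: {banach, second_countable_topology}"
  assumes "cmod u = 1" "f \<in> borel_measurable borel"
  shows "(LINT z|lborel. f (u * z)) = (LINT z|lborel. f z)"
proof -
  have "(LINT z|lborel. f z) = (LINT z|distr lborel borel (\<lambda>z. u * z). f z)"
    by (simp add: distr_lborel_rotation assms)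
  also have "\<dots> = (LINT z|lborel. f (u * z))"
    using assms by (intro integral_distr) auto
  finally show ?thesis ..
qed

text \<open>Rotation by the angle pi / (i - j) preserves area and multiplies the integrand by
  -1.\<close>

lemma integral_radial_orthogonal:
  fixes h :: "real \<Rightarrow> real"
  assumes "i \<noteq> j" and [measurable]: "h \<in> borel_measurable borel"
  shows "(LINT z|lborel. z ^ i * cnj z ^ j * complex_of_real (h (cmod z))) = 0"
proof -
  define u where "u = cis (pi / (real i - real j))"
  have u: "cmod u = 1" by (simp add: u_def)
  have "u ^ i * cnj u ^ j = cis (real i * (pi / (real i - real j)) + real j * (- (pi / (real i - real j))))"
    by (simp only: u_def cis_cnj Complex.DeMoivre cis_mult)
  also have "real i * (pi / (real i - real j)) + real j * (- (pi / (real i - real j)))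
      = (real i - real j) * (pi / (real i - real j))"
    by (simp only: left_diff_distrib)
  also have "\<dots> = pi"
    using assms by simp
  finally have uu: "u ^ i * cnj u ^ j = -1" by simp
  have [measurable]: "cnj \<in> borel_measurable borel"
    by (intro borel_measurable_continuous_onI continuous_intros)
  have "(LINT z|lborel. z ^ i * cnj z ^ j * complex_of_real (h (cmod z)))
      = (LINT z|lborel. (u * z) ^ i * cnj (u * z) ^ j * complex_of_real (h (cmod (u * z))))"
    by (rule integral_rotation[symmetric, OF u]) measurable
  also have "\<dots> = (LINT z|lborel. (u ^ i * cnj u ^ j) * (z ^ i * cnj z ^ j * complex_of_real (h (cmod z))))"
    by (intro Bochner_Integration.integral_cong) (auto simp: power_mult_distrib norm_mult u)
  also have "\<dots> = - (LINT z|lborel. z ^ i * cnj z ^ j * complex_of_real (h (cmod z)))"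
    unfolding uu by simp
  finally show ?thesis by simp
qed

lemma emeasure_cball_complex: "r \<ge> 0 \<Longrightarrow> emeasure lborel (cball c r :: complex set) = ennreal (pi * r\<^sup>2)"
  by (simp add: emeasure_cball unit_ball_vol_2)

text \<open>The area of a disc is pi times its squared radius, so pi |z|^2 is uniformly distributed
  on the half line; the factor \<open>c\<close> in the variable divides the density by
  \<open>c\<close>. This takes the place of polar coordinates.\<close>

lemma distr_radial:
  assumes "c > 0"
  shows "distr lborel borel (\<lambda>z::complex. pi * c * (cmod z)\<^sup>2) = density lborel (\<lambda>y. ennreal (indicator {0..} y / c))"
    (is "?D = ?E")
proof (rule measure_eqI_generator_eq)
  let ?G = "range (\<lambda>a::real. {..a})"
  show "Int_stable ?G" by (auto simp: Int_stable_def)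
  show "?G \<subseteq> Pow UNIV" by auto
  show "sets ?D = sigma_sets UNIV ?G" "sets ?E = sigma_sets UNIV ?G"
    by (simp_all add: borel_eq_atMost)
  have vim: "(\<lambda>z::complex. pi * c * (cmod z)\<^sup>2) -` {..a} = cball 0 (sqrt (a / (pi * c)))" if "a \<ge> 0" for a
  proof (intro set_eqI)
    fix z :: complex
    have "pi * c * (cmod z)\<^sup>2 \<le> a \<longleftrightarrow> (cmod z)\<^sup>2 \<le> a / (pi * c)"
      using assms by (simp add: field_simps)
    also have "\<dots> \<longleftrightarrow> cmod z \<le> sqrt (a / (pi * c))"
      using that assms by (metis norm_ge_zero real_le_rsqrt real_sqrt_le_iff real_sqrt_abs abs_norm_cancel)
    finally show "z \<in> (\<lambda>z. pi * c * (cmod z)\<^sup>2) -` {..a} \<longleftrightarrow> z \<in> cball 0 (sqrt (a / (pi * c)))" by simp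
  qed
  have vim_neg: "(\<lambda>z::complex. pi * c * (cmod z)\<^sup>2) -` {..a} = {}" if "a < 0" for a
  proof -
    have "0 \<le> pi * c * (cmod z)\<^sup>2" for z :: complex using assms by simp
    then show ?thesis using that by (force dest: order_trans)
  qed
  have D: "emeasure ?D {..a} = ennreal (max 0 a / c)" for a
  proof (cases "a \<ge> 0")
    case True
    then show ?thesis using assms
      by (subst emeasure_distr) (auto simp: vim emeasure_cball_complex)
  next
    case False
    then show ?thesis using assms
      by (subst emeasure_distr) (auto simp: vim_neg max_def)
  qed
  have E: "emeasure ?E {..a} = ennreal (max 0 a / c)" for a
  proof -
    have "emeasure ?E {..a} = (\<integral>\<^sup>+ y. ennreal (1 / c) * indicator {0..a} y \<partial>lborel)"
      by (subst emeasure_density) (auto intro!: nn_integral_cong split: split_indicator)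
    also have "\<dots> = ennreal (1 / c) * emeasure lborel {0..a}"
      by (simp add: nn_integral_cmult)
    also have "\<dots> = ennreal (max 0 a / c)"
      using assms by (cases "a \<ge> 0") (auto simp: ennreal_mult[symmetric])
    finally show ?thesis .
  qed
  show "emeasure ?D X = emeasure ?E X" if "X \<in> ?G" for X
    using that D E by auto
  show "range (\<lambda>n::nat. {..real n}) \<subseteq> ?G" by auto
  show "(\<Union>n. {..real n}) = UNIV" using real_arch_simple by auto
  show "emeasure ?D {..real n} \<noteq> \<infinity>" for n by (simp add: D)
qed

lemma nn_integral_radial:
  assumes "c > 0" and [measurable]: "f \<in> borel_measurable borel"
  shows "(\<integral>\<^sup>+z. f (pi * c * (cmod z)\<^sup>2) \<partial>(lborel :: complex measure)) = ennreal (1 / c) * (\<integral>\<^sup>+y. indicator {0..} y * f y \<partial>lborel)"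
proof -
  have "(\<integral>\<^sup>+z. f (pi * c * (cmod z)\<^sup>2) \<partial>(lborel :: complex measure)) = (\<integral>\<^sup>+y. f y \<partial>distr lborel borel (\<lambda>z::complex. pi * c * (cmod z)\<^sup>2))"
    by (subst nn_integral_distr) auto
  also have "\<dots> = (\<integral>\<^sup>+y. ennreal (indicator {0..} y / c) * f y \<partial>lborel)"
    by (simp add: distr_radial assms nn_integral_density)
  also have "\<dots> = (\<integral>\<^sup>+y. ennreal (1 / c) * (indicator {0..} y * f y) \<partial>lborel)"
    by (intro nn_integral_cong) (auto split: split_indicator)
  also have "\<dots> = ennreal (1 / c) * (\<integral>\<^sup>+y. indicator {0..} y * f y \<partial>lborel)"
    by (rule nn_integral_cmult) auto
  finally show ?thesis .
qed

lemma has_bochner_integral_gauss_moment: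
  assumes "c > 0"
  shows "has_bochner_integral lborel (\<lambda>z::complex. (pi * c * (cmod z)\<^sup>2) ^ i * exp (- (pi * c * (cmod z)\<^sup>2))) (fact i / c)"
proof (rule has_bochner_integral_nn_integral)
  have "(\<integral>\<^sup>+z. ennreal ((pi * c * (cmod z)\<^sup>2) ^ i * exp (- (pi * c * (cmod z)\<^sup>2))) \<partial>(lborel :: complex measure))
     = ennreal (1 / c) * (\<integral>\<^sup>+y. indicator {0..} y * ennreal (y ^ i * exp (- y)) \<partial>lborel)"
    by (rule nn_integral_radial[OF assms, of "\<lambda>y. ennreal (y ^ i * exp (- y))"]) auto
  also have "(\<integral>\<^sup>+y. indicator {0..} y * ennreal (y ^ i * exp (- y)) \<partial>lborel)
     = (\<integral>\<^sup>+y. ennreal (indicator {0..} y * y powr (real (Suc i) - 1) / exp y) \<partial>lborel)"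
  \<comment> \<open>At \<open>y = 0\<close> the integrands differ when \<open>i = 0\<close>, since
    \<open>0 ^ 0 = 1\<close> but \<open>0 powr 0 = 0\<close>.\<close>
  proof (rule nn_integral_cong_AE)
    have "AE y in lborel. y \<noteq> (0::real)"
      by (rule AE_lborel_singleton)
    then show "AE y in lborel. indicator {0..} y * ennreal (y ^ i * exp (- y))
        = ennreal (indicator {0..} y * y powr (real (Suc i) - 1) / exp y)"
      by eventually_elim (auto simp: exp_minus powr_realpow field_simps split: split_indicator)
  qed
  also have "\<dots> = ennreal (Gamma (real (Suc i)))"
    by (rule Gamma_conv_nn_integral_real[symmetric]) simp
  also have "Gamma (real (Suc i)) = fact i"
    using Gamma_fact[of i, where 'a = real] by (simp add: add.commute)
  finally show "(\<integral>\<^sup>+z. ennreal ((pi * c * (cmod z)\<^sup>2) ^ i * exp (- (pi * c * (cmod z)\<^sup>2))) \<partial>(lborel :: complex measure))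
     = ennreal (fact i / c)"
    using assms by (simp add: ennreal_mult[symmetric])
qed (use assms in auto)

section \<open>Localisation matrices of dilated sets\<close>

lemma exp_quadratic_bound:
  fixes x :: real
  assumes "\<bar>x\<bar> \<le> 1"
  shows "\<bar>exp x - 1 - x\<bar> \<le> x\<^sup>2"
proof (cases "x \<ge> 0")
  case True
  then have "exp x \<le> 1 + x + x\<^sup>2" using exp_bound[of x] assms by auto
  then show ?thesis using exp_ge_add_one_self[of x] unfolding abs_le_iff by linarith
next
  case False
  \<comment> \<open>For negative \<open>x\<close> the bound is shown for the reciprocal: the product
    is 1 - x^3, hence at least 1, and \<open>1 - x\<close> is at most
    \<open>exp (- x)\<close>.\<close>
  have "(1 + x + x\<^sup>2) * (1 - x) = 1 + (- x) ^ 3"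
    by (simp add: algebra_simps power2_eq_square power3_eq_cube)
  also have "\<dots> \<ge> 1"
    using False by simp
  finally have "1 \<le> (1 + x + x\<^sup>2) * (1 - x)" .
  also have "\<dots> \<le> (1 + x + x\<^sup>2) * exp (- x)"
    using assms exp_ge_add_one_self[of "- x"] by (intro mult_left_mono) auto
  finally have "exp x \<le> 1 + x + x\<^sup>2"
    by (simp add: exp_minus field_simps)
  then show ?thesis using exp_ge_add_one_self[of x] unfolding abs_le_iff by linarith
qed

lemma has_vector_derivative_quadratic:
  fixes F :: "real \<Rightarrow> 'a :: real_normed_vector"
  assumes "d > 0" and F: "\<And>t. \<bar>t\<bar> \<le> d \<Longrightarrow> norm (F (y + t) - F y - t *\<^sub>R D) \<le> K * t\<^sup>2"
  shows "(F has_vector_derivative D) (at y)"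
  unfolding has_vector_derivative_def has_derivative_at
proof
  show "bounded_linear (\<lambda>x. x *\<^sub>R D)" by (rule bounded_linear_scaleR_left)
  have lim: "((\<lambda>t::real. K * \<bar>t\<bar>) \<longlongrightarrow> K * \<bar>0\<bar>) (at 0)" by (intro tendsto_intros)
  have "eventually (\<lambda>t::real. norm (norm (F (y + t) - F y - t *\<^sub>R D) / norm t) \<le> K * \<bar>t\<bar>) (at 0)"
    unfolding eventually_at
  proof (intro exI[of _ d] conjI ballI impI)
    fix t :: real assume "t \<noteq> 0 \<and> dist t 0 < d"
    then have "norm (F (y + t) - F y - t *\<^sub>R D) \<le> K * \<bar>t\<bar> * \<bar>t\<bar>" "t \<noteq> 0"
      using F[of t] by (auto simp: power2_eq_square mult.assoc)
    then show "norm (norm (F (y + t) - F y - t *\<^sub>R D) / norm t) \<le> K * \<bar>t\<bar>"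
      by (simp add: divide_le_eq)
  qed fact
  then show "(\<lambda>t. norm (F (y + t) - F y - t *\<^sub>R D) / norm t) \<midarrow>0\<rightarrow> 0"
    by (rule Lim_null_comparison) (use lim in simp)
qed

text \<open>\<open>a\<close> is bounded only where \<open>f\<close> is nonzero: in the application
  \<open>a\<close> is pi |z|^2 on the whole plane, and \<open>f\<close> carries the indicator of a
  bounded set.\<close>

lemma integral_exp_deriv:
  fixes f :: "complex \<Rightarrow> complex" and a :: "complex \<Rightarrow> real"
  assumes f: "integrable M f" and [measurable]: "a \<in> borel_measurable M"
    and a: "\<And>x. f x \<noteq> 0 \<Longrightarrow> 0 \<le> a x \<and> a x \<le> A" and "A > 0"
  shows "((\<lambda>y. LINT x|M. f x * complex_of_real (exp (- (y * a x)))) has_vector_derivative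
     (LINT x|M. - (complex_of_real (a x) * f x * complex_of_real (exp (- (y * a x)))))) (at y)"
proof -
  have [measurable]: "f \<in> borel_measurable M" using f by simp
  have e: "exp (- (y * a x)) \<le> exp (\<bar>y\<bar> * A)" if "f x \<noteq> 0" for x y
  proof -
    have "- (y * a x) \<le> \<bar>y\<bar> * a x" using a[OF that] by (metis abs_ge_minus_self abs_mult abs_of_nonneg)
    also have "\<dots> \<le> \<bar>y\<bar> * A" using a[OF that] by (intro mult_left_mono) auto
    finally show ?thesis by simp
  qed
  have int1: "integrable M (\<lambda>x. f x * complex_of_real (exp (- (y * a x))))" for y
  proof (rule Bochner_Integration.integrable_bound)
    show "integrable M (\<lambda>x. exp (\<bar>y\<bar> * A) * norm (f x))" using f by simp
    show "AE x in M. norm (f x * complex_of_real (exp (- (y * a x)))) \<le> norm (exp (\<bar>y\<bar> * A) * norm (f x))"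
    proof (rule AE_I2)
      fix x
      show "norm (f x * complex_of_real (exp (- (y * a x)))) \<le> norm (exp (\<bar>y\<bar> * A) * norm (f x))"
      proof (cases "f x = 0")
        case False
        then have "exp (- (y * a x)) * norm (f x) \<le> exp (\<bar>y\<bar> * A) * norm (f x)"
          using e[OF False] by (intro mult_right_mono) auto
        then show ?thesis by (simp add: norm_mult mult.commute)
      qed simp
    qed
  qed measurable
  have int2: "integrable M (\<lambda>x. - (complex_of_real (a x) * f x * complex_of_real (exp (- (y * a x)))))" for y
  proof (rule Bochner_Integration.integrable_bound)
    show "integrable M (\<lambda>x. A * exp (\<bar>y\<bar> * A) * norm (f x))" using f by simp
    show "AE x in M. norm (- (complex_of_real (a x) * f x * complex_of_real (exp (- (y * a x))))) \<le> norm (A * exp (\<bar>y\<bar> * A) * norm (f x))"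
    proof (rule AE_I2)
      fix x
      show "norm (- (complex_of_real (a x) * f x * complex_of_real (exp (- (y * a x))))) \<le> norm (A * exp (\<bar>y\<bar> * A) * norm (f x))"
      proof (cases "f x = 0")
        case False
        then have "a x * exp (- (y * a x)) * norm (f x) \<le> A * exp (\<bar>y\<bar> * A) * norm (f x)"
          using a[OF False] e[OF False] \<open>A > 0\<close> by (intro mult_mono) auto
        then show ?thesis using a[OF False] \<open>A > 0\<close> by (simp add: norm_mult mult_ac)
      qed simp
    qed
  qed measurable
  define K where "K = exp (\<bar>y\<bar> * A) * A\<^sup>2 * (LINT x|M. norm (f x))"
  show ?thesis
  \<comment> \<open>\<open>d = 1 / A\<close> keeps \<open>t * a x\<close> within the range of
    \<open>exp_quadratic_bound\<close>, so the remainder of the integrand is quadratic in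
    \<open>t\<close> with an integrable factor.\<close>
  proof (rule has_vector_derivative_quadratic[where d = "1 / A" and K = K])
    fix t assume t: "\<bar>t\<bar> \<le> 1 / A"
    let ?R = "\<lambda>x. f x * complex_of_real (exp (- ((y + t) * a x))) - f x * complex_of_real (exp (- (y * a x)))
        - t *\<^sub>R (- (complex_of_real (a x) * f x * complex_of_real (exp (- (y * a x)))))"
    have "norm ((LINT x|M. f x * complex_of_real (exp (- ((y + t) * a x)))) - (LINT x|M. f x * complex_of_real (exp (- (y * a x))))
        - t *\<^sub>R (LINT x|M. - (complex_of_real (a x) * f x * complex_of_real (exp (- (y * a x))))))
      = norm (LINT x|M. ?R x)"
      using int1 int2 by (simp add: Bochner_Integration.integral_diff)
    also have "\<dots> \<le> (LINT x|M. exp (\<bar>y\<bar> * A) * A\<^sup>2 * t\<^sup>2 * norm (f x))"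
    proof (rule Bochner_Integration.integral_norm_bound_integral)
      show "integrable M ?R" using int1 int2 by (intro Bochner_Integration.integrable_diff Bochner_Integration.integrable_scaleR_right)
      show "integrable M (\<lambda>x. exp (\<bar>y\<bar> * A) * A\<^sup>2 * t\<^sup>2 * norm (f x))" using f by simp
      fix x
      show "norm (?R x) \<le> exp (\<bar>y\<bar> * A) * A\<^sup>2 * t\<^sup>2 * norm (f x)"
      proof (cases "f x = 0")
        case False
        note ax = a[OF False]
        have "exp (- ((y + t) * a x)) = exp (- (y * a x)) * exp (- (t * a x))"
          by (simp add: algebra_simps flip: exp_add)
        then have "?R x = f x * complex_of_real (exp (- (y * a x)) * (exp (- (t * a x)) - 1 - (- (t * a x))))"
          by (simp add: algebra_simps scaleR_conv_of_real)
        then have "norm (?R x) = norm (f x) * (exp (- (y * a x)) * \<bar>exp (- (t * a x)) - 1 - (- (t * a x))\<bar>)"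
          by (simp only: norm_mult norm_of_real) (simp add: abs_mult)
        also have "\<dots> \<le> norm (f x) * (exp (\<bar>y\<bar> * A) * (A\<^sup>2 * t\<^sup>2))"
        proof (intro mult_left_mono mult_mono)
          have "\<bar>t\<bar> * a x \<le> 1 / A * A"
            using t ax \<open>A > 0\<close> by (intro mult_mono) auto
          then have "\<bar>- (t * a x)\<bar> \<le> 1"
            using ax \<open>A > 0\<close> by (simp add: abs_mult)
          then have "\<bar>exp (- (t * a x)) - 1 - (- (t * a x))\<bar> \<le> (- (t * a x))\<^sup>2"
            by (rule exp_quadratic_bound)
          also have "\<dots> = t\<^sup>2 * (a x)\<^sup>2" by (simp add: power_mult_distrib)
          also have "\<dots> \<le> t\<^sup>2 * A\<^sup>2" using ax by (intro mult_left_mono power_mono) auto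
          finally show "\<bar>exp (- (t * a x)) - 1 - (- (t * a x))\<bar> \<le> A\<^sup>2 * t\<^sup>2" by (simp add: mult.commute)
        qed (use e[OF False] in auto)
        finally show ?thesis by (simp add: mult_ac)
      qed simp
    qed
    also have "\<dots> = K * t\<^sup>2" by (simp add: K_def)
    finally show "norm ((LINT x|M. f x * complex_of_real (exp (- ((y + t) * a x)))) - (LINT x|M. f x * complex_of_real (exp (- (y * a x))))
        - t *\<^sub>R (LINT x|M. - (complex_of_real (a x) * f x * complex_of_real (exp (- (y * a x)))))) \<le> K * t\<^sup>2" .
  qed (use \<open>A > 0\<close> in auto)
qed

lemma set_integrable_continuous_bounded:
  fixes f :: "complex \<Rightarrow> 'a :: {banach, second_countable_topology}"
  assumes "bounded S" "S \<in> sets lebesgue" "continuous_on UNIV f"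
  shows "set_integrable lebesgue S f"
proof -
  obtain R where R: "S \<subseteq> cball 0 R" using assms(1) unfolding bounded_iff by (metis mem_cball_0 subsetI)
  have f: "f \<in> borel_measurable borel"
    using assms(3) by (rule borel_measurable_continuous_onI)
  have "integrable lborel (\<lambda>x. indicator (cball 0 R) x *\<^sub>R f x)"
    using assms(3) by (intro borel_integrable_compact compact_cball) (rule continuous_on_subset, auto)
  then have "set_integrable lebesgue (cball 0 R) f"
    unfolding set_integrable_def using f by (subst integrable_completion) auto
  then show ?thesis
    by (rule set_integrable_subset) (use assms R in auto)
qed

section \<open>Normalised monomials and localisation matrices\<close>

definition gauss :: "complex \<Rightarrow> real" where
  "gauss z = exp (- pi * (cmod z)\<^sup>2)"

text \<open>The squared norm of \<open>z ^ i\<close> in the Fock space is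
  \<open>fact i / pi ^ i\<close>.\<close>

definition fock_coeff :: "nat \<Rightarrow> real" where
  "fock_coeff i = sqrt (pi ^ i / fact i)"

definition fock_basis :: "nat \<Rightarrow> complex \<Rightarrow> complex" where
  "fock_basis i z = complex_of_real (fock_coeff i) * z ^ i"

text \<open>Substituting \<open>w = r z\<close>, this is \<open>1 / r\<^sup>2\<close> times the localisation matrix of \<open>r S\<close>.\<close>

definition toeplitz :: "complex set \<Rightarrow> real \<Rightarrow> nat \<Rightarrow> nat \<Rightarrow> complex" where
  "toeplitz S r i j = (LINT z:S|lebesgue. fock_basis i (of_real r * z) * cnj (fock_basis j (of_real r * z))
      * complex_of_real (gauss (of_real r * z)))"

lemma fock_coeff_pos: "fock_coeff i > 0"
  by (simp add: fock_coeff_def)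

lemma fock_coeff_Suc: "fock_coeff (Suc i) * sqrt (real (Suc i)) = sqrt pi * fock_coeff i"
proof -
  have "pi ^ Suc i / fact (Suc i) * real (Suc i) = pi * (pi ^ i / fact i)"
    by (simp only: fact_Suc power_Suc) (simp add: divide_simps del: of_nat_Suc)
  then show ?thesis
    unfolding fock_coeff_def real_sqrt_mult[symmetric] by simp
qed

lemma fock_basis_sq: "(cmod (fock_basis i z))\<^sup>2 = (pi * (cmod z)\<^sup>2) ^ i / fact i"
  by (simp add: fock_basis_def fock_coeff_def norm_mult norm_power power_mult_distrib flip: power_mult)
     (simp add: mult.commute)

lemma gauss_pos: "gauss z > 0" by (simp add: gauss_def)

lemma gauss_nonneg: "0 \<le> gauss z" by (simp add: gauss_def)

lemma gauss_le_1: "gauss z \<le> 1" by (simp add: gauss_def)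

lemma continuous_gauss [continuous_intros]: "continuous_on S f \<Longrightarrow> continuous_on S (\<lambda>x. gauss (f x))"
  unfolding gauss_def by (intro continuous_intros)

lemma continuous_fock_basis [continuous_intros]: "continuous_on S f \<Longrightarrow> continuous_on S (\<lambda>x. fock_basis i (f x))"
  unfolding fock_basis_def by (intro continuous_intros)

text \<open>The summands are the Poisson probabilities with mean pi |z|^2.\<close>

lemma sum_fock_basis_le: "(\<Sum>i<n. (cmod (fock_basis i z))\<^sup>2 * gauss z) \<le> 1"
proof -
  define y where "y = pi * (cmod z)\<^sup>2"
  have "(\<Sum>i<n. y ^ i / fact i) \<le> (\<Sum>i. y ^ i / fact i)"
    using summable_exp[of y] by (intro sum_le_suminf) (auto simp: y_def field_simps)
  also have "\<dots> = exp y" by (simp add: exp_def field_simps)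
  finally have "(\<Sum>i<n. y ^ i / fact i) * exp (- y) \<le> exp y * exp (- y)"
    by (rule mult_right_mono) simp
  then show ?thesis
    by (simp add: fock_basis_sq gauss_def y_def sum_distrib_right flip: exp_add)
qed

lemma fock_basis_le: "(cmod (fock_basis i z))\<^sup>2 * gauss z \<le> 1"
proof -
  have "(cmod (fock_basis i z))\<^sup>2 * gauss z \<le> (\<Sum>i<Suc i. (cmod (fock_basis i z))\<^sup>2 * gauss z)"
    by (rule member_le_sum[of i "{..<Suc i}" "\<lambda>i. (cmod (fock_basis i z))\<^sup>2 * gauss z"]) (auto simp: gauss_nonneg)
  also have "\<dots> \<le> 1" by (rule sum_fock_basis_le)
  finally show ?thesis .
qed

text \<open>Deliberately lopsided: the Gaussian absorbs the factor with index \<open>i\<close> and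
  \<open>fock_basis j\<close> remains. With \<open>M\<close> in place of \<open>j\<close> this
  bounds the last column uniformly in \<open>i\<close>, by a quantity that is tiny on bounded sets
  for large \<open>M\<close>.\<close>

lemma fock_basis_prod_le:
  "cmod (fock_basis i z * cnj (fock_basis j z) * complex_of_real (gauss z)) \<le> cmod (fock_basis j z)"
proof -
  have "(cmod (fock_basis i z) * gauss z)\<^sup>2 \<le> (cmod (fock_basis i z))\<^sup>2 * gauss z * 1"
    unfolding power_mult_distrib power2_eq_square[of "gauss z"] mult.assoc
    using gauss_pos[of z] gauss_le_1[of z] by (intro mult_left_mono) auto
  also have "\<dots> \<le> 1" using fock_basis_le by simp
  finally have "cmod (fock_basis i z) * gauss z \<le> 1"
    by (simp add: power2_le_iff_abs_le abs_square_le_1 abs_le_iff)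
  then have "cmod (fock_basis i z) * gauss z * cmod (fock_basis j z) \<le> 1 * cmod (fock_basis j z)"
    by (rule mult_right_mono) simp
  then show ?thesis
    using gauss_pos[of z] by (simp add: norm_mult mult_ac)
qed

lemma toeplitz_herm: "toeplitz S r j i = cnj (toeplitz S r i j)"
  unfolding toeplitz_def set_lebesgue_integral_def Bochner_Integration.integral_cnj[symmetric]
  by (intro Bochner_Integration.integral_cong) auto

lemma toeplitz_integrable:
  assumes "bounded S" "S \<in> sets lebesgue"
  shows "set_integrable lebesgue S (\<lambda>z. fock_basis i (of_real r * z) * cnj (fock_basis j (of_real r * z))
      * complex_of_real (gauss (of_real r * z)))"
  by (intro set_integrable_continuous_bounded assms continuous_intros)

lemma toeplitz_form:
  assumes "bounded S" "S \<in> sets lebesgue"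
  shows "sesq M (toeplitz S r) v v =
     complex_of_real (LINT z:S|lebesgue. (cmod (\<Sum>i<M. v i * fock_basis i (of_real r * z)))\<^sup>2 * gauss (of_real r * z))"
proof -
  let ?p = "\<lambda>i z. fock_basis i (of_real r * z)" and ?g = "\<lambda>z. complex_of_real (gauss (of_real r * z))"
  define G where "G i j z = indicator S z *\<^sub>R (?p i z * cnj (?p j z) * ?g z)" for i j z
  have int: "integrable lebesgue (G i j)" for i j
    using toeplitz_integrable[OF assms, of i r j] by (simp add: set_integrable_def G_def[abs_def])
  have "sesq M (toeplitz S r) v v = (\<Sum>i<M. \<Sum>j<M. LINT z|lebesgue. G i j z * (v i * cnj (v j)))"
    using int by (simp add: sesq_def toeplitz_def set_lebesgue_integral_def flip: G_def) (simp only: mult.assoc)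
  also have "\<dots> = (LINT z|lebesgue. (\<Sum>i<M. \<Sum>j<M. G i j z * (v i * cnj (v j))))"
    using int by (simp add: Bochner_Integration.integral_sum)
  also have "\<dots> = (LINT z|lebesgue. complex_of_real (indicator S z *\<^sub>R ((cmod (\<Sum>i<M. v i * ?p i z))\<^sup>2 * gauss (of_real r * z))))"
  proof (intro Bochner_Integration.integral_cong refl)
    fix z
    have "complex_of_real ((cmod (\<Sum>i<M. v i * ?p i z))\<^sup>2) = (\<Sum>i<M. v i * ?p i z) * cnj (\<Sum>i<M. v i * ?p i z)"
      by (rule mult_cnj_self[symmetric])
    also have "\<dots> = (\<Sum>i<M. \<Sum>j<M. v i * ?p i z * cnj (v j * ?p j z))"
      by (simp add: sum_product)
    finally have *: "complex_of_real ((cmod (\<Sum>i<M. v i * ?p i z))\<^sup>2) = (\<Sum>i<M. \<Sum>j<M. v i * ?p i z * cnj (v j * ?p j z))" .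
    show "(\<Sum>i<M. \<Sum>j<M. G i j z * (v i * cnj (v j)))
      = complex_of_real (indicator S z *\<^sub>R ((cmod (\<Sum>i<M. v i * ?p i z))\<^sup>2 * gauss (of_real r * z)))"
      unfolding G_def scaleR_conv_of_real of_real_mult real_scaleR_def * sum_distrib_left sum_distrib_right
      by (intro sum.cong refl) (simp add: mult_ac)
  qed
  also have "\<dots> = complex_of_real (LINT z|lebesgue. indicator S z *\<^sub>R ((cmod (\<Sum>i<M. v i * ?p i z))\<^sup>2 * gauss (of_real r * z)))"
    by (rule integral_complex_of_real)
  finally show ?thesis by (simp add: set_lebesgue_integral_def)
qed

lemma toeplitz_pos:
  assumes "bounded S" "S \<in> sets lebesgue"
  shows "Re (sesq M (toeplitz S r) v v) \<ge> 0"
  unfolding toeplitz_form[OF assms] Re_complex_of_real set_lebesgue_integral_def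
  by (intro Bochner_Integration.integral_nonneg) (auto simp: gauss_nonneg)

text \<open>\<open>r\<close> enters through the monomial factor \<open>r ^ (i + j)\<close>, which
  gives the first term, and through the Gaussian. Differentiating the Gaussian brings down a
  multiple of \<open>z * cnj z\<close>, which raises both indices; \<open>fock_coeff_Suc\<close>
  converts the normalisation.\<close>

lemma toeplitz_flow:
  assumes S: "bounded S" "S \<in> sets lebesgue" and r: "r \<ge> 1"
  shows "((\<lambda>r. toeplitz S r i j) has_vector_derivative
       (1 / r) *\<^sub>R (of_nat (i + j) * toeplitz S r i j
         - 2 * complex_of_real (sqrt (real (Suc i)) * sqrt (real (Suc j))) * toeplitz S r (Suc i) (Suc j))) (at r)"
proof -
  \<comment> \<open>The exponent is made linear in \<open>y\<close>, as
    \<open>integral_exp_deriv\<close> expects; the chain rule then inserts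
    \<open>r\<^sup>2\<close>.\<close>
  define I where "I i j y = (LINT z|lebesgue. (indicator S z *\<^sub>R (z ^ i * cnj z ^ j)) * complex_of_real (exp (- (y * (pi * (cmod z)\<^sup>2)))))" for i j :: nat and y :: real
  define c where "c i j = fock_coeff i * fock_coeff j" for i j
  have T: "toeplitz S r i j = (c i j * r ^ (i + j)) *\<^sub>R I i j (r\<^sup>2)" for r i j
  proof -
    have "toeplitz S r i j = (LINT z|lebesgue. (c i j * r ^ (i + j)) *\<^sub>R ((indicator S z *\<^sub>R (z ^ i * cnj z ^ j)) * complex_of_real (exp (- (r\<^sup>2 * (pi * (cmod z)\<^sup>2))))))"
      unfolding toeplitz_def set_lebesgue_integral_def
      by (intro Bochner_Integration.integral_cong refl)
         (simp add: fock_basis_def gauss_def c_def power_mult_distrib power_add norm_mult scaleR_conv_of_real mult_ac)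
    then show ?thesis unfolding I_def integral_scaleR_right .
  qed
  obtain R where R: "S \<subseteq> cball 0 R" "R > 0" using S(1) unfolding bounded_pos by (metis mem_cball_0 subsetI)
  have dI: "(I i j has_vector_derivative - (pi *\<^sub>R I (Suc i) (Suc j) y)) (at y)" for y
  proof -
    have "(I i j has_vector_derivative (LINT z|lebesgue. - (complex_of_real (pi * (cmod z)\<^sup>2) * (indicator S z *\<^sub>R (z ^ i * cnj z ^ j)) * complex_of_real (exp (- (y * (pi * (cmod z)\<^sup>2))))))) (at y)"
      unfolding I_def
    proof (rule integral_exp_deriv[where A = "pi * R\<^sup>2"])
      show "integrable lebesgue (\<lambda>z. indicator S z *\<^sub>R (z ^ i * cnj z ^ j))"
        unfolding set_integrable_def[symmetric] by (intro set_integrable_continuous_bounded S continuous_intros)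
      show "(\<lambda>z. pi * (cmod z)\<^sup>2) \<in> borel_measurable lebesgue"
        by (intro measurable_completion) simp
      show "0 \<le> pi * (cmod x)\<^sup>2 \<and> pi * (cmod x)\<^sup>2 \<le> pi * R\<^sup>2" if "indicator S x *\<^sub>R (x ^ i * cnj x ^ j) \<noteq> 0" for x
        using that R by (auto simp: indicator_def subset_eq split: if_splits intro!: power_mono mult_left_mono)
      show "0 < pi * R\<^sup>2" using R by simp
    qed
    also have "(LINT z|lebesgue. - (complex_of_real (pi * (cmod z)\<^sup>2) * (indicator S z *\<^sub>R (z ^ i * cnj z ^ j)) * complex_of_real (exp (- (y * (pi * (cmod z)\<^sup>2))))))
      = (LINT z|lebesgue. (- pi) *\<^sub>R ((indicator S z *\<^sub>R (z ^ Suc i * cnj z ^ Suc j)) * complex_of_real (exp (- (y * (pi * (cmod z)\<^sup>2))))))"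
    proof (intro Bochner_Integration.integral_cong refl)
      fix z :: complex
      have "complex_of_real (pi * (cmod z)\<^sup>2) = complex_of_real pi * (z * cnj z)"
        by (simp only: mult_cnj_self of_real_mult)
      then show "- (complex_of_real (pi * (cmod z)\<^sup>2) * (indicator S z *\<^sub>R (z ^ i * cnj z ^ j)) * complex_of_real (exp (- (y * (pi * (cmod z)\<^sup>2)))))
        = (- pi) *\<^sub>R ((indicator S z *\<^sub>R (z ^ Suc i * cnj z ^ Suc j)) * complex_of_real (exp (- (y * (pi * (cmod z)\<^sup>2)))))"
        by (simp only:) (simp add: scaleR_conv_of_real del: of_real_mult)
    qed
    also have "\<dots> = (- pi) *\<^sub>R I (Suc i) (Suc j) y"
      unfolding I_def by (rule integral_scaleR_right)
    finally show ?thesis by simp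
  qed
  have "((\<lambda>r. r\<^sup>2) has_vector_derivative 2 * r) (at r)"
    unfolding has_real_derivative_iff_has_vector_derivative[symmetric] by (auto intro!: derivative_eq_intros)
  from vector_diff_chain_at[OF this dI]
  have "((\<lambda>r. I i j (r\<^sup>2)) has_vector_derivative (2 * r) *\<^sub>R (- (pi *\<^sub>R I (Suc i) (Suc j) (r\<^sup>2)))) (at r)"
    unfolding o_def .
  moreover have "((\<lambda>r. c i j * r ^ (i + j)) has_real_derivative c i j * (real (i + j) * r ^ (i + j - 1))) (at r)"
    by (auto intro!: derivative_eq_intros)
  ultimately have "((\<lambda>r. (c i j * r ^ (i + j)) *\<^sub>R I i j (r\<^sup>2)) has_vector_derivative
     (c i j * r ^ (i + j)) *\<^sub>R ((2 * r) *\<^sub>R (- (pi *\<^sub>R I (Suc i) (Suc j) (r\<^sup>2))))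
     + (c i j * (real (i + j) * r ^ (i + j - 1))) *\<^sub>R I i j (r\<^sup>2)) (at r)"
    by (intro has_vector_derivative_scaleR)
  also have "(c i j * r ^ (i + j)) *\<^sub>R ((2 * r) *\<^sub>R (- (pi *\<^sub>R I (Suc i) (Suc j) (r\<^sup>2))))
     + (c i j * (real (i + j) * r ^ (i + j - 1))) *\<^sub>R I i j (r\<^sup>2)
     = (1 / r) *\<^sub>R (of_nat (i + j) * toeplitz S r i j
         - 2 * complex_of_real (sqrt (real (Suc i)) * sqrt (real (Suc j))) * toeplitz S r (Suc i) (Suc j))"
  proof -
    have "c (Suc i) (Suc j) * (sqrt (real (Suc i)) * sqrt (real (Suc j))) = pi * c i j"
    proof -
      have "c (Suc i) (Suc j) * (sqrt (real (Suc i)) * sqrt (real (Suc j)))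
         = (fock_coeff (Suc i) * sqrt (real (Suc i))) * (fock_coeff (Suc j) * sqrt (real (Suc j)))"
        by (simp add: c_def)
      then show ?thesis unfolding fock_coeff_Suc by (simp add: c_def)
    qed
    then have k: "2 * (sqrt (real (Suc i)) * sqrt (real (Suc j))) * (c (Suc i) (Suc j) * r ^ (Suc i + Suc j)) = 2 * (pi * c i j) * r ^ (i + j + 2)"
      by (simp add: mult_ac)
    have 1: "2 * complex_of_real (sqrt (real (Suc i)) * sqrt (real (Suc j))) * toeplitz S r (Suc i) (Suc j)
       = (2 * (pi * c i j) * r ^ (i + j + 2)) *\<^sub>R I (Suc i) (Suc j) (r\<^sup>2)"
      unfolding T k[symmetric] by (simp only: scaleR_conv_of_real of_real_mult of_real_numeral mult.assoc)
    have 2: "of_nat (i + j) * toeplitz S r i j = (real (i + j) * (c i j * r ^ (i + j))) *\<^sub>R I i j (r\<^sup>2)"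
      unfolding T by (simp only: scaleR_conv_of_real of_real_mult of_real_of_nat_eq mult.assoc)
    \<comment> \<open>At \<open>n = 0\<close> the truncated subtraction does no harm, because the
      factor \<open>real n\<close> vanishes.\<close>
    have n3: "real n * r ^ (n - 1) = real n * r ^ n / r" for n
      using r by (cases n) auto
    have 3: "c i j * (real (i + j) * r ^ (i + j - 1)) = (1 / r) * (real (i + j) * (c i j * r ^ (i + j)))"
      unfolding n3 by simp
    have 4: "c i j * r ^ (i + j) * (2 * r * pi) = (1 / r) * (2 * (pi * c i j) * r ^ (i + j + 2))"
      using r by (simp add: power2_eq_square)
    show ?thesis
      unfolding 1 2 3 scaleR_right_diff_distrib scaleR_scaleR 4[symmetric] scaleR_minus_right
      by (simp only: mult.assoc uminus_add_conv_diff)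
  qed
  finally show ?thesis unfolding T[symmetric] .
qed

lemma ladder_flow_toeplitz:
  assumes "bounded S" "S \<in> sets lebesgue"
  shows "ladder_flow (toeplitz S)"
  by unfold_locales (rule toeplitz_herm, rule toeplitz_pos[OF assms], rule toeplitz_flow[OF assms])

section \<open>Integrals over the plane and the resulting eigenvalue bounds\<close>

lemma fock_basis_sq_scaled:
  assumes "r > 0"
  shows "(cmod (fock_basis i (of_real r * z)))\<^sup>2 * gauss (of_real r * z)
      = (1 / fact i) * ((pi * r\<^sup>2 * (cmod z)\<^sup>2) ^ i * exp (- (pi * r\<^sup>2 * (cmod z)\<^sup>2)))"
  by (simp add: fock_basis_sq gauss_def norm_mult power_mult_distrib mult.assoc)

lemma has_bochner_integral_fock_basis_scaled:
  assumes "r > 0"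
  shows "has_bochner_integral lebesgue (\<lambda>z. (cmod (fock_basis i (of_real r * z)))\<^sup>2 * gauss (of_real r * z)) (1 / r\<^sup>2)"
proof -
  have "has_bochner_integral lborel (\<lambda>z. (cmod (fock_basis i (of_real r * z)))\<^sup>2 * gauss (of_real r * z)) ((1 / fact i) * (fact i / r\<^sup>2))"
    unfolding fock_basis_sq_scaled[OF assms]
    using assms by (intro has_bochner_integral_mult_right has_bochner_integral_gauss_moment) simp
  moreover have "(\<lambda>z. (cmod (fock_basis i (of_real r * z)))\<^sup>2 * gauss (of_real r * z)) \<in> borel_measurable borel"
    by (intro borel_measurable_continuous_onI continuous_intros)
  ultimately show ?thesis
    by (simp add: has_bochner_integral_iff integrable_completion integral_completion)
qed

lemma fock_basis_orthogonal:
  assumes "i \<noteq> j" "0 < r" "h \<in> borel_measurable borel"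
  shows "(LINT z|lebesgue. complex_of_real (h (cmod z)) * (fock_basis i (of_real r * z) * cnj (fock_basis j (of_real r * z)) * complex_of_real (gauss (of_real r * z)))) = 0"
proof -
  note [measurable] = assms(3)
  have [measurable]: "cnj \<in> borel_measurable borel"
    by (intro borel_measurable_continuous_onI continuous_intros)
  define h' where "h' t = h t * exp (- pi * (r * t)\<^sup>2) * (fock_coeff i * fock_coeff j * r ^ (i + j))" for t
  have h'[measurable]: "h' \<in> borel_measurable borel"
    unfolding h'_def by measurable
  have eq: "complex_of_real (h (cmod z)) * (fock_basis i (of_real r * z) * cnj (fock_basis j (of_real r * z)) * complex_of_real (gauss (of_real r * z)))
      = z ^ i * cnj z ^ j * complex_of_real (h' (cmod z))" for z
    using assms by (simp add: fock_basis_def gauss_def h'_def norm_mult power_mult_distrib power_add mult_ac)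
  have "(LINT z|lebesgue. z ^ i * cnj z ^ j * complex_of_real (h' (cmod z))) = (LINT z|lborel. z ^ i * cnj z ^ j * complex_of_real (h' (cmod z)))"
    by (rule integral_completion) measurable
  also have "\<dots> = 0"
    by (rule integral_radial_orthogonal[OF assms(1) h'])
  finally show ?thesis unfolding eq .
qed

lemma fock_basis_inner:
  assumes "r > 0"
  shows "integrable lebesgue (\<lambda>z. fock_basis i (of_real r * z) * cnj (fock_basis j (of_real r * z)) * complex_of_real (gauss (of_real r * z)))"
    and "(LINT z|lebesgue. fock_basis i (of_real r * z) * cnj (fock_basis j (of_real r * z)) * complex_of_real (gauss (of_real r * z)))
       = (if i = j then complex_of_real (1 / r\<^sup>2) else 0)"
proof -
  let ?f = "\<lambda>i z. (cmod (fock_basis i (of_real r * z)))\<^sup>2 * gauss (of_real r * z)"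
  let ?F = "\<lambda>z. fock_basis i (of_real r * z) * cnj (fock_basis j (of_real r * z)) * complex_of_real (gauss (of_real r * z))"
  have int: "integrable lebesgue (?f i)" for i
    using has_bochner_integral_fock_basis_scaled[OF assms] by (auto simp: has_bochner_integral_iff)
  show "integrable lebesgue ?F"
  proof (rule Bochner_Integration.integrable_bound)
    show "integrable lebesgue (\<lambda>z. ?f i z + ?f j z)" using int by simp
    show "?F \<in> borel_measurable lebesgue"
      by (intro measurable_completion) (simp add: borel_measurable_continuous_onI continuous_intros)
    show "AE z in lebesgue. norm (?F z) \<le> norm (?f i z + ?f j z)"
    proof (rule AE_I2)
      fix z
      define a b g where "a = cmod (fock_basis i (of_real r * z))" "b = cmod (fock_basis j (of_real r * z))" "g = gauss (of_real r * z)"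
      have "0 \<le> (a - b)\<^sup>2" "0 \<le> a * b" by (auto simp: a_b_g_def)
      then have "a * b \<le> a\<^sup>2 + b\<^sup>2" by (auto simp: power2_diff)
      then have "a * b * g \<le> (a\<^sup>2 + b\<^sup>2) * g"
        by (rule mult_right_mono) (simp add: a_b_g_def gauss_nonneg)
      moreover have "0 \<le> g" by (simp add: a_b_g_def gauss_nonneg)
      ultimately show "norm (?F z) \<le> norm (?f i z + ?f j z)"
        by (simp add: norm_mult distrib_right flip: a_b_g_def)
    qed
  qed
  show "(LINT z|lebesgue. ?F z) = (if i = j then complex_of_real (1 / r\<^sup>2) else 0)"
  proof (cases "i = j")
    case True
    have "?F z = complex_of_real (?f i z)" for z
      unfolding True mult_cnj_self by simp
    then show ?thesis
      using True has_bochner_integral_fock_basis_scaled[OF assms, of i] integral_complex_of_real[of lebesgue "?f i"]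
      by (simp add: has_bochner_integral_iff del: of_real_mult)
  next
    case False
    then show ?thesis using fock_basis_orthogonal[OF False assms, of "\<lambda>_. 1"] by simp
  qed
qed

lemma complex_norm_sum_sq:
  "complex_of_real ((cmod (\<Sum>i<M. v i * p i))\<^sup>2 * g) = (\<Sum>i<M. \<Sum>j<M. v i * cnj (v j) * (p i * cnj (p j) * complex_of_real g))"
proof -
  have "complex_of_real ((cmod (\<Sum>i<M. v i * p i))\<^sup>2 * g) = (\<Sum>i<M. v i * p i) * cnj (\<Sum>i<M. v i * p i) * complex_of_real g"
    by (simp only: mult_cnj_self of_real_mult)
  also have "\<dots> = (\<Sum>i<M. \<Sum>j<M. v i * p i * cnj (v j * p j) * complex_of_real g)"
    unfolding cnj_sum sum_product by (simp only: sum_distrib_right)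
  finally show ?thesis by (simp add: mult_ac)
qed

lemma has_bochner_integral_fock_poly:
  assumes "r > 0"
  shows "has_bochner_integral lebesgue (\<lambda>z. (cmod (\<Sum>i<M. v i * fock_basis i (of_real r * z)))\<^sup>2 * gauss (of_real r * z))
     ((\<Sum>i<M. (cmod (v i))\<^sup>2) / r\<^sup>2)"
proof -
  let ?F = "\<lambda>i j z. fock_basis i (of_real r * z) * cnj (fock_basis j (of_real r * z)) * complex_of_real (gauss (of_real r * z))"
  have "has_bochner_integral lebesgue (?F i j) (if i = j then complex_of_real (1 / r\<^sup>2) else 0)" for i j
    using fock_basis_inner[OF assms] by (simp add: has_bochner_integral_iff)
  then have "has_bochner_integral lebesgue (\<lambda>z. \<Sum>i<M. \<Sum>j<M. v i * cnj (v j) * ?F i j z)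
     (\<Sum>i<M. \<Sum>j<M. v i * cnj (v j) * (if i = j then complex_of_real (1 / r\<^sup>2) else 0))"
    by (intro has_bochner_integral_sum has_bochner_integral_mult_right)
  also have "(\<Sum>i<M. \<Sum>j<M. v i * cnj (v j) * (if i = j then complex_of_real (1 / r\<^sup>2) else 0))
     = (\<Sum>i<M. v i * cnj (v i) * complex_of_real (1 / r\<^sup>2))"
    by (intro sum.cong refl) (simp add: mult_delta_right)
  also have "\<dots> = complex_of_real ((\<Sum>i<M. (cmod (v i))\<^sup>2) / r\<^sup>2)"
    unfolding mult_cnj_self by (simp add: sum_divide_distrib)
  finally have "has_bochner_integral lebesgue (\<lambda>z. complex_of_real ((cmod (\<Sum>i<M. v i * fock_basis i (of_real r * z)))\<^sup>2 * gauss (of_real r * z)))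
      (complex_of_real ((\<Sum>i<M. (cmod (v i))\<^sup>2) / r\<^sup>2))"
    unfolding complex_norm_sum_sq .
  from has_bochner_integral_Re[OF this] show ?thesis by simp
qed

text \<open>Enlarging \<open>S\<close> to the whole plane only increases the form, and there the
  scaled monomials are orthogonal with squared norm 1 / r^2.\<close>

lemma toeplitz_form_le:
  assumes "bounded S" "S \<in> sets lebesgue" "r > 0"
  shows "Re (sesq M (toeplitz S r) v v) \<le> (\<Sum>i<M. (cmod (v i))\<^sup>2) / r\<^sup>2"
proof -
  let ?f = "\<lambda>z. (cmod (\<Sum>i<M. v i * fock_basis i (of_real r * z)))\<^sup>2 * gauss (of_real r * z)"
  have int: "integrable lebesgue ?f" "integral\<^sup>L lebesgue ?f = (\<Sum>i<M. (cmod (v i))\<^sup>2) / r\<^sup>2"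
    using has_bochner_integral_fock_poly[OF assms(3)] by (auto simp: has_bochner_integral_iff)
  have "(LINT z:S|lebesgue. ?f z) \<le> integral\<^sup>L lebesgue ?f"
    unfolding set_lebesgue_integral_def
    using assms int(1)
    by (intro integral_mono integrable_mult_indicator[of S lebesgue ?f])
       (auto simp: indicator_def gauss_nonneg)
  then show ?thesis
    by (simp add: toeplitz_form assms int(2))
qed

lemma toeplitz_diag:
  "toeplitz S r i i = complex_of_real (LINT z:S|lebesgue. (cmod (fock_basis i (of_real r * z)))\<^sup>2 * gauss (of_real r * z))"
  unfolding toeplitz_def set_lebesgue_integral_def integral_complex_of_real[symmetric] mult_cnj_self
  by (intro Bochner_Integration.integral_cong) (simp_all add: scaleR_conv_of_real)

lemma toeplitz_diag_nonneg: "Re (toeplitz S r i i) \<ge> 0"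
  unfolding toeplitz_diag Re_complex_of_real set_lebesgue_integral_def
  by (intro Bochner_Integration.integral_nonneg) (auto simp: gauss_nonneg)

lemma toeplitz_trace:
  assumes "bounded S" "S \<in> sets lebesgue"
  shows "(\<Sum>i<n. Re (toeplitz S r i i)) = (LINT z:S|lebesgue. \<Sum>i<n. (cmod (fock_basis i (of_real r * z)))\<^sup>2 * gauss (of_real r * z))"
proof -
  let ?f = "\<lambda>i z. (cmod (fock_basis i (of_real r * z)))\<^sup>2 * gauss (of_real r * z)"
  have "set_integrable lebesgue S (?f i)" for i
    by (intro set_integrable_continuous_bounded assms continuous_intros)
  then show ?thesis
    unfolding toeplitz_diag Re_complex_of_real set_lebesgue_integral_def set_integrable_def scaleR_sum_right
    by (simp only: Bochner_Integration.integral_sum)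
qed

lemma toeplitz_trace_le:
  assumes "bounded S" "S \<in> sets lebesgue"
  shows "(\<Sum>i<n. Re (toeplitz S r i i)) \<le> measure lebesgue S"
proof -
  have fin: "S \<in> lmeasurable" using assms by (simp add: bounded_set_imp_lmeasurable)
  have "(LINT z:S|lebesgue. \<Sum>i<n. (cmod (fock_basis i (of_real r * z)))\<^sup>2 * gauss (of_real r * z)) \<le> (LINT z:S|lebesgue. 1)"
    by (intro set_integral_mono set_integrable_continuous_bounded assms continuous_intros sum_fock_basis_le)
  also have "\<dots> = measure lebesgue S"
    using fin by (simp add: set_lebesgue_integral_def)
  finally show ?thesis unfolding toeplitz_trace[OF assms] .
qed

text \<open>Uniform in \<open>i\<close> and in the dilation, as the hypothesis on \<open>b\<close>
  in \<open>topsum_comparison\<close> demands. Boundedness of \<open>S\<close> confines |r z| to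
  \<open>r1 * R\<close>, and the root of the factorial inside \<open>fock_coeff M\<close> eventually
  dominates the power.\<close>

lemma toeplitz_entry_le:
  assumes "bounded S" "S \<in> sets lebesgue" "S \<subseteq> cball 0 R" "0 < R" "measure lebesgue S \<le> s" "0 \<le> r" "r \<le> r1"
  shows "cmod (toeplitz S r i M) \<le> s * (fock_coeff M * (r1 * R) ^ M)"
proof -
  have fin: "S \<in> lmeasurable" using assms by (simp add: bounded_set_imp_lmeasurable)
  let ?q = "fock_coeff M * (r1 * R) ^ M"
  have q: "?q \<ge> 0" using assms fock_coeff_pos[of M] by (simp add: less_imp_le)
  have "cmod (toeplitz S r i M) \<le> (LINT z|lebesgue. ?q * indicator S z)"
    unfolding toeplitz_def set_lebesgue_integral_def
  proof (rule Bochner_Integration.integral_norm_bound_integral)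
    show "integrable lebesgue (\<lambda>z. indicat_real S z *\<^sub>R (fock_basis i (of_real r * z) * cnj (fock_basis M (of_real r * z)) * complex_of_real (gauss (of_real r * z))))"
      using toeplitz_integrable[OF assms(1,2)] unfolding set_integrable_def .
    show "integrable lebesgue (\<lambda>z. ?q * indicator S z)"
      using fin by (intro integrable_mult_right integrable_real_indicator) (auto simp: fmeasurable_def)
    fix z
    show "norm (indicat_real S z *\<^sub>R (fock_basis i (of_real r * z) * cnj (fock_basis M (of_real r * z)) * complex_of_real (gauss (of_real r * z)))) \<le> ?q * indicator S z"
    proof (cases "z \<in> S")
      case True
      then have "cmod z \<le> R" using assms by auto
      then have "cmod (of_real r * z) \<le> r1 * R"
        using assms by (auto simp: norm_mult intro!: mult_mono)
      then have "cmod (fock_basis M (of_real r * z)) \<le> ?q"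
        using fock_coeff_pos[of M] by (auto simp: fock_basis_def norm_mult norm_power intro!: mult_left_mono power_mono)
      then show ?thesis
        using True fock_basis_prod_le[of i "of_real r * z" M] by simp
    qed (simp add: q)
  qed
  also have "\<dots> = ?q * measure lebesgue S"
    using fin by (simp add: fmeasurable_def)
  also have "\<dots> \<le> ?q * s"
    by (rule mult_left_mono) (use assms q in auto)
  finally show ?thesis by (simp add: mult.commute)
qed

text \<open>Each eigenvalue is at most 1 / r^2. All of them are nonnegative, so a partial sum is
  also at most the trace, which is at most the area of \<open>S\<close>.\<close>

lemma toeplitz_topsum_le:
  assumes "bounded S" "S \<in> sets lebesgue" "r > 0" "n \<le> M"
  shows "ladder_flow.topsum (toeplitz S) M n r \<le> min (real n / r\<^sup>2) (measure lebesgue S)"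
proof -
  interpret ladder_flow "toeplitz S" by (rule ladder_flow_toeplitz) fact+
  define e where "e = fst (spec M r)"
  interpret spectral_data M "toeplitz S r" e "snd (spec M r)" unfolding e_def by (rule spec)
  have "topsum M n r \<le> (\<Sum>k<n. 1 / r\<^sup>2)"
    unfolding topsum_eq[OF assms(4)] e_def[symmetric]
    using toeplitz_form_le[OF assms(1-3)] norm_e assms(4)
    by (intro sum_mono) (metis lessThan_iff less_le_trans)
  then have "topsum M n r \<le> real n / r\<^sup>2" by simp
  moreover have "topsum M n r \<le> (\<Sum>j<M. snd (spec M r) j)"
    unfolding topsum_def using assms(4) lam_nonneg[OF pos] by (intro sum_mono2) auto
  moreover have "(\<Sum>j<M. snd (spec M r) j) = (\<Sum>i<M. Re (toeplitz S r i i))"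
  proof -
    have del: "sesq M (toeplitz S r) (\<lambda>m. if m = i then 1 else 0) (\<lambda>m. if m = i then 1 else 0) = toeplitz S r i i" if "i < M" for i
      using that by (simp add: sesq_def mult_delta_right if_distrib[of cnj] cong: if_cong)
    have cd: "cip M (\<lambda>m. if m = i then 1 else 0) v = cnj (v i)" if "i < M" for i v
      using that by (simp add: cip_def mult_delta_left)
    have "(\<Sum>i<M. Re (toeplitz S r i i)) = (\<Sum>i<M. \<Sum>j<M. snd (spec M r) j * (cmod (e j i))\<^sup>2)"
      by (intro sum.cong refl) (simp add: sesq_self cd flip: del)
    also have "\<dots> = (\<Sum>j<M. snd (spec M r) j * (\<Sum>i<M. (cmod (e j i))\<^sup>2))"
      by (subst sum.swap) (simp add: sum_distrib_left)
    also have "\<dots> = (\<Sum>j<M. snd (spec M r) j)"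
      by (simp add: norm_e)
    finally show ?thesis ..
  qed
  ultimately show ?thesis
    using toeplitz_trace_le[OF assms(1,2), of r M] by simp
qed

section \<open>The disc\<close>

definition disc :: "real \<Rightarrow> complex set" where
  "disc s = cball 0 (sqrt (s / pi))"

text \<open>For \<open>n = K\<close> and \<open>r = 1\<close> this is the value of the
  supremum.\<close>

definition disc_sum :: "real \<Rightarrow> nat \<Rightarrow> real \<Rightarrow> real" where
  "disc_sum s n r = (\<Sum>i<n. Re (toeplitz (disc s) r i i))"

lemma disc_props: "bounded (disc s)" "disc s \<in> sets lebesgue" "s \<ge> 0 \<Longrightarrow> emeasure lebesgue (disc s) = ennreal s"
  by (auto simp: disc_def emeasure_cball_complex)

lemma measure_disc: "s \<ge> 0 \<Longrightarrow> measure lebesgue (disc s) = s"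
  unfolding measure_def by (subst disc_props(3)) simp_all

lemma disc_sum_mono: "disc_sum s n r \<le> disc_sum s (Suc n) r"
  by (simp add: disc_sum_def toeplitz_diag_nonneg)

text \<open>On the diagonal the flow gives the difference of consecutive terms of the sequence
  \<open>i * c i\<close>, with \<open>c i\<close> the diagonal entry. The sum telescopes and only
  the entry with index \<open>n\<close> remains.\<close>

lemma disc_sum_deriv:
  assumes "r \<ge> 1"
  shows "(disc_sum s n has_real_derivative - (2 * real n / r) * (disc_sum s (Suc n) r - disc_sum s n r)) (at r)"
proof -
  let ?c = "\<lambda>i. Re (toeplitz (disc s) r i i)"
  have "((\<lambda>r. Re (toeplitz (disc s) r i i)) has_real_derivative (1 / r) * (2 * real i * ?c i - 2 * real (Suc i) * ?c (Suc i))) (at r)" for i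
    unfolding has_real_derivative_iff_has_vector_derivative
    using bounded_linear.has_vector_derivative[OF bounded_linear_Re toeplitz_flow[OF disc_props(1,2) assms, of s i i]]
    by (simp add: algebra_simps flip: of_real_mult)
  then have "((\<lambda>r. \<Sum>i<n. Re (toeplitz (disc s) r i i)) has_real_derivative (\<Sum>i<n. (1 / r) * (2 * real i * ?c i - 2 * real (Suc i) * ?c (Suc i)))) (at r)"
    by (intro DERIV_sum)
  also have "(\<Sum>i<n. (1 / r) * (2 * real i * ?c i - 2 * real (Suc i) * ?c (Suc i))) = - (2 * real n / r) * ?c n"
  proof -
    have "(\<Sum>i<n. 2 * real i * ?c i - 2 * real (Suc i) * ?c (Suc i)) = - (2 * real n) * ?c n"
      by (induction n) (simp_all add: algebra_simps)
    then show ?thesis unfolding sum_distrib_left[symmetric] by simp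
  qed
  finally show ?thesis by (simp add: disc_sum_def[abs_def])
qed

text \<open>Chernoff bound with the factor \<open>\<theta> = 1 / (1 - \<eta>)\<close>.\<close>

lemma poisson_tail:
  fixes y \<eta> :: real
  assumes "0 < \<eta>" "\<eta> < 1" "0 \<le> y" "y \<le> (1 - \<eta>) * real n"
  shows "1 - exp (real n * (\<eta> + ln (1 - \<eta>))) \<le> (\<Sum>i<n. y ^ i / fact i) * exp (- y)"
proof -
  define \<theta> where "\<theta> = 1 / (1 - \<eta>)"
  have \<theta>: "\<theta> \<ge> 1" using assms by (simp add: \<theta>_def field_simps)
  have sm: "summable (\<lambda>i. x ^ i / fact i)" for x :: real
    using summable_exp[of x] by (simp add: field_simps)
  have ex: "(\<Sum>i. x ^ i / fact i) = exp x" for x :: real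
    by (simp add: exp_def field_simps)
  have "exp y = (\<Sum>i<n. y ^ i / fact i) + (\<Sum>i. y ^ (i + n) / fact (i + n))"
    using suminf_split_initial_segment[OF sm[of y], of n] ex[of y] by simp
  also have "(\<Sum>i. y ^ (i + n) / fact (i + n)) \<le> (\<Sum>i. (1 / \<theta> ^ n) * ((\<theta> * y) ^ (i + n) / fact (i + n)))"
  proof (rule suminf_le)
    fix i
    have "y ^ (i + n) \<le> \<theta> ^ i * y ^ (i + n)"
      using \<theta> assms by (simp add: mult_le_cancel_right1)
    also have "\<dots> = (1 / \<theta> ^ n) * (\<theta> * y) ^ (i + n)"
      using \<theta> by (simp add: power_mult_distrib power_add)
    finally have "y ^ (i + n) \<le> (1 / \<theta> ^ n) * (\<theta> * y) ^ (i + n)" .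
    from divide_right_mono[OF this, of "fact (i + n)"]
    show "y ^ (i + n) / fact (i + n) \<le> (1 / \<theta> ^ n) * ((\<theta> * y) ^ (i + n) / fact (i + n))"
      by simp
  next
    show "summable (\<lambda>i. y ^ (i + n) / fact (i + n))"
      using sm by (subst summable_iff_shift[of "\<lambda>i. y ^ i / fact i"]) 
    show "summable (\<lambda>i. (1 / \<theta> ^ n) * ((\<theta> * y) ^ (i + n) / fact (i + n)))"
      using sm by (intro summable_mult) (subst summable_iff_shift[of "\<lambda>i. (\<theta> * y) ^ i / fact i"])
  qed
  also have "(\<Sum>i. (1 / \<theta> ^ n) * ((\<theta> * y) ^ (i + n) / fact (i + n))) = (1 / \<theta> ^ n) * (\<Sum>i. (\<theta> * y) ^ (i + n) / fact (i + n))"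
    by (intro suminf_mult) (use sm in \<open>subst summable_iff_shift[of "\<lambda>i. (\<theta> * y) ^ i / fact i"]\<close>)
  also have "\<dots> \<le> (1 / \<theta> ^ n) * exp (\<theta> * y)"
  proof (rule mult_left_mono)
    have "(\<Sum>i. (\<theta> * y) ^ (i + n) / fact (i + n)) = exp (\<theta> * y) - (\<Sum>i<n. (\<theta> * y) ^ i / fact i)"
      using suminf_split_initial_segment[OF sm[of "\<theta> * y"], of n] ex[of "\<theta> * y"] by simp
    also have "\<dots> \<le> exp (\<theta> * y)"
      using \<theta> assms by (simp add: sum_nonneg)
    finally show "(\<Sum>i. (\<theta> * y) ^ (i + n) / fact (i + n)) \<le> exp (\<theta> * y)" .
  qed (use \<theta> in simp)
  finally have "exp y * exp (- y) \<le> ((\<Sum>i<n. y ^ i / fact i) + (1 / \<theta> ^ n) * exp (\<theta> * y)) * exp (- y)"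
    by (rule mult_right_mono) auto
  then have 1: "1 \<le> (\<Sum>i<n. y ^ i / fact i) * exp (- y) + (1 / \<theta> ^ n) * exp (\<theta> * y) * exp (- y)"
    by (simp add: distrib_right flip: exp_add)
  have "1 / \<theta> ^ n = (1 - \<eta>) ^ n"
    by (simp add: \<theta>_def power_divide)
  also have "\<dots> = exp (real n * ln (1 - \<eta>))"
    using assms by (simp add: exp_of_nat_mult)
  finally have "(1 / \<theta> ^ n) * exp (\<theta> * y) * exp (- y) = exp (real n * ln (1 - \<eta>) + (\<theta> - 1) * y)"
    by (simp add: algebra_simps flip: exp_add)
  also have "\<dots> \<le> exp (real n * (\<eta> + ln (1 - \<eta>)))"
  proof -
    have "(\<theta> - 1) * y \<le> (\<theta> - 1) * ((1 - \<eta>) * real n)"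
      using \<theta> assms by (intro mult_left_mono) auto
    also have "\<dots> = \<eta> * real n"
      using assms by (simp add: \<theta>_def field_simps)
    finally show ?thesis by (simp add: algebra_simps)
  qed
  finally show ?thesis using 1 by simp
qed

text \<open>Only the smaller disc of area \<open>(1 - \<eta>) * m\<close> is counted. There the
  Poisson mean pi r^2 |z|^2 is at most \<open>(1 - \<eta>) * n\<close>, because
  \<open>r\<^sup>2 * m \<le> n\<close>, so \<open>poisson_tail\<close> bounds the density of the
  first \<open>n\<close> monomials from below.\<close>

lemma disc_sum_ge:
  fixes n :: nat
  assumes "0 < \<eta>" "\<eta> < 1" "r \<ge> 1" "s > 0"
  defines "m \<equiv> min (real n / r\<^sup>2) s"
  shows "(1 - \<eta>) * m * (1 - exp (real n * (\<eta> + ln (1 - \<eta>)))) \<le> disc_sum s n r"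
proof -
  define E where "E = disc ((1 - \<eta>) * m)"
  have m: "m \<ge> 0" "m \<le> s" "r\<^sup>2 * m \<le> real n" using assms by (auto simp: m_def min_def field_simps)
  have em: "(1 - \<eta>) * m \<ge> 0" "(1 - \<eta>) * m \<le> s"
    using assms m mult_mono[of "1 - \<eta>" 1 m s] by auto
  have sub: "E \<subseteq> disc s"
    unfolding E_def disc_def using em by (intro subset_cball) (simp add: divide_right_mono)
  let ?f = "\<lambda>z. \<Sum>i<n. (cmod (fock_basis i (of_real r * z)))\<^sup>2 * gauss (of_real r * z)"
  let ?a = "1 - exp (real n * (\<eta> + ln (1 - \<eta>)))"
  have intf: "set_integrable lebesgue (disc t) ?f" for t
    by (intro set_integrable_continuous_bounded disc_props continuous_intros)
  have "(1 - \<eta>) * m * ?a = (LINT z:E|lebesgue. ?a)"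
    using em disc_props by (simp add: set_lebesgue_integral_def E_def measure_disc bounded_set_imp_lmeasurable)
  also have "\<dots> \<le> (LINT z:E|lebesgue. ?f z)"
  proof (intro set_integral_mono)
    show "set_integrable lebesgue E (\<lambda>z. ?a)" unfolding E_def
      by (intro set_integrable_continuous_bounded disc_props continuous_intros)
    show "set_integrable lebesgue E ?f" unfolding E_def by (rule intf)
    fix z assume "z \<in> E"
    then have "(cmod z)\<^sup>2 \<le> (sqrt ((1 - \<eta>) * m / pi))\<^sup>2"
      by (intro power_mono) (simp_all add: E_def disc_def)
    also have "\<dots> = (1 - \<eta>) * m / pi"
      using em(1) by (intro real_sqrt_pow2) simp
    finally have "(cmod z)\<^sup>2 \<le> (1 - \<eta>) * m / pi" .
    then have "pi * r\<^sup>2 * (cmod z)\<^sup>2 \<le> pi * r\<^sup>2 * ((1 - \<eta>) * m / pi)"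
      by (rule mult_left_mono) simp
    also have "\<dots> = (1 - \<eta>) * (r\<^sup>2 * m)" by simp
    also have "\<dots> \<le> (1 - \<eta>) * real n"
      using m assms by (intro mult_left_mono) auto
    finally have "?a \<le> (\<Sum>i<n. (pi * r\<^sup>2 * (cmod z)\<^sup>2) ^ i / fact i) * exp (- (pi * r\<^sup>2 * (cmod z)\<^sup>2))"
      using assms by (intro poisson_tail) auto
    also have "\<dots> = ?f z"
      using assms by (simp add: fock_basis_sq_scaled sum_distrib_right)
    finally show "?a \<le> ?f z" .
  qed
  also have "\<dots> \<le> (LINT z:disc s|lebesgue. ?f z)"
    unfolding set_lebesgue_integral_def
    using intf sub unfolding E_def set_integrable_def
    by (intro integral_mono) (auto simp: indicator_def gauss_nonneg sum_nonneg)
  also have "\<dots> = disc_sum s n r"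
    unfolding disc_sum_def by (rule toeplitz_trace[symmetric]) (rule disc_props)+
  finally show ?thesis .
qed

lemma add_ln_neg:
  fixes \<eta> :: real
  assumes "0 < \<eta>" "\<eta> < 1"
  shows "\<eta> + ln (1 - \<eta>) < 0"
  using assms ln_le_minus_one[of "1 - \<eta>"] ln_eq_minus_one[of "1 - \<eta>"]
  by (cases "ln (1 - \<eta>) = - \<eta>") auto

text \<open>Both sums are compared with the minimum \<open>m\<close> of n / r^2 and
  \<open>s\<close>. The loss must not depend on \<open>n\<close>, because the comparison minimises
  over all n \<le> M. The exponential tail \<open>x\<close> achieves this: \<open>m\<close> is at
  most n / r^2, and \<open>n * \<kappa> * x\<close> is at most 1.\<close>

lemma topsum_le_disc_sum_large:
  assumes "bounded S" "S \<in> sets lebesgue" "measure lebesgue S \<le> s" "s > 0" "n \<le> M" "0 < \<eta>" "\<eta> < 1" "r \<ge> 1"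
  shows "ladder_flow.topsum (toeplitz S) M n r \<le> disc_sum s n r + (\<eta> * s + 1 / (- (\<eta> + ln (1 - \<eta>)) * r\<^sup>2))"
proof -
  define \<kappa> where "\<kappa> = - (\<eta> + ln (1 - \<eta>))"
  have \<kappa>: "\<kappa> > 0"
    using add_ln_neg[OF assms(6,7)] by (simp add: \<kappa>_def)
  define m where "m = min (real n / r\<^sup>2) s"
  have m: "0 \<le> m" "m \<le> s" "m \<le> real n / r\<^sup>2" using assms by (auto simp: m_def)
  define x where "x = exp (- (real n * \<kappa>))"
  have x: "0 \<le> x" "x \<le> 1" "real n * \<kappa> * x \<le> 1"
  proof -
    show "0 \<le> x" "x \<le> 1" using \<kappa> by (auto simp: x_def)
    have "real n * \<kappa> \<le> exp (real n * \<kappa>)" using exp_ge_add_one_self[of "real n * \<kappa>"] by linarith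
    then have "real n * \<kappa> * x \<le> exp (real n * \<kappa>) * x" by (rule mult_right_mono) (simp add: x_def)
    then show "real n * \<kappa> * x \<le> 1" by (simp add: x_def flip: exp_add)
  qed
  have "ladder_flow.topsum (toeplitz S) M n r \<le> m"
    using toeplitz_topsum_le[OF assms(1,2) _ assms(5), of r] assms by (auto simp: m_def)
  also have "m = (1 - \<eta>) * m * (1 - x) + (\<eta> * m + (1 - \<eta>) * (m * x))"
    by (simp add: algebra_simps)
  also have "(1 - \<eta>) * m * (1 - x) \<le> disc_sum s n r"
    using disc_sum_ge[OF assms(6-8,4), of n] unfolding m_def x_def \<kappa>_def mult_minus_right minus_minus .
  also have "\<eta> * m \<le> \<eta> * s" using m assms by simp
  also have "(1 - \<eta>) * (m * x) \<le> 1 * (m * x)"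
    using m x assms by (intro mult_right_mono) auto
  also have "1 * (m * x) \<le> (real n / r\<^sup>2) * x"
    using mult_right_mono[OF m(3) x(1)] by simp
  also have "\<dots> \<le> 1 / (\<kappa> * r\<^sup>2)"
    using x \<kappa> assms by (simp add: field_simps)
  finally show ?thesis
    unfolding \<kappa>_def by simp
qed

section \<open>Choice of the dilation and of the truncation\<close>

lemma truncation_error_tendsto_0:
  fixes s x :: real
  assumes "s \<ge> 0" "x \<ge> 0"
  shows "(\<lambda>M. 2 * real M * ((2 * real M + 1) * (s * (fock_coeff M * x ^ M) * real M))) \<longlonglongrightarrow> 0"
proof -
  \<comment> \<open>The factors of \<open>M\<close> are bounded by \<open>6 * M ^ 3\<close>. Squared
    under the root, the cube is absorbed by \<open>M ^ 6 \<le> 720 * exp 1 ^ M\<close>, where 720 is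
    \<open>fact 6\<close>; hence the factor \<open>exp 1\<close> in \<open>z\<close>.\<close>
  define z where "z = exp 1 * (pi * x\<^sup>2)"
  have z: "z \<ge> 0" by (simp add: z_def)
  have "(\<lambda>M. z ^ M / fact M) \<longlonglongrightarrow> 0"
    using summable_LIMSEQ_zero[OF summable_exp[of z]] by (simp add: field_simps)
  then have "(\<lambda>M. 6 * s * sqrt (720 * (z ^ M / fact M))) \<longlonglongrightarrow> 6 * s * sqrt (720 * 0)"
    by (intro tendsto_intros)
  then have lim: "(\<lambda>M. 6 * s * sqrt (720 * (z ^ M / fact M))) \<longlonglongrightarrow> 0" by simp
  show ?thesis
  proof (rule tendsto_sandwich[OF _ _ tendsto_const lim])
    show "\<forall>\<^sub>F M in sequentially. 0 \<le> 2 * real M * ((2 * real M + 1) * (s * (fock_coeff M * x ^ M) * real M))"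
      using assms fock_coeff_pos by (intro always_eventually) (auto simp: less_imp_le)
    show "\<forall>\<^sub>F M in sequentially. 2 * real M * ((2 * real M + 1) * (s * (fock_coeff M * x ^ M) * real M)) \<le> 6 * s * sqrt (720 * (z ^ M / fact M))"
    proof (intro always_eventually allI)
      fix M :: nat
      have "real M ^ 6 / fact 6 \<le> (\<Sum>i. real M ^ i / fact i)"
        using summable_exp[of "real M"] sum_le_suminf[of "\<lambda>i. real M ^ i / fact i" "{6}"] by (simp add: field_simps)
      also have "\<dots> = exp (real M)"
        by (simp add: exp_def field_simps)
      also have "\<dots> = exp 1 ^ M"
        by (simp flip: exp_of_nat_mult)
      finally have "real M ^ 6 \<le> 720 * exp 1 ^ M" by (simp add: fact_numeral)
      then have "real M ^ 6 * ((pi * x\<^sup>2) ^ M / fact M) \<le> (720 * exp 1 ^ M) * ((pi * x\<^sup>2) ^ M / fact M)"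
        by (rule mult_right_mono) simp
      also have "\<dots> = 720 * (z ^ M / fact M)"
        by (simp add: z_def power_mult_distrib)
      finally have "sqrt (real M ^ 6 * ((pi * x\<^sup>2) ^ M / fact M)) \<le> sqrt (720 * (z ^ M / fact M))"
        by simp
      also have "sqrt (real M ^ 6 * ((pi * x\<^sup>2) ^ M / fact M)) = real M ^ 3 * (fock_coeff M * x ^ M)"
      proof (rule real_sqrt_unique)
        show "(real M ^ 3 * (fock_coeff M * x ^ M))\<^sup>2 = real M ^ 6 * ((pi * x\<^sup>2) ^ M / fact M)"
          by (simp add: fock_coeff_def power_mult_distrib power_divide flip: power_mult) (simp add: mult.commute)
      qed (use assms fock_coeff_pos[of M] in auto)
      finally have "6 * s * (real M ^ 3 * (fock_coeff M * x ^ M)) \<le> 6 * s * sqrt (720 * (z ^ M / fact M))"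
        using assms by (intro mult_left_mono) auto
      moreover have "2 * real M * ((2 * real M + 1) * (s * (fock_coeff M * x ^ M) * real M))
          = (2 * real M * (2 * real M + 1) * real M) * (s * (fock_coeff M * x ^ M))" by simp
      moreover have "\<dots> \<le> (6 * real M ^ 3) * (s * (fock_coeff M * x ^ M))"
      proof (rule mult_right_mono)
        have "(2 * real M + 1) * real M \<le> 3 * real M * real M" by (cases M) auto
        then have "(2 * real M) * ((2 * real M + 1) * real M) \<le> (2 * real M) * (3 * real M * real M)"
          by (rule mult_left_mono) simp
        then show "2 * real M * (2 * real M + 1) * real M \<le> 6 * real M ^ 3"
          by (simp add: power3_eq_cube mult.assoc)
      qed (use assms fock_coeff_pos[of M] in auto)
      ultimately show "2 * real M * ((2 * real M + 1) * (s * (fock_coeff M * x ^ M) * real M)) \<le> 6 * s * sqrt (720 * (z ^ M / fact M))"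
        by (simp add: mult_ac)
    qed
  qed
qed

text \<open>The error consists of three parts of size at most \<epsilon> / 3: \<eta> controls the
  shrinking of the disc, \<open>r1\<close> the exponential tail, and only then is \<open>M\<close>
  taken large enough for the truncation.\<close>

lemma topsum_le_disc_sum:
  assumes S: "bounded S" "S \<in> sets lebesgue" "measure lebesgue S \<le> s" and s: "s > 0" and K: "1 \<le> K" and "\<epsilon> > 0"
  shows "\<forall>\<^sub>F M in sequentially. ladder_flow.topsum (toeplitz S) M K 1 \<le> disc_sum s K 1 + \<epsilon>"
proof -
  interpret ladder_flow "toeplitz S" by (rule ladder_flow_toeplitz) fact+
  define \<eta> where "\<eta> = min (1 / 2) (\<epsilon> / (3 * s))"
  have \<eta>: "0 < \<eta>" "\<eta> < 1" "\<eta> * s \<le> \<epsilon> / 3"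
    using s \<open>\<epsilon> > 0\<close> by (auto simp: \<eta>_def min_def field_simps)
  define \<kappa> where "\<kappa> = - (\<eta> + ln (1 - \<eta>))"
  have \<kappa>: "\<kappa> > 0"
    using add_ln_neg[OF \<eta>(1,2)] by (simp add: \<kappa>_def)
  define r1 where "r1 = max 1 (3 / (\<kappa> * \<epsilon>))"
  have r1: "r1 \<ge> 1" "1 / (\<kappa> * r1\<^sup>2) \<le> \<epsilon> / 3"
  proof -
    show "r1 \<ge> 1" by (simp add: r1_def)
    then have "3 / (\<kappa> * \<epsilon>) \<le> r1\<^sup>2"
      using self_le_power[of r1 2] by (simp add: r1_def)
    then show "1 / (\<kappa> * r1\<^sup>2) \<le> \<epsilon> / 3"
      using \<kappa> \<open>\<epsilon> > 0\<close> \<open>r1 \<ge> 1\<close> by (simp add: field_simps)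
  qed
  obtain R where R: "S \<subseteq> cball 0 R" "R > 0"
    using S(1) unfolding bounded_pos by (metis mem_cball_0 subsetI)
  define b where "b M = s * (fock_coeff M * (r1 * R) ^ M)" for M
  have "(\<lambda>M. 2 * real M * ((2 * real M + 1) * (b M * real M))) \<longlonglongrightarrow> 0"
    unfolding b_def using s r1 R by (intro truncation_error_tendsto_0) auto
  then have "\<forall>\<^sub>F M in sequentially. 2 * real M * ((2 * real M + 1) * (b M * real M)) < \<epsilon> / (3 * r1)"
    using \<open>\<epsilon> > 0\<close> r1 by (intro order_tendstoD) auto
  moreover have "\<forall>\<^sub>F M in sequentially. K \<le> M" by (rule eventually_ge_at_top)
  ultimately show ?thesis
  proof eventually_elim
    case (elim M)
    \<comment> \<open>The slope is \<open>\<epsilon> / (3 * r1)\<close>, so that over the length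
      \<open>r1 - 1\<close> it contributes at most \<epsilon> / 3.\<close>
    have "topsum M K 1 \<le> disc_sum s K 1 + (\<eta> * s + 1 / (\<kappa> * r1\<^sup>2)) + \<epsilon> / (3 * r1) * (r1 - 1)"
    proof (rule topsum_comparison)
      show "1 \<le> r1" "1 \<le> K" "K \<le> M" by fact+
      show "cmod (toeplitz S r i M) \<le> b M" if "r \<in> {1..r1}" for r i
        unfolding b_def using that by (intro toeplitz_entry_le S R) auto
      show "topsum M n r1 \<le> disc_sum s n r1 + (\<eta> * s + 1 / (\<kappa> * r1\<^sup>2))" if "n \<le> M" for n
        unfolding \<kappa>_def by (intro topsum_le_disc_sum_large S s that \<eta> r1)
    qed (use elim disc_sum_deriv disc_sum_mono in auto)
    also have "\<epsilon> / (3 * r1) * (r1 - 1) \<le> \<epsilon> / 3"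
      using \<open>\<epsilon> > 0\<close> r1 by (simp add: field_simps)
    finally show ?case using \<eta> r1 by simp
  qed
qed

section \<open>The Fock space\<close>

lemma fock_space_gauss: "f \<in> fock_space \<longleftrightarrow> f holomorphic_on UNIV \<and> integrable lebesgue (\<lambda>z. (cmod (f z))\<^sup>2 * gauss z)"
  by (simp add: fock_space_def gauss_def)

lemma fock_inner_gauss: "fock_inner f g = (LINT z|lebesgue. f z * cnj (g z) * complex_of_real (gauss z))"
  by (simp add: fock_inner_def gauss_def)

lemma fock_space_continuous: "f \<in> fock_space \<Longrightarrow> continuous_on S f"
  unfolding fock_space_gauss using holomorphic_on_imp_continuous_on continuous_on_subset by blast

lemma fock_space_scale:
  assumes "f \<in> fock_space"
  shows "(\<lambda>z. c * f z) \<in> fock_space"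
proof -
  have "integrable lebesgue (\<lambda>z. (cmod c)\<^sup>2 * ((cmod (f z))\<^sup>2 * gauss z))"
    using assms by (simp add: fock_space_gauss)
  then show ?thesis
    using assms by (auto simp: fock_space_gauss norm_mult power_mult_distrib mult.assoc intro!: holomorphic_intros)
qed

lemma fock_space_add:
  assumes "f \<in> fock_space" "g \<in> fock_space"
  shows "(\<lambda>z. f z + g z) \<in> fock_space"
proof -
  have "integrable lebesgue (\<lambda>z. (cmod (f z + g z))\<^sup>2 * gauss z)"
  proof (rule Bochner_Integration.integrable_bound)
    show "integrable lebesgue (\<lambda>z. 2 * ((cmod (f z))\<^sup>2 * gauss z) + 2 * ((cmod (g z))\<^sup>2 * gauss z))"
      using assms by (simp add: fock_space_gauss)
    show "(\<lambda>z. (cmod (f z + g z))\<^sup>2 * gauss z) \<in> borel_measurable lebesgue"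
      by (intro measurable_completion) (simp add: borel_measurable_continuous_onI continuous_intros fock_space_continuous assms)
    show "AE z in lebesgue. norm ((cmod (f z + g z))\<^sup>2 * gauss z) \<le> norm (2 * ((cmod (f z))\<^sup>2 * gauss z) + 2 * ((cmod (g z))\<^sup>2 * gauss z))"
    proof (rule AE_I2)
      fix z
      have "(cmod (f z + g z))\<^sup>2 \<le> (cmod (f z) + cmod (g z))\<^sup>2"
        by (intro power_mono norm_triangle_ineq) simp
      also have "\<dots> \<le> 2 * (cmod (f z))\<^sup>2 + 2 * (cmod (g z))\<^sup>2"
        using sum_squares_bound[of "cmod (f z)" "cmod (g z)"] by (simp add: power2_sum)
      finally have "(cmod (f z + g z))\<^sup>2 * gauss z \<le> (2 * (cmod (f z))\<^sup>2 + 2 * (cmod (g z))\<^sup>2) * gauss z"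
        by (rule mult_right_mono) (simp add: gauss_nonneg)
      then show "norm ((cmod (f z + g z))\<^sup>2 * gauss z) \<le> norm (2 * ((cmod (f z))\<^sup>2 * gauss z) + 2 * ((cmod (g z))\<^sup>2 * gauss z))"
        using gauss_pos[of z] by (simp add: distrib_right abs_of_nonneg)
    qed
  qed
  then show ?thesis
    using assms by (auto simp: fock_space_gauss intro!: holomorphic_intros)
qed

lemma fock_space_zero: "(\<lambda>z. 0) \<in> fock_space"
  by (simp add: fock_space_gauss)

lemma fock_space_sum: "(\<And>a. a \<in> A \<Longrightarrow> f a \<in> fock_space) \<Longrightarrow> (\<lambda>z. \<Sum>a\<in>A. f a z) \<in> fock_space"
  by (induction A rule: infinite_finite_induct) (simp_all add: fock_space_zero fock_space_add)

lemma fock_inner_integrable: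
  assumes "f \<in> fock_space" "g \<in> fock_space"
  shows "integrable lebesgue (\<lambda>z. f z * cnj (g z) * complex_of_real (gauss z))"
proof (rule Bochner_Integration.integrable_bound)
  show "integrable lebesgue (\<lambda>z. (cmod (f z))\<^sup>2 * gauss z + (cmod (g z))\<^sup>2 * gauss z)"
    using assms by (simp add: fock_space_gauss)
  show "(\<lambda>z. f z * cnj (g z) * complex_of_real (gauss z)) \<in> borel_measurable lebesgue"
    by (intro measurable_completion) (simp add: borel_measurable_continuous_onI continuous_intros fock_space_continuous assms)
  show "AE z in lebesgue. norm (f z * cnj (g z) * complex_of_real (gauss z)) \<le> norm ((cmod (f z))\<^sup>2 * gauss z + (cmod (g z))\<^sup>2 * gauss z)"
  proof (rule AE_I2)
    fix z
    have "cmod (f z) * cmod (g z) \<le> (cmod (f z))\<^sup>2 + (cmod (g z))\<^sup>2"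
      using sum_squares_bound[of "cmod (f z)" "cmod (g z)"] mult_nonneg_nonneg[OF norm_ge_zero norm_ge_zero, of "f z" "g z"]
      unfolding mult.assoc by linarith
    then have "cmod (f z) * cmod (g z) * gauss z \<le> ((cmod (f z))\<^sup>2 + (cmod (g z))\<^sup>2) * gauss z"
      by (rule mult_right_mono) (simp add: gauss_nonneg)
    then show "norm (f z * cnj (g z) * complex_of_real (gauss z)) \<le> norm ((cmod (f z))\<^sup>2 * gauss z + (cmod (g z))\<^sup>2 * gauss z)"
      using gauss_pos[of z] by (simp add: norm_mult distrib_right abs_of_nonneg)
  qed
qed

lemma fock_inner_cnj: "cnj (fock_inner f g) = fock_inner g f"
  unfolding fock_inner_def Bochner_Integration.integral_cnj[symmetric]
  by (intro Bochner_Integration.integral_cong) auto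

lemma fock_inner_scale: "fock_inner (\<lambda>z. c * f z) g = c * fock_inner f g"
  unfolding fock_inner_def Bochner_Integration.integral_mult_right_zero[symmetric]
  by (intro Bochner_Integration.integral_cong) auto

lemma fock_inner_add:
  assumes "f \<in> fock_space" "h \<in> fock_space" "g \<in> fock_space"
  shows "fock_inner (\<lambda>z. f z + h z) g = fock_inner f g + fock_inner h g"
  unfolding fock_inner_gauss distrib_right
  using assms by (intro Bochner_Integration.integral_add fock_inner_integrable)

lemma fock_inner_sum:
  assumes "\<And>a. a \<in> A \<Longrightarrow> f a \<in> fock_space" "g \<in> fock_space"
  shows "fock_inner (\<lambda>z. \<Sum>a\<in>A. f a z) g = (\<Sum>a\<in>A. fock_inner (f a) g)"
  using assms(1)
proof (induction A rule: infinite_finite_induct)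
  case (insert x F)
  then show ?case
    using fock_inner_add[of "f x" "\<lambda>z. \<Sum>a\<in>F. f a z" g] fock_space_sum[of F f] assms(2) by simp
qed (simp_all add: fock_inner_def)

lemma fock_inner_self_nonneg: "Re (fock_inner f f) \<ge> 0"
proof -
  have "fock_inner f f = complex_of_real (LINT z|lebesgue. (cmod (f z))\<^sup>2 * gauss z)"
    unfolding fock_inner_gauss mult_cnj_self of_real_mult[symmetric] by (rule integral_complex_of_real)
  then show ?thesis
    by (auto intro!: Bochner_Integration.integral_nonneg simp: gauss_nonneg)
qed

section \<open>Bessel's inequality and Taylor expansion in the Fock space\<close>

lemma fock_bessel:
  assumes f: "f \<in> fock_space" and u: "\<And>a. a \<in> A \<Longrightarrow> u a \<in> fock_space" and "finite A"
    and orth: "\<And>a b. a \<in> A \<Longrightarrow> b \<in> A \<Longrightarrow> fock_inner (u a) (u b) = (if a = b then 1 else 0)"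
  shows "(\<Sum>a\<in>A. (cmod (fock_inner f (u a)))\<^sup>2) \<le> Re (fock_inner f f)"
proof -
  define c where "c a = fock_inner f (u a)" for a
  define h where "h z = (\<Sum>a\<in>A. - c a * u a z)" for z
  have cu: "(\<lambda>z. - c a * u a z) \<in> fock_space" if "a \<in> A" for a
    using fock_space_scale[OF u[OF that]] .
  have h: "h \<in> fock_space"
    unfolding h_def using cu by (intro fock_space_sum)
  define k where "k z = f z + h z" for z
  have k: "k \<in> fock_space" unfolding k_def by (intro fock_space_add f h)
  have hu: "fock_inner h g = (\<Sum>a\<in>A. - c a * fock_inner (u a) g)" if "g \<in> fock_space" for g
    unfolding h_def using fock_inner_sum[OF cu that] by (simp only: fock_inner_scale)
  have kg: "fock_inner k g = fock_inner f g + fock_inner h g" if "g \<in> fock_space" for g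
    unfolding k_def by (rule fock_inner_add[OF f h that])
  have ku: "fock_inner k (u b) = 0" if "b \<in> A" for b
    using that \<open>finite A\<close> by (simp add: kg u hu orth mult_delta_right c_def sum_negf)
  have "fock_inner h k = 0"
    unfolding hu[OF k] using ku fock_inner_cnj[of k] by (metis (no_types, lifting) complex_cnj_zero mult_zero_right sum.neutral)
  have "fock_inner k k = fock_inner f k + fock_inner h k" by (rule kg[OF k])
  also have "\<dots> = cnj (fock_inner k f)" using \<open>fock_inner h k = 0\<close> by (simp add: fock_inner_cnj)
  also have "\<dots> = cnj (fock_inner f f + (\<Sum>a\<in>A. - (c a * cnj (c a))))"
    unfolding kg[OF f] hu[OF f] by (simp add: c_def fock_inner_cnj)
  also have "\<dots> = cnj (fock_inner f f - complex_of_real (\<Sum>a\<in>A. (cmod (c a))\<^sup>2))"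
    unfolding mult_cnj_self by (simp add: sum_negf)
  finally have "Re (fock_inner k k) = Re (fock_inner f f) - (\<Sum>a\<in>A. (cmod (c a))\<^sup>2)" by simp
  then show ?thesis
    using fock_inner_self_nonneg[of k] by (simp add: c_def)
qed

lemma fock_basis_in_fock_space: "fock_basis i \<in> fock_space"
  using has_bochner_integral_fock_basis_scaled[of 1 i]
  by (auto simp: fock_space_gauss fock_basis_def[abs_def] has_bochner_integral_iff intro!: holomorphic_intros)

lemma fock_basis_orthonormal: "fock_inner (fock_basis i) (fock_basis j) = (if i = j then 1 else 0)"
  using fock_basis_inner(2)[of 1 i j] by (simp add: fock_inner_gauss)

text \<open>The second property bounds all partial sums on a disc at once. It supplies the majorant
  for dominated convergence in \<open>fock_coefficient\<close> and
  \<open>toeplitz_form_tendsto\<close>.\<close>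

lemma fock_expansion:
  assumes "f \<in> fock_space"
  obtains \<alpha> where "\<And>z. (\<lambda>n. \<alpha> n * fock_basis n z) sums f z"
    "\<And>R. \<exists>C. \<forall>N z. cmod z \<le> R \<longrightarrow> cmod (\<Sum>n<N. \<alpha> n * fock_basis n z) \<le> C"
proof -
  define a where "a n = (deriv ^^ n) f 0 / fact n" for n
  define \<alpha> where "\<alpha> n = a n / complex_of_real (fock_coeff n)" for n
  have f: "f holomorphic_on UNIV" using assms by (simp add: fock_space_gauss)
  have sums: "(\<lambda>n. a n * z ^ n) sums f z" for z
    using holomorphic_power_series[of f 0 "cmod z + 1" z] holomorphic_on_subset[OF f] by (auto simp: a_def)
  have eq: "\<alpha> n * fock_basis n z = a n * z ^ n" for n z
    using fock_coeff_pos[of n] by (simp add: \<alpha>_def fock_basis_def)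
  show ?thesis
  proof
    show "(\<lambda>n. \<alpha> n * fock_basis n z) sums f z" for z
      using sums by (simp add: eq)
    fix R :: real
    define R' where "R' = max R 0"
    \<comment> \<open>Convergence at the larger radius \<open>R' + 1\<close> gives absolute
      convergence at \<open>R'\<close>.\<close>
    have "summable (\<lambda>n. norm (a n * complex_of_real R' ^ n))"
      by (rule powser_insidea[of _ "complex_of_real (R' + 1)"]) (use sums sums_summable in \<open>auto simp: R'_def\<close>)
    then have sm: "summable (\<lambda>n. cmod (a n) * R' ^ n)"
      by (simp add: norm_mult norm_power R'_def)
    show "\<exists>C. \<forall>N z. cmod z \<le> R \<longrightarrow> cmod (\<Sum>n<N. \<alpha> n * fock_basis n z) \<le> C"
    proof (intro exI[of _ "\<Sum>n. cmod (a n) * R' ^ n"] allI impI)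
      fix N z assume "cmod z \<le> R"
      then have "cmod (\<Sum>n<N. \<alpha> n * fock_basis n z) \<le> (\<Sum>n<N. cmod (a n) * R' ^ n)"
        by (intro sum_norm_le) (auto simp: eq norm_mult norm_power R'_def intro!: mult_left_mono power_mono)
      also have "\<dots> \<le> (\<Sum>n. cmod (a n) * R' ^ n)"
        by (intro sum_le_suminf sm) (auto simp: R'_def)
      finally show "cmod (\<Sum>n<N. \<alpha> n * fock_basis n z) \<le> (\<Sum>n. cmod (a n) * R' ^ n)" .
    qed
  qed
qed

text \<open>Rotation invariance identifies the Taylor coefficients with inner products, first on discs
  and then in the limit on the whole plane.\<close>

lemma fock_coefficient:
  assumes f: "f \<in> fock_space" and sums: "\<And>z. (\<lambda>n. \<alpha> n * fock_basis n z) sums f z"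
    and bd: "\<And>R. \<exists>C. \<forall>N z. cmod z \<le> R \<longrightarrow> cmod (\<Sum>n<N. \<alpha> n * fock_basis n z) \<le> C"
  shows "fock_inner f (fock_basis m) = \<alpha> m"
proof -
  let ?B = "\<lambda>k. cball 0 (real k) :: complex set"
  let ?g = "\<lambda>z. complex_of_real (gauss z)"
  define L where "L k n = (LINT z|lebesgue. indicator (?B k) z *\<^sub>R (fock_basis n z * cnj (fock_basis m z) * ?g z))" for k n
  have int_basis: "integrable lebesgue (\<lambda>z. indicator (?B k) z *\<^sub>R (fock_basis n z * cnj (fock_basis m z) * ?g z))" for k n
    unfolding set_integrable_def[symmetric]
    by (intro set_integrable_continuous_bounded continuous_intros) auto
  have L0: "L k n = 0" if "n \<noteq> m" for k n
  proof -
    have "L k n = (LINT z|lebesgue. complex_of_real (indicator {..real k} (cmod z)) * (fock_basis n (of_real 1 * z) * cnj (fock_basis m (of_real 1 * z)) * complex_of_real (gauss (of_real 1 * z))))"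
      unfolding L_def by (intro Bochner_Integration.integral_cong) (auto simp: indicator_def)
    also have "\<dots> = 0" by (rule fock_basis_orthogonal[OF that]) auto
    finally show ?thesis .
  qed
  \<comment> \<open>On a disc the partial sums may be integrated term by term, and only the term
    with \<open>n = m\<close> survives; its factor \<open>L k m\<close> tends to 1 as the disc
    grows.\<close>
  have disc: "(LINT z|lebesgue. indicator (?B k) z *\<^sub>R (f z * cnj (fock_basis m z) * ?g z)) = \<alpha> m * L k m" for k
  proof -
    obtain C where C: "\<And>N z. cmod z \<le> real k \<Longrightarrow> cmod (\<Sum>n<N. \<alpha> n * fock_basis n z) \<le> C"
      using bd[of "real k"] by blast
    have "(\<lambda>N. LINT z|lebesgue. indicator (?B k) z *\<^sub>R ((\<Sum>n<N. \<alpha> n * fock_basis n z) * cnj (fock_basis m z) * ?g z))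
       \<longlonglongrightarrow> (LINT z|lebesgue. indicator (?B k) z *\<^sub>R (f z * cnj (fock_basis m z) * ?g z))"
    proof (rule integral_dominated_convergence)
      show "(\<lambda>z. indicator (?B k) z *\<^sub>R (f z * cnj (fock_basis m z) * ?g z)) \<in> borel_measurable lebesgue"
      proof -
        have "set_integrable lebesgue (?B k) (\<lambda>z. f z * cnj (fock_basis m z) * ?g z)"
          by (intro set_integrable_continuous_bounded continuous_intros fock_space_continuous f) auto
        then show ?thesis unfolding set_integrable_def by (rule borel_measurable_integrable)
      qed
      show "(\<lambda>z. indicator (?B k) z *\<^sub>R ((\<Sum>n<N. \<alpha> n * fock_basis n z) * cnj (fock_basis m z) * ?g z)) \<in> borel_measurable lebesgue" for N
      proof -
        have "set_integrable lebesgue (?B k) (\<lambda>z. (\<Sum>n<N. \<alpha> n * fock_basis n z) * cnj (fock_basis m z) * ?g z)"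
          by (intro set_integrable_continuous_bounded continuous_intros) auto
        then show ?thesis unfolding set_integrable_def by (rule borel_measurable_integrable)
      qed
      show "integrable lebesgue (\<lambda>z. indicator (?B k) z *\<^sub>R (C * cmod (fock_basis m z) * gauss z))"
        unfolding set_integrable_def[symmetric]
        by (intro set_integrable_continuous_bounded continuous_intros) auto
      show "AE z in lebesgue. (\<lambda>N. indicator (?B k) z *\<^sub>R ((\<Sum>n<N. \<alpha> n * fock_basis n z) * cnj (fock_basis m z) * ?g z))
         \<longlonglongrightarrow> indicator (?B k) z *\<^sub>R (f z * cnj (fock_basis m z) * ?g z)"
        using sums unfolding sums_def by (intro AE_I2 tendsto_intros)
      show "AE z in lebesgue. norm (indicator (?B k) z *\<^sub>R ((\<Sum>n<N. \<alpha> n * fock_basis n z) * cnj (fock_basis m z) * ?g z))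
          \<le> indicator (?B k) z *\<^sub>R (C * cmod (fock_basis m z) * gauss z)" for N
        using C[of _ N]
        by (intro AE_I2) (auto simp: norm_mult indicator_def gauss_nonneg intro!: mult_right_mono)
    qed
    moreover have "(LINT z|lebesgue. indicator (?B k) z *\<^sub>R ((\<Sum>n<N. \<alpha> n * fock_basis n z) * cnj (fock_basis m z) * ?g z)) = \<alpha> m * L k m"
      if "m < N" for N
    proof -
      have "(LINT z|lebesgue. indicator (?B k) z *\<^sub>R ((\<Sum>n<N. \<alpha> n * fock_basis n z) * cnj (fock_basis m z) * ?g z))
         = (LINT z|lebesgue. (\<Sum>n<N. \<alpha> n * (indicator (?B k) z *\<^sub>R (fock_basis n z * cnj (fock_basis m z) * ?g z))))"
        by (intro Bochner_Integration.integral_cong refl)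
           (simp add: sum_distrib_right sum_distrib_left scaleR_conv_of_real mult_ac)
      also have "\<dots> = (\<Sum>n<N. \<alpha> n * L k n)"
        unfolding L_def Bochner_Integration.integral_mult_right_zero[symmetric]
        by (intro Bochner_Integration.integral_sum integrable_mult_right int_basis)
      also have "\<dots> = (\<Sum>n<N. if n = m then \<alpha> m * L k m else 0)"
        by (intro sum.cong refl) (auto simp: L0)
      also have "\<dots> = \<alpha> m * L k m" using that by simp
      finally show ?thesis .
    qed
    then have "(\<lambda>N. LINT z|lebesgue. indicator (?B k) z *\<^sub>R ((\<Sum>n<N. \<alpha> n * fock_basis n z) * cnj (fock_basis m z) * ?g z)) \<longlonglongrightarrow> \<alpha> m * L k m"
      by (intro tendsto_eventually) (auto simp: eventually_sequentially intro!: exI[of _ "Suc m"])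
    ultimately show ?thesis by (rule LIMSEQ_unique)
  qed
  have exhaust: "(\<lambda>k. LINT z|lebesgue. indicator (?B k) z *\<^sub>R F z) \<longlonglongrightarrow> (LINT z|lebesgue. F z)"
    if "integrable lebesgue F" for F :: "complex \<Rightarrow> complex"
  proof (rule integral_dominated_convergence)
    show "integrable lebesgue (\<lambda>z. norm (F z))" using that by simp
    show "F \<in> borel_measurable lebesgue" using that by simp
    show "(\<lambda>z. indicator (?B k) z *\<^sub>R F z) \<in> borel_measurable lebesgue" for k
      using that by (intro borel_measurable_scaleR borel_measurable_indicator) auto
    show "AE z in lebesgue. norm (indicator (?B k) z *\<^sub>R F z) \<le> norm (F z)" for k
      by (intro AE_I2) (auto simp: indicator_def)
    show "AE z in lebesgue. (\<lambda>k. indicator (?B k) z *\<^sub>R F z) \<longlonglongrightarrow> F z"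
    proof (rule AE_I2)
      fix z :: complex
      obtain k0 :: nat where "cmod z \<le> real k0" using real_arch_simple by blast
      then show "(\<lambda>k. indicator (?B k) z *\<^sub>R F z) \<longlonglongrightarrow> F z"
        by (intro tendsto_eventually) (auto simp: eventually_sequentially indicator_def intro!: exI[of _ k0])
    qed
  qed
  have "(\<lambda>k. \<alpha> m * L k m) \<longlonglongrightarrow> fock_inner f (fock_basis m)"
    using exhaust[OF fock_inner_integrable[OF f fock_basis_in_fock_space[of m]]] unfolding disc fock_inner_gauss .
  moreover have "(\<lambda>k. L k m) \<longlonglongrightarrow> fock_inner (fock_basis m) (fock_basis m)"
    using exhaust[OF fock_inner_integrable[OF fock_basis_in_fock_space[of m] fock_basis_in_fock_space[of m]]]
    unfolding L_def fock_inner_gauss .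
  then have "(\<lambda>k. \<alpha> m * L k m) \<longlonglongrightarrow> \<alpha> m * 1"
    unfolding fock_basis_orthonormal by (intro tendsto_mult_left) simp
  ultimately show ?thesis
    using LIMSEQ_unique by fastforce
qed

text \<open>At truncation \<open>M\<close> the form is the concentration on \<open>S\<close> of the
  Taylor polynomial of degree below \<open>M\<close>, and these polynomials are uniformly bounded on
  the bounded set \<open>S\<close>.\<close>

lemma toeplitz_form_tendsto:
  assumes S: "bounded S" "S \<in> sets lebesgue" and f: "f \<in> fock_space"
  shows "(\<lambda>M. Re (sesq M (toeplitz S 1) (\<lambda>i. fock_inner f (fock_basis i)) (\<lambda>i. fock_inner f (fock_basis i))))
     \<longlonglongrightarrow> (LINT z:S|lebesgue. (cmod (f z))\<^sup>2 * gauss z)"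
proof -
  obtain \<alpha> where \<alpha>: "\<And>z. (\<lambda>n. \<alpha> n * fock_basis n z) sums f z"
    "\<And>R. \<exists>C. \<forall>N z. cmod z \<le> R \<longrightarrow> cmod (\<Sum>n<N. \<alpha> n * fock_basis n z) \<le> C"
    using fock_expansion[OF f] by metis
  have eq: "fock_inner f (fock_basis i) = \<alpha> i" for i
    by (rule fock_coefficient[OF f \<alpha>])
  obtain R where R: "\<And>z. z \<in> S \<Longrightarrow> cmod z \<le> R"
    using S(1) unfolding bounded_iff by blast
  obtain C where C: "\<And>N z. cmod z \<le> R \<Longrightarrow> cmod (\<Sum>n<N. \<alpha> n * fock_basis n z) \<le> C"
    using \<alpha>(2)[of R] by blast
  have "(\<lambda>N. LINT z|lebesgue. indicator S z *\<^sub>R ((cmod (\<Sum>n<N. \<alpha> n * fock_basis n z))\<^sup>2 * gauss z))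
     \<longlonglongrightarrow> (LINT z|lebesgue. indicator S z *\<^sub>R ((cmod (f z))\<^sup>2 * gauss z))"
  proof (rule integral_dominated_convergence)
    show "(\<lambda>z. indicat_real S z *\<^sub>R ((cmod (f z))\<^sup>2 * gauss z)) \<in> borel_measurable lebesgue"
    proof -
      have "set_integrable lebesgue S (\<lambda>z. (cmod (f z))\<^sup>2 * gauss z)"
        by (intro set_integrable_continuous_bounded continuous_intros fock_space_continuous f S)
      then show ?thesis unfolding set_integrable_def by (rule borel_measurable_integrable)
    qed
    show "(\<lambda>z. indicat_real S z *\<^sub>R ((cmod (\<Sum>n<N. \<alpha> n * fock_basis n z))\<^sup>2 * gauss z)) \<in> borel_measurable lebesgue" for N
    proof -
      have "set_integrable lebesgue S (\<lambda>z. (cmod (\<Sum>n<N. \<alpha> n * fock_basis n z))\<^sup>2 * gauss z)"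
        by (intro set_integrable_continuous_bounded continuous_intros S)
      then show ?thesis unfolding set_integrable_def by (rule borel_measurable_integrable)
    qed
    show "integrable lebesgue (\<lambda>z. indicat_real S z *\<^sub>R (C\<^sup>2 * gauss z))"
      unfolding set_integrable_def[symmetric]
      by (intro set_integrable_continuous_bounded continuous_intros S)
    show "AE z in lebesgue. (\<lambda>N. indicat_real S z *\<^sub>R ((cmod (\<Sum>n<N. \<alpha> n * fock_basis n z))\<^sup>2 * gauss z))
       \<longlonglongrightarrow> indicat_real S z *\<^sub>R ((cmod (f z))\<^sup>2 * gauss z)"
      using \<alpha>(1) unfolding sums_def by (intro AE_I2 tendsto_intros)
    show "AE z in lebesgue. norm (indicat_real S z *\<^sub>R ((cmod (\<Sum>n<N. \<alpha> n * fock_basis n z))\<^sup>2 * gauss z))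
        \<le> indicat_real S z *\<^sub>R (C\<^sup>2 * gauss z)" for N
      using C[OF R, of _ N]
      by (intro AE_I2) (auto simp: abs_mult indicator_def gauss_nonneg intro!: mult_right_mono power_mono)
  qed
  then show ?thesis
    unfolding eq by (simp add: toeplitz_form[OF S] set_lebesgue_integral_def)
qed

section \<open>From orthonormal functions to the disc\<close>

lemma concentration_le_bounded:
  assumes S: "bounded S" "S \<in> sets lebesgue" "measure lebesgue S \<le> s" and s: "s > 0" and K: "1 \<le> K"
    and f: "fock_orthonormal K f"
  shows "fock_concentration K S f \<le> disc_sum s K 1"
proof (rule field_le_epsilon)
  fix \<epsilon> :: real assume "\<epsilon> > 0"
  interpret ladder_flow "toeplitz S" by (rule ladder_flow_toeplitz) fact+
  define v where "v k i = fock_inner (f k) (fock_basis i)" for k i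
  have fk: "f k \<in> fock_space" if "k \<in> {1..K}" for k
    using f that by (auto simp: fock_orthonormal_def)
  have fo: "fock_inner (f j) (f k) = (if j = k then 1 else 0)" if "j \<in> {1..K}" "k \<in> {1..K}" for j k
    using f that by (auto simp: fock_orthonormal_def)
  have "(\<lambda>M. \<Sum>k=1..K. Re (sesq M (toeplitz S 1) (v k) (v k))) \<longlonglongrightarrow> (\<Sum>k=1..K. LINT z:S|lebesgue. (cmod (f k z))\<^sup>2 * gauss z)"
    unfolding v_def using fk S by (intro tendsto_sum toeplitz_form_tendsto)
  moreover have "\<forall>\<^sub>F M in sequentially. (\<Sum>k=1..K. Re (sesq M (toeplitz S 1) (v k) (v k))) \<le> disc_sum s K 1 + \<epsilon>"
    using topsum_le_disc_sum[OF S s K \<open>\<epsilon> > 0\<close>] eventually_ge_at_top[of K]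
  proof eventually_elim
    case (elim M)
    \<comment> \<open>Cut off at \<open>M\<close>, the coefficient vectors are no longer
      orthonormal. The row bound is Bessel for \<open>f k\<close> against the monomials, the column
      bound is Bessel for a polynomial against the family \<open>f\<close>.\<close>
    have "(\<Sum>k\<in>{1..K}. Re (sesq M (toeplitz S 1) (v k) (v k))) \<le> topsum M K 1"
    proof (rule topsum_ge_subframe)
      show "(\<Sum>i<M. (cmod (v k i))\<^sup>2) \<le> 1" if "k \<in> {1..K}" for k
        using fock_bessel[OF fk[OF that], of "{..<M}" fock_basis] fo[OF that that]
        by (simp add: v_def fock_basis_in_fock_space fock_basis_orthonormal)
      fix u :: "nat \<Rightarrow> complex"
      \<comment> \<open>The polynomial with coefficient vector \<open>u\<close>; its inner product
        with \<open>f k\<close> is the conjugate of \<open>cip M (v k) u\<close>.\<close>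
      define E where "E z = (\<Sum>i<M. u i * fock_basis i z)" for z
      have ue: "(\<lambda>z. u i * fock_basis i z) \<in> fock_space" for i
        by (rule fock_space_scale[OF fock_basis_in_fock_space])
      have E: "E \<in> fock_space" unfolding E_def using ue by (intro fock_space_sum)
      have Eg: "fock_inner E g = (\<Sum>i<M. u i * fock_inner (fock_basis i) g)" if "g \<in> fock_space" for g
        unfolding E_def using fock_inner_sum[OF ue that] by (simp only: fock_inner_scale)
      have "cmod (cip M (v k) u) = cmod (fock_inner E (f k))" if "k \<in> {1..K}" for k
      proof -
        have "cnj (cip M (v k) u) = fock_inner E (f k)"
          unfolding Eg[OF fk[OF that]] by (simp add: cip_def v_def fock_inner_cnj mult.commute)
        then show ?thesis by (metis complex_mod_cnj)
      qed
      then have "(\<Sum>k\<in>{1..K}. (cmod (cip M (v k) u))\<^sup>2) = (\<Sum>k\<in>{1..K}. (cmod (fock_inner E (f k)))\<^sup>2)"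
        by simp
      also have "\<dots> \<le> Re (fock_inner E E)"
        using fk fo by (intro fock_bessel E) auto
      also have "fock_inner E E = (\<Sum>i<M. u i * cnj (u i))"
      proof -
        have "fock_inner (fock_basis i) E = cnj (u i)" if "i < M" for i
        proof -
          have "fock_inner E (fock_basis i) = u i"
            using that by (simp add: Eg fock_basis_in_fock_space fock_basis_orthonormal mult_delta_right)
          then show ?thesis by (metis fock_inner_cnj)
        qed
        then show ?thesis by (simp add: Eg[OF E])
      qed
      also have "Re \<dots> = (\<Sum>i<M. (cmod (u i))\<^sup>2)"
        unfolding mult_cnj_self by simp
      finally show "(\<Sum>k\<in>{1..K}. (cmod (cip M (v k) u))\<^sup>2) \<le> (\<Sum>i<M. (cmod (u i))\<^sup>2)" .
    qed (use elim in auto)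
    with elim show ?case by simp
  qed
  ultimately have "(\<Sum>k=1..K. LINT z:S|lebesgue. (cmod (f k z))\<^sup>2 * gauss z) \<le> disc_sum s K 1 + \<epsilon>"
    by (intro tendsto_upperbound) auto
  then show "fock_concentration K S f \<le> disc_sum s K 1 + \<epsilon>"
    by (simp add: fock_concentration_def gauss_def)
qed

text \<open>Intersecting with growing discs reduces the claim to bounded sets. Their area may be
  smaller than \<open>s\<close>, which is why \<open>concentration_le_bounded\<close> allows any
  measure up to \<open>s\<close>.\<close>

lemma concentration_le:
  assumes S: "S \<in> sets lebesgue" "emeasure lebesgue S = ennreal s" and s: "s > 0" and K: "1 \<le> K"
    and f: "fock_orthonormal K f"
  shows "fock_concentration K S f \<le> disc_sum s K 1"
proof -
  let ?S = "\<lambda>n. S \<inter> cball 0 (real n)"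
  have fk: "integrable lebesgue (\<lambda>z. (cmod (f k z))\<^sup>2 * gauss z)" if "k \<in> {1..K}" for k
    using f that by (auto simp: fock_orthonormal_def fock_space_gauss)
  have fin: "S \<in> lmeasurable" using S by (simp add: fmeasurable_def)
  have Sm: "?S n \<in> sets lebesgue" for n using S by auto
  have "(\<lambda>n. fock_concentration K (?S n) f) \<longlonglongrightarrow> fock_concentration K S f"
    unfolding fock_concentration_def set_lebesgue_integral_def gauss_def[symmetric]
  proof (intro tendsto_sum integral_dominated_convergence)
    fix k assume k: "k \<in> {1..K}"
    let ?F = "\<lambda>z. (cmod (f k z))\<^sup>2 * gauss z"
    show "integrable lebesgue ?F" by (rule fk[OF k])
    show "(\<lambda>z. indicat_real S z *\<^sub>R ?F z) \<in> borel_measurable lebesgue"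
      using S(1) fk[OF k] by (intro borel_measurable_scaleR borel_measurable_indicator) auto
    show "(\<lambda>z. indicat_real (?S n) z *\<^sub>R ?F z) \<in> borel_measurable lebesgue" for n
      using Sm fk[OF k] by (intro borel_measurable_scaleR borel_measurable_indicator) auto
    show "AE z in lebesgue. norm (indicat_real (?S n) z *\<^sub>R ?F z) \<le> ?F z" for n
      by (intro AE_I2) (auto simp: indicator_def gauss_nonneg)
    show "AE z in lebesgue. (\<lambda>n. indicat_real (?S n) z *\<^sub>R ?F z) \<longlonglongrightarrow> indicat_real S z *\<^sub>R ?F z"
    proof (rule AE_I2)
      fix z :: complex
      obtain n0 :: nat where "cmod z \<le> real n0" using real_arch_simple by blast
      then show "(\<lambda>n. indicat_real (?S n) z *\<^sub>R ?F z) \<longlonglongrightarrow> indicat_real S z *\<^sub>R ?F z"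
        by (intro tendsto_eventually) (auto simp: eventually_sequentially indicator_def intro!: exI[of _ n0])
    qed
  qed
  moreover have "fock_concentration K (?S n) f \<le> disc_sum s K 1" for n
  proof (rule concentration_le_bounded)
    show "bounded (?S n)" by (simp add: bounded_Int)
    show "?S n \<in> sets lebesgue" by (rule Sm)
    have "measure lebesgue (?S n) \<le> measure lebesgue S"
      using fin Sm by (intro measure_mono_fmeasurable) auto
    also have "\<dots> = s" using S s by (simp add: measure_def)
    finally show "measure lebesgue (?S n) \<le> s" .
  qed fact+
  ultimately show ?thesis
    by (intro LIMSEQ_le_const2) auto
qed

lemma disc_sum_attained:
  assumes "s > 0"
  shows "disc_sum s K 1 \<in> concentration_values K s"
proof -
  \<comment> \<open>Orthonormal families are indexed from 1, monomials from 0.\<close>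
  define f where "f k = fock_basis (k - 1)" for k
  have "fock_orthonormal K f"
    by (auto simp: fock_orthonormal_def f_def fock_basis_in_fock_space fock_basis_orthonormal)
  moreover have "fock_concentration K (disc s) f = disc_sum s K 1"
  proof -
    have "fock_concentration K (disc s) f = (\<Sum>k=1..K. Re (toeplitz (disc s) 1 (k - 1) (k - 1)))"
      by (simp add: fock_concentration_def f_def toeplitz_diag gauss_def)
    also have "\<dots> = disc_sum s K 1"
      unfolding disc_sum_def by (rule sum.reindex_bij_witness[of _ Suc "\<lambda>k. k - 1"]) auto
    finally show ?thesis .
  qed
  ultimately show ?thesis
    unfolding concentration_values_def using disc_props[of s] assms
    by (intro CollectI exI[of _ "disc s"] exI[of _ f]) auto
qed

theorem theorem1p2:
  fixes K :: nat and s :: real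
  assumes "K \<ge> 1" and "s > 0"
  shows "bdd_above (concentration_values K s) \<and>
         Sup (concentration_values K s) \<in> concentration_values K s"
proof -
  have le: "x \<le> disc_sum s K 1" if "x \<in> concentration_values K s" for x
    using that concentration_le[OF _ _ assms(2,1)] by (auto simp: concentration_values_def)
  have "Sup (concentration_values K s) = disc_sum s K 1"
    by (rule cSup_eq_maximum[OF disc_sum_attained[OF assms(2)] le])
  moreover have "bdd_above (concentration_values K s)"
    by (rule bdd_aboveI[OF le])
  ultimately show ?thesis
    using disc_sum_attained[OF assms(2)] by simp
qed

end
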